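(* The following are equivalent: (1) For every measurable $E\subset[0,1]$ with $0<|E|$ there is a finite partition $\{A_j\}_{j=1}^r$ of $\mathbb Z$ such that for all $j=1,\dots,r$, $P_E$ is an isomorphism of $S(A_j)$ onto its range. (2) For every $0\ne\phi\in L^2(\mathbb R)$ and every family of real numbers $\{\lambda_n\}_{n\in\Lambda}$, if $\{e^{2\pi i\lambda_nt}\phi\}_{n\in\Lambda}$ is Bessel in $L^2(\mathbb R)$, then it is a finite union of Riesz basic sequences. (3) For every $0\ne\phi\in L^2[0,1]$ and every $\Lambda\subset\mathbb Z$, if $\{e^{2\pi int}\phi\}_{n\in\Lambda}$ is a Bessel sequence, then it is a finite union of Riesz basic sequences. (4) For every $0\ne\phi\in L^2(\mathbb R)$ and every family of real numbers $\{\lambda_n\}_{n\in\Lambda}$, if $\{e^{2\pi i\lambda_nt}\phi\}_{n\in\Lambda}$ is a frame sequence in $L^2(\mathbb R)$, then it is a finite union of Riesz basic sequences. (5) For every $\Lambda\subset\mathbb Z$ and every $0\ne\phi\in L^2[0,1]$, if $\{e^{2\pi int}\phi\}_{n\in\Lambda}$ is a Bessel sequence, then it is a finite union of frame sequences.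
   Context: For $I\subset\mathbb Z$, $S(I)$ is the $L^2([0,1])$-closure of the span of $\{e^{2\pi int}\}_{n\in I}$; $P_Ef=f\cdot\chi_E$ on $L^2[0,1]$; "isomorphism onto its range" means bounded and bounded below. In (2) and (4), $\Lambda$ is an arbitrary countable index set. A family $\{f_i\}_{i\in I}$ in a Hilbert space $\mathbb H$ is: a Bessel sequence if there is $B<\infty$ with $\sum_i|\langle f,f_i\rangle|^2\le B\|f\|^2$ for all $f\in\mathbb H$; a frame for $\mathbb H$ if in addition there is $A>0$ with $A\|f\|^2\le\sum_i|\langle f,f_i\rangle|^2$ for all $f\in\mathbb H$; a frame sequence if it is a frame for its closed linear span; a Riesz basic sequence if there are $A,B>0$ with $A\sum|a_i|^2\le\|\sum a_if_i\|^2\le B\sum|a_i|^2$ for all scalars $\{a_i\}$. A family indexed by $\Lambda$ is a finite union of sequences of a given kind if $\Lambda$ can be partitioned into finitely many subsets such that each corresponding subfamily is of that kind. *)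

theory Defs
  imports "HOL-Analysis.Analysis" "HOL-Library.Disjoint_Sets"
begin

text \<open>Elements of \<open>L\<^sup>2(M)\<close> are represented by square-integrable functions; equality in
  \<open>L\<^sup>2(M)\<close> is equality almost everywhere, and every set of representatives defined below is
  closed under it.\<close>

definition L2 :: "'a measure \<Rightarrow> ('a \<Rightarrow> complex) set" where
  "L2 M = {f \<in> borel_measurable M. integrable M (\<lambda>x. (cmod (f x))\<^sup>2)}"

definition L2_inner :: "'a measure \<Rightarrow> ('a \<Rightarrow> complex) \<Rightarrow> ('a \<Rightarrow> complex) \<Rightarrow> complex" where
  "L2_inner M f g = (LINT x|M. f x * cnj (g x))"

definition L2_norm :: "'a measure \<Rightarrow> ('a \<Rightarrow> complex) \<Rightarrow> real" where
  "L2_norm M f = sqrt (LINT x|M. (cmod (f x))\<^sup>2)"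

definition L2_nonzero :: "'a measure \<Rightarrow> ('a \<Rightarrow> complex) \<Rightarrow> bool" where
  "L2_nonzero M f \<longleftrightarrow> \<not> (AE x in M. f x = 0)"

definition closed_span :: "'a measure \<Rightarrow> ('i \<Rightarrow> 'a \<Rightarrow> complex) \<Rightarrow> 'i set \<Rightarrow> ('a \<Rightarrow> complex) set" where
  "closed_span M F I = {f \<in> L2 M. \<forall>\<epsilon>>0. \<exists>J c. finite J \<and> J \<subseteq> I \<and>
     L2_norm M (\<lambda>x. f x - (\<Sum>j\<in>J. c j * F j x)) < \<epsilon>}"

text \<open>Unconditional convergence of a series in the norm of \<open>L\<^sup>2(M)\<close>.\<close>

definition L2_has_sum ::
  "'a measure \<Rightarrow> ('i \<Rightarrow> 'a \<Rightarrow> complex) \<Rightarrow> 'i set \<Rightarrow> ('a \<Rightarrow> complex) \<Rightarrow> bool" where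
  "L2_has_sum M F I g \<longleftrightarrow> g \<in> L2 M \<and>
     ((\<lambda>J. L2_norm M (\<lambda>x. (\<Sum>i\<in>J. F i x) - g x)) \<longlongrightarrow> 0) (finite_subsets_at_top I)"

text \<open>In the next two definitions \<open>V\<close> plays the role of the Hilbert space: either all of
  \<open>L\<^sup>2(M)\<close> or a closed subspace of it.\<close>

definition bessel_in ::
  "'a measure \<Rightarrow> ('a \<Rightarrow> complex) set \<Rightarrow> ('i \<Rightarrow> 'a \<Rightarrow> complex) \<Rightarrow> 'i set \<Rightarrow> bool" where
  "bessel_in M V F I \<longleftrightarrow> (\<forall>i\<in>I. F i \<in> V) \<and>
     (\<exists>B. \<forall>f\<in>V. (\<lambda>i. (cmod (L2_inner M f (F i)))\<^sup>2) summable_on I \<and>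
        (\<Sum>\<^sub>\<infinity>i\<in>I. (cmod (L2_inner M f (F i)))\<^sup>2) \<le> B * (L2_norm M f)\<^sup>2)"

definition frame_for ::
  "'a measure \<Rightarrow> ('a \<Rightarrow> complex) set \<Rightarrow> ('i \<Rightarrow> 'a \<Rightarrow> complex) \<Rightarrow> 'i set \<Rightarrow> bool" where
  "frame_for M V F I \<longleftrightarrow> bessel_in M V F I \<and>
     (\<exists>A>0. \<forall>f\<in>V. A * (L2_norm M f)\<^sup>2 \<le> (\<Sum>\<^sub>\<infinity>i\<in>I. (cmod (L2_inner M f (F i)))\<^sup>2))"

definition bessel_sequence :: "'a measure \<Rightarrow> ('i \<Rightarrow> 'a \<Rightarrow> complex) \<Rightarrow> 'i set \<Rightarrow> bool" where
  "bessel_sequence M F I \<longleftrightarrow> bessel_in M (L2 M) F I"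

definition frame_sequence :: "'a measure \<Rightarrow> ('i \<Rightarrow> 'a \<Rightarrow> complex) \<Rightarrow> 'i set \<Rightarrow> bool" where
  "frame_sequence M F I \<longleftrightarrow> (\<forall>i\<in>I. F i \<in> L2 M) \<and> frame_for M (closed_span M F I) F I"

text \<open>The scalar families range over all of \<open>\<ell>\<^sup>2(I)\<close>, not just the finitely supported ones, so
  convergence of \<open>\<Sum> a\<^sub>i F\<^sub>i\<close> is part of the condition.\<close>

definition riesz_basic_sequence :: "'a measure \<Rightarrow> ('i \<Rightarrow> 'a \<Rightarrow> complex) \<Rightarrow> 'i set \<Rightarrow> bool" where
  "riesz_basic_sequence M F I \<longleftrightarrow> (\<forall>i\<in>I. F i \<in> L2 M) \<and>
     (\<exists>A>0. \<exists>B>0. \<forall>a :: 'i \<Rightarrow> complex. (\<lambda>i. (cmod (a i))\<^sup>2) summable_on I \<longrightarrow>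
        (\<exists>g. L2_has_sum M (\<lambda>i x. a i * F i x) I g \<and>
           A * (\<Sum>\<^sub>\<infinity>i\<in>I. (cmod (a i))\<^sup>2) \<le> (L2_norm M g)\<^sup>2 \<and>
           (L2_norm M g)\<^sup>2 \<le> B * (\<Sum>\<^sub>\<infinity>i\<in>I. (cmod (a i))\<^sup>2)))"

definition finite_union_of :: "('i set \<Rightarrow> bool) \<Rightarrow> 'i set \<Rightarrow> bool" where
  "finite_union_of Q I \<longleftrightarrow> (\<exists>P. finite P \<and> partition_on I P \<and> (\<forall>A\<in>P. Q A))"

definition iso_onto_range ::
  "'a measure \<Rightarrow> (('a \<Rightarrow> complex) \<Rightarrow> 'a \<Rightarrow> complex) \<Rightarrow> ('a \<Rightarrow> complex) set \<Rightarrow> bool" where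
  "iso_onto_range M T V \<longleftrightarrow> T ` V \<subseteq> L2 M \<and>
     (\<exists>b. \<forall>f\<in>V. L2_norm M (T f) \<le> b * L2_norm M f) \<and>
     (\<exists>a>0. \<forall>f\<in>V. a * L2_norm M f \<le> L2_norm M (T f))"

abbreviation unit_leb :: "real measure" where
  "unit_leb \<equiv> lebesgue_on {0..1}"

definition expi :: "real \<Rightarrow> real \<Rightarrow> complex" where
  "expi l t = exp (2 * complex_of_real pi * \<i> * complex_of_real l * complex_of_real t)"

definition S :: "int set \<Rightarrow> (real \<Rightarrow> complex) set" where
  "S I = closed_span unit_leb (\<lambda>n. expi (of_int n)) I"

definition proj :: "real set \<Rightarrow> (real \<Rightarrow> complex) \<Rightarrow> real \<Rightarrow> complex" where
  "proj E f = (\<lambda>t. f t * indicator E t)"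

definition all_equivalent :: "bool list \<Rightarrow> bool" where
  "all_equivalent Ps \<longleftrightarrow> (\<forall>P\<in>set Ps. \<forall>Q\<in>set Ps. P \<longleftrightarrow> Q)"

text \<open>An arbitrary countable index set is represented by an arbitrary subset of the natural
  numbers (finite or infinite); the families need not be injective.\<close>

definition real_modulations ::
  "(nat \<Rightarrow> real) \<Rightarrow> (real \<Rightarrow> complex) \<Rightarrow> nat \<Rightarrow> real \<Rightarrow> complex" where
  "real_modulations l \<phi> n = (\<lambda>t. expi (l n) t * \<phi> t)"

definition int_modulations :: "(real \<Rightarrow> complex) \<Rightarrow> int \<Rightarrow> real \<Rightarrow> complex" where
  "int_modulations \<phi> n = (\<lambda>t. expi (of_int n) t * \<phi> t)"

end

theory Submission
  imports Defs
begin

text \<open>Write \<open>e\<^sub>n(t) = exp (2 \<pi> \<i> n t)\<close> and \<open>\<chi>\<^sub>E\<close> for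
the indicator function of \<open>E\<close>. All five statements are about one question: whether a
bounded synthesis map \<open>c \<mapsto> \<Sum> c\<^sub>i F\<^sub>i\<close> becomes bounded below
once its index set is cut into finitely many pieces. A Bessel sequence is a family whose synthesis
map is bounded on finitely supported coefficients, and a Riesz basic sequence one for which it is
bounded above and below (\<open>bessel_sequence_iff\<close>,
\<open>riesz_basic_sequence_iff\<close>); completeness of \<open>L\<^sup>2\<close> takes care of
infinite sums. Because the \<open>e\<^sub>n\<close> are orthonormal, \<open>P\<^sub>E\<close> is
an isomorphism of \<open>S(A)\<close> onto its range exactly when \<open>{e\<^sub>n
\<chi>\<^sub>E}\<close>, \<open>n \<in> A\<close>, is bounded below in this sense
(\<open>iso_onto_range_iff_synth_lower\<close>). The statements are linked by the cycles (1)
\<open>\<Rightarrow>\<close> (2) \<open>\<Rightarrow>\<close> (4) \<open>\<Rightarrow>\<close> (1)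
and (2) \<open>\<Rightarrow>\<close> (3) \<open>\<Rightarrow>\<close> (5)
\<open>\<Rightarrow>\<close> (1).

(1) \<open>\<Rightarrow>\<close> (2). A nonzero \<open>\<phi>\<close> satisfies
\<open>\<bar>\<phi>\<bar> \<ge> c > 0\<close> on an integer translate of some \<open>E \<subseteq>
[0,1]\<close> of positive measure, so it is enough to bound the exponentials from below in
\<open>L\<^sup>2(E)\<close>. The Bessel bound limits the number of
\<open>\<lambda>\<^sub>n\<close> in each short interval. After finitely many cuts, therefore, the
integer parts of the \<open>\<lambda>\<^sub>n\<close> are distinct and lie in one of the sets
\<open>A\<^sub>j\<close> that (1) provides for \<open>E\<close>, while their fractional parts
agree up to a small error. Such a family is a small perturbation, in the manner of Paley and
Wiener, of integer exponentials with frequencies in \<open>A\<^sub>j\<close>, so it inherits their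
lower bound (\<open>perturbed_exponentials\<close>, \<open>real_bessel_union_riesz\<close>).

(4) \<open>\<Rightarrow>\<close> (1). The family \<open>{e\<^sub>n \<chi>\<^sub>E}\<close>,
\<open>n \<in> \<int>\<close>, is a frame sequence for every \<open>E\<close>, by Bessel's
inequality and the density of trigonometric polynomials (\<open>frame_sequence_indicator\<close>);
the pieces given by (4) are those required in (1).

(5) \<open>\<Rightarrow>\<close> (1). For \<open>\<Lambda> = \<int>\<close> and \<open>\<phi> =
\<chi>\<^sub>E\<close> the conclusion of (5) carries no information, for the reason just given.
With \<open>\<Lambda> = \<nat>\<close> it does: a square-integrable function on the circle that
has no negative frequencies and vanishes on a set of positive measure is zero
(\<open>hardy_vanishing\<close>). The synthesis map of \<open>{e\<^sub>n \<chi>\<^sub>E}\<close>,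
\<open>n \<in> A \<subseteq> \<nat>\<close>, is therefore injective, and a frame sequence with
injective synthesis map is a Riesz basic sequence
(\<open>frame_sequence_injective_imp_riesz\<close>). Complex conjugation transports the result to
the negative integers.

The remaining implications hold because Riesz basic sequences are frame sequences, frame sequences
are Bessel sequences, and \<open>L\<^sup>2([0,1])\<close> embeds into
\<open>L\<^sup>2(\<real>)\<close> by extension with zero.\<close>

section \<open>Square-integrable functions\<close>

abbreviation lincomb :: "'i set \<Rightarrow> ('i \<Rightarrow> complex) \<Rightarrow> ('i \<Rightarrow> 'a \<Rightarrow> complex) \<Rightarrow> 'a \<Rightarrow> complex" where
  "lincomb J c F \<equiv> (\<lambda>x. \<Sum>j\<in>J. c j * F j x)"

abbreviation energy :: "'i set \<Rightarrow> ('i \<Rightarrow> complex) \<Rightarrow> real" where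
  "energy J c \<equiv> (\<Sum>j\<in>J. (cmod (c j))\<^sup>2)"

abbreviation analysis_energy :: "'a measure \<Rightarrow> ('i \<Rightarrow> 'a \<Rightarrow> complex) \<Rightarrow> 'i set \<Rightarrow> ('a \<Rightarrow> complex) \<Rightarrow> real" where
  "analysis_energy M F I f \<equiv> (\<Sum>\<^sub>\<infinity>i\<in>I. (cmod (L2_inner M f (F i)))\<^sup>2)"

lemma L2_measurable: "f \<in> L2 M \<Longrightarrow> f \<in> borel_measurable M"
  by (simp add: L2_def)

lemma L2_sq_integrable: "f \<in> L2 M \<Longrightarrow> integrable M (\<lambda>x. (cmod (f x))\<^sup>2)"
  by (simp add: L2_def)

lemma L2_norm_nonneg [simp]: "0 \<le> L2_norm M f"
  by (simp add: L2_norm_def)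

lemma L2_norm_sq: "(L2_norm M f)\<^sup>2 = (LINT x|M. (cmod (f x))\<^sup>2)"
  by (simp add: L2_norm_def)

text \<open>Pointwise domination is the source of most membership and norm estimates below: scaling,
restriction to a set and multiplication by a bounded function are all instances.\<close>

lemma L2_dominated:
  assumes "g \<in> L2 M" "f \<in> borel_measurable M" "\<And>x. x \<in> space M \<Longrightarrow> cmod (f x) \<le> C * cmod (g x)"
  shows "f \<in> L2 M" and "0 \<le> C \<Longrightarrow> L2_norm M f \<le> C * L2_norm M g"
proof -
  have le: "(cmod (f x))\<^sup>2 \<le> C\<^sup>2 * (cmod (g x))\<^sup>2" if "x \<in> space M" for x
    using power_mono[OF assms(3)[OF that], of 2] by (simp add: power_mult_distrib)
  have int: "integrable M (\<lambda>x. (cmod (f x))\<^sup>2)"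
    by (rule Bochner_Integration.integrable_bound[where f = "\<lambda>x. C\<^sup>2 * (cmod (g x))\<^sup>2"])
       (use assms(1,2) le in \<open>auto simp: L2_sq_integrable intro!: AE_I2\<close>)
  then show "f \<in> L2 M" using assms(2) by (simp add: L2_def)
  assume C: "0 \<le> C"
  have "(LINT x|M. (cmod (f x))\<^sup>2) \<le> (LINT x|M. C\<^sup>2 * (cmod (g x))\<^sup>2)"
    by (rule integral_mono) (use int le assms(1) in \<open>auto simp: L2_sq_integrable\<close>)
  then have "(L2_norm M f)\<^sup>2 \<le> (C * L2_norm M g)\<^sup>2"
    by (simp add: L2_norm_sq power_mult_distrib)
  then show "L2_norm M f \<le> C * L2_norm M g"
    using C by (rule_tac power2_le_imp_le) auto
qed

lemma L2_scale: "f \<in> L2 M \<Longrightarrow> (\<lambda>x. c * f x) \<in> L2 M"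
  by (rule L2_dominated(1)[where C = "cmod c" and g = f])
    (auto simp: norm_mult intro!: borel_measurable_times borel_measurable_const dest: L2_measurable)

lemma L2_norm_scale: "L2_norm M (\<lambda>x. c * f x) = cmod c * L2_norm M f"
  by (simp add: L2_norm_def norm_mult power_mult_distrib real_sqrt_mult)

lemma L2_zero [simp]: "(\<lambda>x. 0) \<in> L2 M"
  by (simp add: L2_def)

lemma L2_add: assumes "f \<in> L2 M" "g \<in> L2 M" shows "(\<lambda>x. f x + g x) \<in> L2 M"
proof -
  have "integrable M (\<lambda>x. (cmod (f x + g x))\<^sup>2)"
  proof (rule Bochner_Integration.integrable_bound)
    show "integrable M (\<lambda>x. 2 * (cmod (f x))\<^sup>2 + 2 * (cmod (g x))\<^sup>2)"
      using assms by (simp add: L2_sq_integrable)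
    have "(cmod (f x + g x))\<^sup>2 \<le> 2 * (cmod (f x))\<^sup>2 + 2 * (cmod (g x))\<^sup>2" for x
      using power_mono[OF norm_triangle_ineq[of "f x" "g x"], of 2]
        sum_squares_bound[of "cmod (f x)" "cmod (g x)"]
      by (simp add: power2_sum)
    then show "AE x in M. norm ((cmod (f x + g x))\<^sup>2) \<le> norm (2 * (cmod (f x))\<^sup>2 + 2 * (cmod (g x))\<^sup>2)"
      by (intro AE_I2) (metis abs_of_nonneg order_trans real_norm_def zero_le_power2)
  qed (use assms in \<open>auto simp: L2_def\<close>)
  then show ?thesis using assms by (auto simp: L2_def)
qed

lemma L2_diff: "f \<in> L2 M \<Longrightarrow> g \<in> L2 M \<Longrightarrow> (\<lambda>x. f x - g x) \<in> L2 M"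
  using L2_add[of f M "\<lambda>x. (-1) * g x"] L2_scale[of g M "-1"] by simp

lemma L2_sum: "(\<And>i. i \<in> J \<Longrightarrow> F i \<in> L2 M) \<Longrightarrow> (\<lambda>x. \<Sum>i\<in>J. F i x) \<in> L2 M"
  by (induction J rule: infinite_finite_induct) (auto intro: L2_add)

lemma L2_combination: "(\<And>i. i \<in> J \<Longrightarrow> F i \<in> L2 M) \<Longrightarrow> (lincomb J c F) \<in> L2 M"
  by (intro L2_sum L2_scale)

lemma L2_prod_integrable:
  assumes "f \<in> L2 M" "g \<in> L2 M" shows "integrable M (\<lambda>x. f x * cnj (g x))"
proof (rule Bochner_Integration.integrable_bound)
  show "integrable M (\<lambda>x. (cmod (f x))\<^sup>2 + (cmod (g x))\<^sup>2)"
    using assms by (simp add: L2_sq_integrable)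
  have "cmod (f x) * cmod (g x) \<le> (cmod (f x))\<^sup>2 + (cmod (g x))\<^sup>2" for x
    using sum_squares_bound[of "cmod (f x)" "cmod (g x)"] mult_nonneg_nonneg[of "cmod (f x)" "cmod (g x)"]
    by (simp del: mult_nonneg_nonneg)
  then show "AE x in M. norm (f x * cnj (g x)) \<le> norm ((cmod (f x))\<^sup>2 + (cmod (g x))\<^sup>2)"
    by (intro AE_I2) (simp add: norm_mult)
  have "(\<lambda>x. f x * cnj (g x)) \<in> borel_measurable M"
    using assms[THEN L2_measurable]
    by (intro borel_measurable_times measurable_compose[of g M borel cnj borel])
      (auto intro!: borel_measurable_continuous_onI continuous_intros)
  then show "(\<lambda>x. f x * cnj (g x)) \<in> borel_measurable M" .
qed

lemma L2_inner_scale_left: "L2_inner M (\<lambda>x. c * f x) g = c * L2_inner M f g"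
  by (simp add: L2_inner_def mult.assoc)

lemma L2_inner_commute: "L2_inner M g f = cnj (L2_inner M f g)"
  unfolding L2_inner_def by (subst Bochner_Integration.integral_cnj[symmetric]) (simp add: mult.commute)

lemma L2_inner_scale_right: "L2_inner M f (\<lambda>x. c * g x) = cnj c * L2_inner M f g"
  by (metis L2_inner_commute L2_inner_scale_left complex_cnj_mult)

lemma L2_inner_add_left:
  "f \<in> L2 M \<Longrightarrow> g \<in> L2 M \<Longrightarrow> h \<in> L2 M \<Longrightarrow>
    L2_inner M (\<lambda>x. f x + g x) h = L2_inner M f h + L2_inner M g h"
  by (simp add: L2_inner_def distrib_right L2_prod_integrable)

lemma L2_inner_diff_left:
  "f \<in> L2 M \<Longrightarrow> g \<in> L2 M \<Longrightarrow> h \<in> L2 M \<Longrightarrow>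
    L2_inner M (\<lambda>x. f x - g x) h = L2_inner M f h - L2_inner M g h"
  by (simp add: L2_inner_def left_diff_distrib L2_prod_integrable)

lemma L2_inner_combination_left:
  "(\<And>i. i \<in> J \<Longrightarrow> F i \<in> L2 M) \<Longrightarrow> h \<in> L2 M \<Longrightarrow>
    L2_inner M (lincomb J c F) h = (\<Sum>i\<in>J. c i * L2_inner M (F i) h)"
proof (induction J rule: infinite_finite_induct)
  case (insert j J)
  have "(\<lambda>x. c j * F j x) \<in> L2 M" "lincomb J c F \<in> L2 M"
    using insert by (auto intro!: L2_scale L2_combination)
  then show ?case using insert by (simp add: L2_inner_add_left L2_inner_scale_left)
qed (auto simp: L2_inner_def)

lemma L2_inner_combination_right:
  assumes "\<And>i. i \<in> J \<Longrightarrow> F i \<in> L2 M" "h \<in> L2 M"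
  shows "L2_inner M h (lincomb J c F) = (\<Sum>i\<in>J. cnj (c i) * L2_inner M h (F i))"
  by (subst L2_inner_commute, subst L2_inner_combination_left)
     (use assms in \<open>auto simp: L2_inner_commute[of M h]\<close>)

lemma L2_inner_self: "L2_inner M f f = of_real ((L2_norm M f)\<^sup>2)"
  by (simp add: L2_inner_def L2_norm_sq flip: complex_norm_square integral_complex_of_real)

lemma L2_norm_diff_sq:
  assumes "f \<in> L2 M" "g \<in> L2 M"
  shows "(L2_norm M (\<lambda>x. f x - g x))\<^sup>2 = (L2_norm M f)\<^sup>2 - 2 * Re (L2_inner M f g) + (L2_norm M g)\<^sup>2"
proof -
  have p: "(cmod (f x - g x))\<^sup>2 = (cmod (f x))\<^sup>2 - 2 * Re (f x * cnj (g x)) + (cmod (g x))\<^sup>2" for x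
    unfolding cmod_power2 by (simp add: power2_eq_square algebra_simps)
  have "integrable M (\<lambda>x. Re (f x * cnj (g x)))"
    using L2_prod_integrable[OF assms] by (rule integrable_Re)
  moreover have "(LINT x|M. Re (f x * cnj (g x))) = Re (L2_inner M f g)"
    unfolding L2_inner_def by (rule integral_Re[OF L2_prod_integrable[OF assms]])
  ultimately show ?thesis
    unfolding L2_norm_sq p using assms[THEN L2_sq_integrable]
    by (simp del: times_complex.sel)
qed

lemma L2_norm_eq_0_iff: "f \<in> L2 M \<Longrightarrow> L2_norm M f = 0 \<longleftrightarrow> (AE x in M. f x = 0)"
  by (simp add: L2_norm_def integral_nonneg_eq_0_iff_AE L2_sq_integrable)

lemma L2_Cauchy_Schwarz:
  assumes "f \<in> L2 M" "g \<in> L2 M"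
  shows "cmod (L2_inner M f g) \<le> L2_norm M f * L2_norm M g"
proof (cases "L2_norm M g = 0")
  case True
  then have "AE x in M. f x * cnj (g x) = 0" using assms by (auto simp: L2_norm_eq_0_iff)
  then have "L2_inner M f g = 0" unfolding L2_inner_def by (rule integral_eq_zero_AE)
  then show ?thesis by simp
next
  case False
  define a n where "a = L2_inner M f g" and "n = (L2_norm M g)\<^sup>2"
  have n: "n > 0" using False by (simp add: n_def)
  \<comment> \<open>the coefficient of the orthogonal projection of \<open>f\<close> onto
  \<open>g\<close>\<close>
  define s where "s = a / of_real n"
  have "0 \<le> (L2_norm M (\<lambda>x. f x - s * g x))\<^sup>2" by simp
  also have "\<dots> = (L2_norm M f)\<^sup>2 - 2 * Re (cnj s * a) + (cmod s * L2_norm M g)\<^sup>2"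
    unfolding a_def L2_norm_diff_sq[OF assms(1) L2_scale[OF assms(2)]] L2_inner_scale_right L2_norm_scale ..
  also have "cnj s * a = of_real ((cmod a)\<^sup>2 / n)"
    by (simp add: s_def complex_norm_square mult.commute del: of_real_power)
  also have "(cmod s * L2_norm M g)\<^sup>2 = (cmod a)\<^sup>2 / n"
    using n by (simp add: s_def norm_divide power_mult_distrib power_divide flip: n_def) (simp add: power2_eq_square)
  finally have "(cmod a)\<^sup>2 / n \<le> (L2_norm M f)\<^sup>2" by simp
  then have "(cmod a)\<^sup>2 \<le> (L2_norm M f * L2_norm M g)\<^sup>2"
    using n by (simp add: field_simps power_mult_distrib flip: n_def)
  then show ?thesis unfolding a_def[symmetric] by (rule power2_le_imp_le) simp
qed

lemma L2_triangle_diff: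
  assumes "f \<in> L2 M" "g \<in> L2 M"
  shows "L2_norm M (\<lambda>x. f x - g x) \<le> L2_norm M f + L2_norm M g"
proof (rule power2_le_imp_le)
  have "\<bar>Re (L2_inner M f g)\<bar> \<le> L2_norm M f * L2_norm M g"
    using L2_Cauchy_Schwarz[OF assms] abs_Re_le_cmod order_trans by blast
  then show "(L2_norm M (\<lambda>x. f x - g x))\<^sup>2 \<le> (L2_norm M f + L2_norm M g)\<^sup>2"
    unfolding L2_norm_diff_sq[OF assms] by (simp add: power2_sum abs_le_iff)
qed simp

lemma L2_triangle:
  assumes "f \<in> L2 M" "g \<in> L2 M"
  shows "L2_norm M (\<lambda>x. f x + g x) \<le> L2_norm M f + L2_norm M g"
  using L2_triangle_diff[OF assms(1) L2_scale[OF assms(2), of "-1"]] L2_norm_scale[of M "-1" g] by simp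

lemma L2_norm_minus_commute: "L2_norm M (\<lambda>x. f x - g x) = L2_norm M (\<lambda>x. g x - f x)"
  by (simp add: L2_norm_def norm_minus_commute)

lemma L2_norm_diff_ge:
  assumes "f \<in> L2 M" "g \<in> L2 M"
  shows "\<bar>L2_norm M f - L2_norm M g\<bar> \<le> L2_norm M (\<lambda>x. f x - g x)"
  using L2_triangle[OF L2_diff[OF assms] assms(2)] L2_triangle_diff[OF assms(1) L2_diff[OF assms]]
  by (simp add: abs_le_iff)

lemma L2_norm_sum_le:
  assumes "\<And>i. i \<in> J \<Longrightarrow> F i \<in> L2 M"
  shows "L2_norm M (\<lambda>x. \<Sum>i\<in>J. F i x) \<le> (\<Sum>i\<in>J. L2_norm M (F i))"
  using assms
proof (induction J rule: infinite_finite_induct)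
  case (insert j J)
  then have "L2_norm M (\<lambda>x. F j x + (\<Sum>i\<in>J. F i x)) \<le> L2_norm M (F j) + L2_norm M (\<lambda>x. \<Sum>i\<in>J. F i x)"
    by (intro L2_triangle L2_sum) auto
  with insert show ?case by simp
qed (auto simp: L2_norm_def)

text \<open>The Riesz-Fischer argument. Along a subsequence the increments \<open>d\<^sub>k\<close> satisfy
\<open>\<parallel>d\<^sub>k\<parallel> \<le> 2\<^sup>-\<^sup>k\<close>, so the series of
\<open>2\<^sup>k \<bar>d\<^sub>k\<bar>\<^sup>2\<close> has finite integral and converges almost
everywhere. Since \<open>\<bar>d\<^sub>k\<bar> \<le> 2\<^sup>-\<^sup>k + 2\<^sup>k
\<bar>d\<^sub>k\<bar>\<^sup>2\<close>, the subsequence itself converges almost everywhere, and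
Fatou's lemma makes this limit a limit in norm.\<close>

lemma L2_complete:
  assumes L: "\<And>n. g n \<in> L2 M"
    and C: "\<And>e. 0 < e \<Longrightarrow> \<exists>N. \<forall>m\<ge>N. \<forall>n\<ge>N. L2_norm M (\<lambda>x. g m x - g n x) < e"
  obtains h where "h \<in> L2 M" "(\<lambda>n. L2_norm M (\<lambda>x. g n x - h x)) \<longlonglongrightarrow> 0"
proof -
  obtain N where N: "\<And>k m n. m \<ge> N k \<Longrightarrow> n \<ge> N k \<Longrightarrow> L2_norm M (\<lambda>x. g m x - g n x) < (1/2)^k"
  proof -
    have "\<forall>k. \<exists>N. \<forall>m\<ge>N. \<forall>n\<ge>N. L2_norm M (\<lambda>x. g m x - g n x) < (1/2)^k" using C by simp
    then show ?thesis using that by metis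
  qed
  define r where "r k = k + (\<Sum>j\<le>k. N j)" for k
  have rN: "r k \<ge> N k" "r (Suc k) \<ge> N k" "r k \<ge> k" for k
  proof -
    have "N k \<le> (\<Sum>j\<le>k. N j)" by (rule member_le_sum) auto
    then show "r k \<ge> N k" "r (Suc k) \<ge> N k" "r k \<ge> k" by (simp_all add: r_def)
  qed
  have rmono: "r k \<le> r (Suc k)" for k by (simp add: r_def)
  define d where "d k x = g (r (Suc k)) x - g (r k) x" for k x
  have dL: "d k \<in> L2 M" for k unfolding d_def by (intro L2_diff L)
  note [measurable] = L[THEN L2_measurable] dL[THEN L2_measurable]
  have dint: "(\<integral>\<^sup>+x. ennreal (2^k * (cmod (d k x))\<^sup>2) \<partial>M) \<le> ennreal ((1/2)^k)" for k
  proof -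
    have "(\<integral>\<^sup>+x. ennreal (2^k * (cmod (d k x))\<^sup>2) \<partial>M) = ennreal (2^k * (L2_norm M (d k))\<^sup>2)"
      unfolding L2_norm_sq using dL[THEN L2_sq_integrable, of k]
      by (subst nn_integral_eq_integral) auto
    also have "(L2_norm M (d k))\<^sup>2 \<le> ((1/2)^k)\<^sup>2"
      unfolding d_def using N[OF rN(2,1), of k] by (intro power_mono) auto
    then have "2^k * (L2_norm M (d k))\<^sup>2 \<le> (2^k * (1/2)^k) * (1/2)^k"
      by (simp add: power2_eq_square mult.assoc)
    also have "2^k * (1/2)^k = (1::real)" by (simp flip: power_mult_distrib)
    finally show ?thesis by (simp add: ennreal_leI)
  qed
  have "(\<integral>\<^sup>+x. (\<Sum>k. ennreal (2^k * (cmod (d k x))\<^sup>2)) \<partial>M) = (\<Sum>k. \<integral>\<^sup>+x. ennreal (2^k * (cmod (d k x))\<^sup>2) \<partial>M)"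
    by (rule nn_integral_suminf) simp
  also have "\<dots> \<le> (\<Sum>k. ennreal ((1/2)^k))" by (rule suminf_le[OF dint]) auto
  also have "\<dots> = ennreal (\<Sum>k. (1/2)^k)" by (rule suminf_ennreal2) auto
  also have "\<dots> < \<infinity>" by simp
  finally have "(\<integral>\<^sup>+x. (\<Sum>k. ennreal (2^k * (cmod (d k x))\<^sup>2)) \<partial>M) \<noteq> \<infinity>" by simp
  then have AE1: "AE x in M. (\<Sum>k. ennreal (2^k * (cmod (d k x))\<^sup>2)) \<noteq> \<infinity>"
    by (intro nn_integral_PInf_AE) auto
  have conv: "AE x in M. convergent (\<lambda>k. g (r k) x)"
    using AE1
  proof eventually_elim
    case (elim x)
    then have "summable (\<lambda>k. 2^k * (cmod (d k x))\<^sup>2)"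
      by (intro summable_suminf_not_top) auto
    then have s: "summable (\<lambda>k. (1/2)^k + 2^k * (cmod (d k x))\<^sup>2)"
      by (intro summable_add) auto
    have "summable (\<lambda>k. d k x)"
    proof (rule summable_comparison_test'[OF s, of 0])
      fix k
      define u v where "u = (1/2::real)^k" and "v = 2^k * (cmod (d k x))\<^sup>2"
      have uv: "u * v = (cmod (d k x))\<^sup>2" unfolding u_def v_def
        by (simp flip: power_mult_distrib mult.assoc)
      have "(cmod (d k x))\<^sup>2 \<le> (u + v)\<^sup>2"
        unfolding uv[symmetric] power2_sum by (simp add: u_def v_def)
      then show "norm (d k x) \<le> (1/2)^k + 2^k * (cmod (d k x))\<^sup>2"
        unfolding u_def[symmetric] v_def[symmetric]
        by (rule power2_le_imp_le) (simp add: u_def v_def)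
    qed
    then have "convergent (\<lambda>n. \<Sum>k<n. d k x)" by (simp add: summable_iff_convergent)
    then have "convergent (\<lambda>n. g (r n) x - g (r 0) x)"
      unfolding d_def by (subst (asm) sum_lessThan_telescope)
    then have "convergent (\<lambda>n. (g (r n) x - g (r 0) x) + g (r 0) x)"
      by (intro convergent_add convergent_const)
    then show ?case by simp
  qed
  define h where "h x = lim (\<lambda>k. g (r k) x)" for x
  have [measurable]: "h \<in> borel_measurable M" unfolding h_def by (rule borel_measurable_lim_metric) simp
  have fatou: "(\<integral>\<^sup>+x. ennreal ((cmod (g n x - h x))\<^sup>2) \<partial>M) \<le> ennreal (e\<^sup>2)"
    if e: "\<And>m. m \<ge> K \<Longrightarrow> L2_norm M (\<lambda>x. g n x - g m x) < e" for n e K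
  proof -
    have "(\<integral>\<^sup>+x. ennreal ((cmod (g n x - h x))\<^sup>2) \<partial>M) =
        (\<integral>\<^sup>+x. liminf (\<lambda>k. ennreal ((cmod (g n x - g (r k) x))\<^sup>2)) \<partial>M)"
    proof (rule nn_integral_cong_AE, use conv in eventually_elim)
      case (elim x)
      then have "(\<lambda>k. g (r k) x) \<longlonglongrightarrow> h x" unfolding h_def by (simp add: convergent_LIMSEQ_iff)
      then have "(\<lambda>k. ennreal ((cmod (g n x - g (r k) x))\<^sup>2)) \<longlonglongrightarrow> ennreal ((cmod (g n x - h x))\<^sup>2)"
        by (intro tendsto_ennrealI tendsto_intros)
      then show ?case by (rule lim_imp_Liminf[OF trivial_limit_sequentially, symmetric])
    qed
    also have "\<dots> \<le> liminf (\<lambda>k. \<integral>\<^sup>+x. ennreal ((cmod (g n x - g (r k) x))\<^sup>2) \<partial>M)"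
      by (rule nn_integral_liminf) simp
    also have "\<dots> \<le> ennreal (e\<^sup>2)"
    proof (rule Liminf_le)
      show "\<forall>\<^sub>F k in sequentially. (\<integral>\<^sup>+x. ennreal ((cmod (g n x - g (r k) x))\<^sup>2) \<partial>M) \<le> ennreal (e\<^sup>2)"
        using eventually_ge_at_top[of K]
      proof eventually_elim
        case (elim k)
        have "(\<integral>\<^sup>+x. ennreal ((cmod (g n x - g (r k) x))\<^sup>2) \<partial>M) = ennreal ((L2_norm M (\<lambda>x. g n x - g (r k) x))\<^sup>2)"
          unfolding L2_norm_sq using L2_diff[OF L L, THEN L2_sq_integrable]
          by (subst nn_integral_eq_integral) auto
        also have "\<dots> \<le> ennreal (e\<^sup>2)"
          using e[of "r k"] rN(3)[of k] elim by (intro ennreal_leI power_mono) auto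
        finally show ?case .
      qed
    qed simp
    finally show ?thesis .
  qed
  have diffL: "(\<lambda>x. g n x - h x) \<in> L2 M \<and> L2_norm M (\<lambda>x. g n x - h x) \<le> e"
    if e: "\<And>m. m \<ge> K \<Longrightarrow> L2_norm M (\<lambda>x. g n x - g m x) < e" for n e K
  proof -
    have e0: "0 < e" using e[of K] by (meson L2_norm_nonneg le_less_trans order_refl)
    have int: "integrable M (\<lambda>x. (cmod (g n x - h x))\<^sup>2)"
      by (rule integrableI_bounded) (simp_all add: order_le_less_trans[OF fatou[OF e] ennreal_less_top])
    have "ennreal (LINT x|M. (cmod (g n x - h x))\<^sup>2) \<le> ennreal (e\<^sup>2)"
      using fatou[OF e] by (subst (asm) nn_integral_eq_integral[OF int]) auto
    then have "(L2_norm M (\<lambda>x. g n x - h x))\<^sup>2 \<le> e\<^sup>2" by (simp add: L2_norm_sq)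
    then show ?thesis using int e0 by (auto simp: L2_def intro: power2_le_imp_le)
  qed
  have "\<exists>N. \<forall>n\<ge>N. L2_norm M (\<lambda>x. g n x - h x) < e" if e: "0 < e" for e
  proof -
    obtain N where N: "\<forall>m\<ge>N. \<forall>n\<ge>N. L2_norm M (\<lambda>x. g m x - g n x) < e/2"
      using C[of "e/2"] e by auto
    have "L2_norm M (\<lambda>x. g n x - h x) < e" if "n \<ge> N" for n
    proof -
      have "L2_norm M (\<lambda>x. g n x - h x) \<le> e/2" using diffL[of N n "e/2"] N that by blast
      then show ?thesis using e by linarith
    qed
    then show ?thesis by blast
  qed
  then have lim: "(\<lambda>n. L2_norm M (\<lambda>x. g n x - h x)) \<longlonglongrightarrow> 0"
    by (auto simp: LIMSEQ_iff)
  obtain N where "\<forall>m\<ge>N. \<forall>n\<ge>N. L2_norm M (\<lambda>x. g m x - g n x) < 1" using C[of 1] by auto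
  then have "(\<lambda>x. g N x - h x) \<in> L2 M" using diffL[of N N 1] by auto
  then have "(\<lambda>x. g N x - (g N x - h x)) \<in> L2 M" by (rule L2_diff[OF L])
  then show ?thesis using that lim by simp
qed

section \<open>Bessel, frame and Riesz sequences through finite sums\<close>

text \<open>The next two predicates bound the synthesis map on finitely supported coefficients. Bessel and
Riesz basic sequences can be expressed through them alone, and in this form they pass easily to
subfamilies, other index sets and other measures.\<close>

definition synth_upper :: "'a measure \<Rightarrow> ('i \<Rightarrow> 'a \<Rightarrow> complex) \<Rightarrow> 'i set \<Rightarrow> real \<Rightarrow> bool" where
  "synth_upper M F I B \<longleftrightarrow> (\<forall>J c. finite J \<longrightarrow> J \<subseteq> I \<longrightarrow>
     (L2_norm M (lincomb J c F))\<^sup>2 \<le> B * energy J c)"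

definition synth_lower :: "'a measure \<Rightarrow> ('i \<Rightarrow> 'a \<Rightarrow> complex) \<Rightarrow> 'i set \<Rightarrow> real \<Rightarrow> bool" where
  "synth_lower M F I A \<longleftrightarrow> (\<forall>J c. finite J \<longrightarrow> J \<subseteq> I \<longrightarrow>
     A * energy J c \<le> (L2_norm M (lincomb J c F))\<^sup>2)"

lemma synth_upperD: "synth_upper M F I B \<Longrightarrow> finite J \<Longrightarrow> J \<subseteq> I \<Longrightarrow>
    (L2_norm M (lincomb J c F))\<^sup>2 \<le> B * energy J c"
  by (simp add: synth_upper_def)

lemma synth_lowerD: "synth_lower M F I A \<Longrightarrow> finite J \<Longrightarrow> J \<subseteq> I \<Longrightarrow>
    A * energy J c \<le> (L2_norm M (lincomb J c F))\<^sup>2"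
  by (simp add: synth_lower_def)

lemma closed_span_combination:
  assumes "\<And>i. i \<in> I \<Longrightarrow> F i \<in> L2 M" "finite J" "J \<subseteq> I"
  shows "lincomb J c F \<in> closed_span M F I"
  unfolding closed_span_def
proof (intro CollectI conjI allI impI exI)
  show "lincomb J c F \<in> L2 M" using assms by (intro L2_combination) auto
  fix e :: real assume "0 < e"
  then show "L2_norm M (\<lambda>x. (lincomb J c F x) - (lincomb J c F x)) < e"
    by (simp add: L2_norm_def)
qed (use assms in auto)

lemma closed_span_L2: "f \<in> closed_span M F I \<Longrightarrow> f \<in> L2 M"
  by (simp add: closed_span_def)

lemma closed_span_approx:
  assumes "f \<in> closed_span M F I" "0 < e"
  obtains J c where "finite J" "J \<subseteq> I" "L2_norm M (\<lambda>x. f x - (lincomb J c F x)) < e"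
  using assms by (auto simp: closed_span_def)

lemma closed_span_closed:
  assumes F: "\<And>i. i \<in> I \<Longrightarrow> F i \<in> L2 M" and f: "f \<in> L2 M"
    and ap: "\<And>e. 0 < e \<Longrightarrow> \<exists>g\<in>closed_span M F I. L2_norm M (\<lambda>x. f x - g x) < e"
  shows "f \<in> closed_span M F I"
  unfolding closed_span_def
proof (intro CollectI conjI allI impI)
  fix e :: real assume e: "0 < e"
  obtain g where g: "g \<in> closed_span M F I" "L2_norm M (\<lambda>x. f x - g x) < e/2"
    using ap[of "e/2"] e by auto
  obtain J c where J: "finite J" "J \<subseteq> I" "L2_norm M (\<lambda>x. g x - (lincomb J c F x)) < e/2"
    using closed_span_approx[OF g(1), of "e/2"] e by auto
  have "L2_norm M (\<lambda>x. (f x - g x) + (g x - (lincomb J c F x))) < e"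
    using J g F f e
    by (intro order_le_less_trans[OF L2_triangle] L2_diff L2_combination)
       (auto dest: closed_span_L2)
  then show "\<exists>J c. finite J \<and> J \<subseteq> I \<and> L2_norm M (\<lambda>x. f x - (lincomb J c F x)) < e"
    using J by auto
qed (fact f)

lemma closed_span_linear:
  assumes F: "\<And>i. i \<in> I \<Longrightarrow> F i \<in> L2 M"
    and f: "f \<in> closed_span M F I" and g: "g \<in> closed_span M F I"
  shows "(\<lambda>x. f x + s * g x) \<in> closed_span M F I"
proof (rule closed_span_closed)
  have L: "f \<in> L2 M" "g \<in> L2 M" using f g by (auto dest: closed_span_L2)
  then show "(\<lambda>x. f x + s * g x) \<in> L2 M" by (intro L2_add L2_scale)
  fix e :: real assume e: "0 < e"
  have e': "e / (2 * (cmod s + 1)) > 0" using e by (simp add: add_nonneg_pos)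
  obtain J c where J: "finite J" "J \<subseteq> I" "L2_norm M (\<lambda>x. f x - (lincomb J c F x)) < e/2"
    using closed_span_approx[OF f, of "e/2"] e by auto
  obtain K d where K: "finite K" "K \<subseteq> I" "L2_norm M (\<lambda>x. g x - (lincomb K d F x)) < e/(2 * (cmod s + 1))"
    using closed_span_approx[OF g e'] by blast
  define b where "b j = (if j \<in> J then c j else 0) + s * (if j \<in> K then d j else 0)" for j
  define h where "h x = (\<Sum>j\<in>J \<union> K. b j * F j x)" for x
  have h: "h \<in> closed_span M F I" unfolding h_def using J K F by (intro closed_span_combination) auto
  have hx: "h x = lincomb J c F x + s * (lincomb K d F x)" for x
  proof -
    have "h x = (\<Sum>j\<in>J \<union> K. (if j \<in> J then c j * F j x else 0)) + s * (\<Sum>j\<in>J \<union> K. (if j \<in> K then d j * F j x else 0))"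
      unfolding h_def b_def sum_distrib_left sum.distrib[symmetric]
      by (intro sum.cong) (auto simp: algebra_simps)
    then show ?thesis using J K by (simp add: sum.inter_restrict[symmetric] Int_absorb1 Int_absorb2 Int_commute)
  qed
  have "L2_norm M (\<lambda>x. (f x - (lincomb J c F x)) + s * (g x - (lincomb K d F x)))
      \<le> L2_norm M (\<lambda>x. (f x - (lincomb J c F x))) + cmod s * L2_norm M (\<lambda>x. g x - (lincomb K d F x))"
    unfolding L2_norm_scale[symmetric] using J K F L
    by (intro L2_triangle L2_scale L2_diff L2_combination) auto
  also have "\<dots> < e/2 + e/2"
  proof (intro add_less_le_mono J)
    have "cmod s * L2_norm M (\<lambda>x. g x - (lincomb K d F x)) \<le> (cmod s + 1) * (e/(2 * (cmod s + 1)))"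
      using K(3) by (intro mult_mono) auto
    also have "\<dots> = e/2" by (simp add: field_simps add_nonneg_eq_0_iff)
    finally show "cmod s * L2_norm M (\<lambda>x. g x - (lincomb K d F x)) \<le> e/2" .
  qed
  also have "(\<lambda>x. (f x - (lincomb J c F x)) + s * (g x - (lincomb K d F x))) = (\<lambda>x. f x + s * g x - h x)"
    by (auto simp: hx algebra_simps)
  finally show "\<exists>g'\<in>closed_span M F I. L2_norm M (\<lambda>x. f x + s * g x - g' x) < e"
    using h by auto
qed (fact F)

text \<open>For \<open>g = \<Sum> c\<^sub>j F\<^sub>j\<close> one has \<open>\<parallel>g\<parallel>\<^sup>2 =
\<Sum> cnj c\<^sub>j \<langle>g, F\<^sub>j\<rangle>\<close>; the Cauchy-Schwarz inequality for
finite sums and the Bessel bound at \<open>g\<close> itself give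
\<open>\<parallel>g\<parallel>\<^sup>4 \<le> B \<parallel>g\<parallel>\<^sup>2 \<Sum>
\<bar>c\<^sub>j\<bar>\<^sup>2\<close>. Only the values at finite combinations matter, so a Bessel
bound on the closed span is as good as one on the whole space.\<close>

lemma bessel_in_synth_upper:
  assumes b: "bessel_in M V F I" and V: "V \<subseteq> L2 M"
    and comb: "\<And>J c. finite J \<Longrightarrow> J \<subseteq> I \<Longrightarrow> (lincomb J c F) \<in> V"
  shows "\<exists>B>0. synth_upper M F I B"
proof -
  have F: "F i \<in> L2 M" if "i \<in> I" for i using b V that by (auto simp: bessel_in_def)
  obtain B where B: "\<And>f. f \<in> V \<Longrightarrow> (\<lambda>i. (cmod (L2_inner M f (F i)))\<^sup>2) summable_on I"
      "\<And>f. f \<in> V \<Longrightarrow> (analysis_energy M F I f) \<le> B * (L2_norm M f)\<^sup>2"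
    using b by (auto simp: bessel_in_def)
  define B' where "B' = max B 1"
  have "(L2_norm M (lincomb J c F))\<^sup>2 \<le> B' * energy J c"
    if J: "finite J" "J \<subseteq> I" for J c
  proof -
    define g where "g x = lincomb J c F x" for x
    define n where "n = (L2_norm M g)\<^sup>2"
    have gV: "g \<in> V" unfolding g_def using comb J by auto
    then have gL: "g \<in> L2 M" using V by auto
    have "complex_of_real n = (\<Sum>j\<in>J. cnj (c j) * L2_inner M g (F j))"
    proof -
      have "L2_inner M g (lincomb J c F) = (\<Sum>j\<in>J. cnj (c j) * L2_inner M g (F j))"
        by (rule L2_inner_combination_right) (use J F gL in auto)
      then show ?thesis unfolding n_def L2_inner_self[symmetric] by (simp add: g_def[abs_def])
    qed
    then have "cmod (of_real n) \<le> (\<Sum>j\<in>J. cmod (cnj (c j) * L2_inner M g (F j)))"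
      by (metis norm_sum)
    moreover have n0: "0 \<le> n" by (simp add: n_def)
    ultimately have "n \<le> (\<Sum>j\<in>J. cmod (c j) * cmod (L2_inner M g (F j)))"
      by (simp add: norm_mult)
    then have "n\<^sup>2 \<le> (\<Sum>j\<in>J. cmod (c j) * cmod (L2_inner M g (F j)))\<^sup>2"
      by (intro power_mono n0)
    also have "\<dots> \<le> energy J c * (\<Sum>j\<in>J. (cmod (L2_inner M g (F j)))\<^sup>2)"
      by (rule Cauchy_Schwarz_ineq_sum)
    also have "(\<Sum>j\<in>J. (cmod (L2_inner M g (F j)))\<^sup>2) \<le> B * n"
      unfolding n_def by (rule order_trans[OF finite_sum_le_infsum B(2)]) (use B gV J in auto)
    also have "B * n \<le> B' * n" by (intro mult_right_mono) (auto simp: B'_def n_def)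
    finally have "n * n \<le> energy J c * (B' * n)"
      by (simp add: power2_eq_square sum_nonneg mult_left_mono)
    then have "n * n \<le> (B' * energy J c) * n" by (simp add: mult_ac)
    moreover have "0 \<le> B' * energy J c" by (simp add: B'_def sum_nonneg)
    ultimately have "n \<le> B' * energy J c"
      using n0 by (cases "n = 0") auto
    then show ?thesis unfolding n_def g_def .
  qed
  then show ?thesis by (intro exI[of _ B']) (auto simp: synth_upper_def B'_def)
qed

text \<open>The dual estimate: with the coefficients \<open>c\<^sub>j = \<langle>f, F\<^sub>j\<rangle>\<close>
the inner product of \<open>f\<close> and \<open>\<Sum> c\<^sub>j F\<^sub>j\<close> is
\<open>\<Sum> \<bar>c\<^sub>j\<bar>\<^sup>2\<close>, and \<open>\<parallel>\<Sum> c\<^sub>j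
F\<^sub>j\<parallel>\<close> is at most the square root of \<open>B \<Sum>
\<bar>c\<^sub>j\<bar>\<^sup>2\<close>.\<close>

lemma synth_upper_analysis_finite:
  assumes u: "synth_upper M F I B" and B: "0 < B" and F: "\<And>i. i \<in> I \<Longrightarrow> F i \<in> L2 M"
    and f: "f \<in> L2 M" and J: "finite J" "J \<subseteq> I"
  shows "(\<Sum>j\<in>J. (cmod (L2_inner M f (F j)))\<^sup>2) \<le> B * (L2_norm M f)\<^sup>2"
proof -
  define g where "g x = (\<Sum>j\<in>J. L2_inner M f (F j) * F j x)" for x
  define C where "C = (\<Sum>j\<in>J. (cmod (L2_inner M f (F j)))\<^sup>2)"
  have gL: "g \<in> L2 M" unfolding g_def using J F by (intro L2_combination) auto
  have "L2_inner M f g = (\<Sum>j\<in>J. cnj (L2_inner M f (F j)) * L2_inner M f (F j))"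
    unfolding g_def by (rule L2_inner_combination_right) (use J F f in auto)
  also have "\<dots> = of_real C"
    unfolding C_def of_real_sum complex_norm_square by (simp add: mult.commute)
  finally have "L2_inner M f g = of_real C" .
  moreover have "0 \<le> C" by (auto simp: C_def sum_nonneg)
  ultimately have "C \<le> L2_norm M f * L2_norm M g"
    using L2_Cauchy_Schwarz[OF f gL] by simp
  then have "C\<^sup>2 \<le> (L2_norm M f * L2_norm M g)\<^sup>2"
    by (intro power_mono) (auto simp: C_def sum_nonneg)
  also have "\<dots> \<le> (L2_norm M f)\<^sup>2 * (B * C)"
    unfolding power_mult_distrib C_def g_def by (intro mult_left_mono synth_upperD[OF u J]) auto
  finally have "C * C \<le> (B * (L2_norm M f)\<^sup>2) * C" by (simp add: power2_eq_square mult_ac)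
  moreover have "0 \<le> C" by (auto simp: C_def sum_nonneg)
  ultimately have "C \<le> B * (L2_norm M f)\<^sup>2"
    using B by (cases "C = 0") auto
  then show ?thesis by (simp add: C_def)
qed

lemma synth_upper_analysis:
  assumes u: "synth_upper M F I B" and B: "0 < B" and F: "\<And>i. i \<in> I \<Longrightarrow> F i \<in> L2 M"
    and f: "f \<in> L2 M"
  shows "(\<lambda>i. (cmod (L2_inner M f (F i)))\<^sup>2) summable_on I"
    and "(analysis_energy M F I f) \<le> B * (L2_norm M f)\<^sup>2"
proof -
  show s: "(\<lambda>i. (cmod (L2_inner M f (F i)))\<^sup>2) summable_on I"
    by (intro nonneg_bdd_above_summable_on bdd_aboveI[of _ "B * (L2_norm M f)\<^sup>2"])
       (auto intro!: synth_upper_analysis_finite[OF u B F f])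
  show "(analysis_energy M F I f) \<le> B * (L2_norm M f)\<^sup>2"
    by (rule infsum_le_finite_sums[OF s]) (rule synth_upper_analysis_finite[OF u B F f])
qed

lemma bessel_sequence_iff:
  "bessel_sequence M F I \<longleftrightarrow> (\<forall>i\<in>I. F i \<in> L2 M) \<and> (\<exists>B>0. synth_upper M F I B)"
proof (safe)
  assume "bessel_sequence M F I"
  then have b: "bessel_in M (L2 M) F I" by (simp add: bessel_sequence_def)
  then show F: "F i \<in> L2 M" if "i \<in> I" for i using that by (auto simp: bessel_in_def)
  show "\<exists>B>0. synth_upper M F I B"
    by (rule bessel_in_synth_upper[OF b]) (auto intro!: L2_combination F)
next
  fix B assume "\<forall>i\<in>I. F i \<in> L2 M" "0 < B" "synth_upper M F I B"
  then show "bessel_sequence M F I"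
    unfolding bessel_sequence_def bessel_in_def using synth_upper_analysis[of M F I B] by blast
qed

lemma frame_sequence_iff:
  "frame_sequence M F I \<longleftrightarrow> (\<forall>i\<in>I. F i \<in> L2 M) \<and> (\<exists>B>0. synth_upper M F I B) \<and>
     (\<exists>A>0. \<forall>f\<in>closed_span M F I. A * (L2_norm M f)\<^sup>2 \<le> analysis_energy M F I f)"
  (is "_ \<longleftrightarrow> ?L \<and> ?B \<and> ?A")
proof
  assume f: "frame_sequence M F I"
  then have L: ?L and b: "bessel_in M (closed_span M F I) F I" and A: ?A
    by (auto simp: frame_sequence_def frame_for_def)
  have ?B by (rule bessel_in_synth_upper[OF b]) (use L in \<open>auto intro: closed_span_combination dest: closed_span_L2\<close>)
  with L A show "?L \<and> ?B \<and> ?A" by simp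
next
  assume r: "?L \<and> ?B \<and> ?A"
  then obtain B where B: "B > 0" "synth_upper M F I B" by auto
  have mem: "F i \<in> closed_span M F I" if "i \<in> I" for i
    using closed_span_combination[of I F M "{i}" "\<lambda>_. 1"] r that by auto
  have "bessel_in M (closed_span M F I) F I"
    unfolding bessel_in_def using synth_upper_analysis[of M F I B] B r mem closed_span_L2[of _ M F I] by blast
  with r show "frame_sequence M F I" by (auto simp: frame_sequence_def frame_for_def)
qed

text \<open>The finite partial sums form a Cauchy net, since \<open>B\<close> times the tail of \<open>\<Sum>
\<bar>a\<^sub>i\<bar>\<^sup>2\<close> controls their differences. Finite sets
\<open>J\<^sub>k\<close> beyond which they vary by less than \<open>1/(k+1)\<close> reduce its
convergence to that of a sequence.\<close>

lemma L2_has_sum_exists: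
  fixes F :: "'i \<Rightarrow> 'a \<Rightarrow> complex"
  assumes u: "synth_upper M F I B" and B: "0 < B" and F: "\<And>i. i \<in> I \<Longrightarrow> F i \<in> L2 M"
    and a: "(\<lambda>i. (cmod (a i))\<^sup>2) summable_on I"
  shows "\<exists>g. L2_has_sum M (\<lambda>i x. a i * F i x) I g"
proof -
  define s where "s J x = lincomb J a F x" for J x
  define t where "t = (\<Sum>\<^sub>\<infinity>i\<in>I. (cmod (a i))\<^sup>2)"
  have sL: "s J \<in> L2 M" if "J \<subseteq> I" for J unfolding s_def using that F by (intro L2_combination) auto
  have "\<exists>J. finite J \<and> J \<subseteq> I \<and> (\<forall>K. finite K \<longrightarrow> J \<subseteq> K \<longrightarrow> K \<subseteq> I \<longrightarrow> L2_norm M (\<lambda>x. s K x - s J x) < e)"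
    if e: "0 < e" for e
  proof -
    have e': "0 < e\<^sup>2 / (2 * B)" using e B by simp
    have "((\<lambda>i. (cmod (a i))\<^sup>2) has_sum t) I" unfolding t_def using a by (rule has_sum_infsum)
    then have "\<forall>\<^sub>F J in finite_subsets_at_top I. dist (energy J a) t < e\<^sup>2 / (2 * B)"
      unfolding has_sum_def using e' by (rule tendstoD)
    then obtain J where J: "finite J" "J \<subseteq> I" "dist (energy J a) t < e\<^sup>2 / (2 * B)"
      by (auto simp: eventually_finite_subsets_at_top)
    have "L2_norm M (\<lambda>x. s K x - s J x) < e" if K: "finite K" "J \<subseteq> K" "K \<subseteq> I" for K
    proof -
      have "s K x - s J x = (\<Sum>i\<in>K - J. a i * F i x)" for x
        unfolding s_def using K by (simp add: sum_diff)
      then have "(L2_norm M (\<lambda>x. s K x - s J x))\<^sup>2 \<le> B * (\<Sum>i\<in>K - J. (cmod (a i))\<^sup>2)"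
        using synth_upperD[OF u, of "K - J" a] K by auto
      also have "(\<Sum>i\<in>K - J. (cmod (a i))\<^sup>2) = energy K a - energy J a"
        using K by (simp add: sum_diff)
      also have "\<dots> \<le> e\<^sup>2 / (2 * B)"
        using J(3) finite_sum_le_infsum[OF a, of K] K by (auto simp: t_def dist_real_def)
      finally have "(L2_norm M (\<lambda>x. s K x - s J x))\<^sup>2 \<le> e\<^sup>2 / 2" using B by simp
      also have "\<dots> < e\<^sup>2" using e by simp
      finally show ?thesis using e by (rule_tac power2_less_imp_less) auto
    qed
    then show ?thesis using J by blast
  qed
  then have "\<forall>k. \<exists>J. finite J \<and> J \<subseteq> I \<and> (\<forall>K. finite K \<longrightarrow> J \<subseteq> K \<longrightarrow> K \<subseteq> I \<longrightarrow>
      L2_norm M (\<lambda>x. s K x - s J x) < inverse (real (Suc k)))" by simp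
  then obtain J where J: "\<And>k. finite (J k)" "\<And>k. J k \<subseteq> I"
    "\<And>k K. finite K \<Longrightarrow> J k \<subseteq> K \<Longrightarrow> K \<subseteq> I \<Longrightarrow> L2_norm M (\<lambda>x. s K x - s (J k) x) < inverse (real (Suc k))"
    by metis
  have inv: "\<exists>N. \<forall>n\<ge>N. inverse (real (Suc n)) < e" if "0 < e" for e
    using LIMSEQ_D[OF LIMSEQ_inverse_real_of_nat that] by auto
  have tri: "L2_norm M (\<lambda>x. s K x - s L x) \<le> L2_norm M (\<lambda>x. s K x - s H x) + L2_norm M (\<lambda>x. s H x - s L x)"
    if "K \<subseteq> I" "H \<subseteq> I" "L \<subseteq> I" for K H L
    using L2_triangle[OF L2_diff[OF sL[of K] sL[of H]] L2_diff[OF sL[of H] sL[of L]]] that by simp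
  obtain g where g: "g \<in> L2 M" "(\<lambda>n. L2_norm M (\<lambda>x. s (J n) x - g x)) \<longlonglongrightarrow> 0"
  proof (rule L2_complete[of "\<lambda>n. s (J n)"])
    fix e :: real assume "0 < e"
    then obtain N where N: "\<forall>n\<ge>N. inverse (real (Suc n)) < e/2" using inv[of "e/2"] by auto
    have "L2_norm M (\<lambda>x. s (J m) x - s (J n) x) < e" if "m \<ge> N" "n \<ge> N" for m n
    proof -
      have "L2_norm M (\<lambda>x. s (J m) x - s (J m \<union> J n) x) < inverse (real (Suc m))"
        "L2_norm M (\<lambda>x. s (J m \<union> J n) x - s (J n) x) < inverse (real (Suc n))"
        using J(3)[of "J m \<union> J n"] J(1,2) by (auto simp: L2_norm_minus_commute[of M "s (J m)"])
      moreover have "inverse (real (Suc m)) < e/2" "inverse (real (Suc n)) < e/2" using N that by auto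
      ultimately show ?thesis using tri[of "J m" "J m \<union> J n" "J n"] J(2)[of m] J(2)[of n] by simp
    qed
    then show "\<exists>N. \<forall>m\<ge>N. \<forall>n\<ge>N. L2_norm M (\<lambda>x. s (J m) x - s (J n) x) < e" by blast
  qed (use sL J in auto)
  have "((\<lambda>K. L2_norm M (\<lambda>x. s K x - g x)) \<longlongrightarrow> 0) (finite_subsets_at_top I)"
  proof (rule tendstoI)
    fix e :: real assume e: "0 < e"
    obtain N where N: "\<forall>n\<ge>N. inverse (real (Suc n)) < e/2" using inv[of "e/2"] e by auto
    obtain N' where N': "\<forall>n\<ge>N'. L2_norm M (\<lambda>x. s (J n) x - g x) < e/2"
      using LIMSEQ_D[OF g(2), of "e/2"] e by auto
    define n where "n = max N N'"
    have "L2_norm M (\<lambda>x. s K x - g x) < e" if K: "finite K" "J n \<subseteq> K" "K \<subseteq> I" for K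
    proof -
      have "L2_norm M (\<lambda>x. (s K x - s (J n) x) + (s (J n) x - g x)) \<le>
          L2_norm M (\<lambda>x. s K x - s (J n) x) + L2_norm M (\<lambda>x. s (J n) x - g x)"
        using K J g sL by (intro L2_triangle L2_diff) auto
      also have "\<dots> < e/2 + e/2"
      proof (intro add_strict_mono)
        have "inverse (real (Suc n)) < e/2" using N by (simp add: n_def)
        then show "L2_norm M (\<lambda>x. s K x - s (J n) x) < e/2" using J(3)[of K n] K by linarith
        show "L2_norm M (\<lambda>x. s (J n) x - g x) < e/2" using N' by (simp add: n_def)
      qed
      finally show ?thesis by simp
    qed
    then show "\<forall>\<^sub>F K in finite_subsets_at_top I. dist (L2_norm M (\<lambda>x. s K x - g x)) 0 < e"
      unfolding eventually_finite_subsets_at_top using J by (intro exI[of _ "J n"]) auto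
  qed
  then show ?thesis using g(1) by (auto simp: L2_has_sum_def s_def)
qed

lemma L2_has_sum_norm:
  assumes s: "L2_has_sum M F I g" and F: "\<And>i. i \<in> I \<Longrightarrow> F i \<in> L2 M"
  shows "((\<lambda>J. L2_norm M (\<lambda>x. \<Sum>i\<in>J. F i x)) \<longlongrightarrow> L2_norm M g) (finite_subsets_at_top I)"
proof (rule Lim_null[THEN iffD2], rule Lim_null_comparison)
  show "((\<lambda>J. L2_norm M (\<lambda>x. (\<Sum>i\<in>J. F i x) - g x)) \<longlongrightarrow> 0) (finite_subsets_at_top I)"
    using s by (simp add: L2_has_sum_def)
  show "\<forall>\<^sub>F J in finite_subsets_at_top I. norm (L2_norm M (\<lambda>x. \<Sum>i\<in>J. F i x) - L2_norm M g)
      \<le> L2_norm M (\<lambda>x. (\<Sum>i\<in>J. F i x) - g x)"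
    by (rule eventually_finite_subsets_at_top_weakI)
       (use s F in \<open>auto simp: L2_has_sum_def intro!: L2_norm_diff_ge L2_sum\<close>)
qed

lemma L2_has_sum_linear:
  assumes f: "L2_has_sum M F I f" and g: "L2_has_sum M G I g"
    and F: "\<And>i. i \<in> I \<Longrightarrow> F i \<in> L2 M" and G: "\<And>i. i \<in> I \<Longrightarrow> G i \<in> L2 M"
  shows "L2_has_sum M (\<lambda>i x. F i x + c * G i x) I (\<lambda>x. f x + c * g x)"
  unfolding L2_has_sum_def
proof (intro conjI)
  show "(\<lambda>x. f x + c * g x) \<in> L2 M" using f g by (auto simp: L2_has_sum_def intro!: L2_add L2_scale)
  have 0: "((\<lambda>J. L2_norm M (\<lambda>x. (\<Sum>i\<in>J. F i x) - f x) + cmod c * L2_norm M (\<lambda>x. (\<Sum>i\<in>J. G i x) - g x)) \<longlongrightarrow> 0 + cmod c * 0) (finite_subsets_at_top I)"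
    using f g unfolding L2_has_sum_def by (intro tendsto_intros) auto
  show "((\<lambda>J. L2_norm M (\<lambda>x. (\<Sum>i\<in>J. F i x + c * G i x) - (f x + c * g x))) \<longlongrightarrow> 0) (finite_subsets_at_top I)"
  proof (rule tendsto_sandwich[OF _ _ tendsto_const 0[simplified]])
    show "\<forall>\<^sub>F J in finite_subsets_at_top I. L2_norm M (\<lambda>x. (\<Sum>i\<in>J. F i x + c * G i x) - (f x + c * g x))
       \<le> L2_norm M (\<lambda>x. (\<Sum>i\<in>J. F i x) - f x) + cmod c * L2_norm M (\<lambda>x. (\<Sum>i\<in>J. G i x) - g x)"
    proof (rule eventually_finite_subsets_at_top_weakI)
      fix J assume J: "finite J" "J \<subseteq> I"
      have eq: "(\<lambda>x. (\<Sum>i\<in>J. F i x + c * G i x) - (f x + c * g x)) =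
        (\<lambda>x. ((\<Sum>i\<in>J. F i x) - f x) + c * ((\<Sum>i\<in>J. G i x) - g x))"
        by (auto simp: sum.distrib algebra_simps sum_distrib_left)
      show "L2_norm M (\<lambda>x. (\<Sum>i\<in>J. F i x + c * G i x) - (f x + c * g x))
       \<le> L2_norm M (\<lambda>x. (\<Sum>i\<in>J. F i x) - f x) + cmod c * L2_norm M (\<lambda>x. (\<Sum>i\<in>J. G i x) - g x)"
        unfolding eq L2_norm_scale[symmetric] using f g F G J
        by (intro L2_triangle L2_scale L2_diff L2_sum) (auto simp: L2_has_sum_def)
    qed
  qed simp
qed

lemma L2_has_sum_inner:
  assumes s: "L2_has_sum M F I g" and F: "\<And>i. i \<in> I \<Longrightarrow> F i \<in> L2 M" and h: "h \<in> L2 M"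
  shows "((\<lambda>i. L2_inner M (F i) h) has_sum L2_inner M g h) I"
  unfolding has_sum_def
proof (rule Lim_null[THEN iffD2], rule Lim_null_comparison)
  have "((\<lambda>J. L2_norm M (\<lambda>x. (\<Sum>i\<in>J. F i x) - g x) * L2_norm M h) \<longlongrightarrow> 0 * L2_norm M h) (finite_subsets_at_top I)"
    using s unfolding L2_has_sum_def by (intro tendsto_intros) auto
  then show "((\<lambda>J. L2_norm M (\<lambda>x. (\<Sum>i\<in>J. F i x) - g x) * L2_norm M h) \<longlongrightarrow> 0) (finite_subsets_at_top I)"
    by simp
  show "\<forall>\<^sub>F J in finite_subsets_at_top I. norm ((\<Sum>i\<in>J. L2_inner M (F i) h) - L2_inner M g h)
      \<le> L2_norm M (\<lambda>x. (\<Sum>i\<in>J. F i x) - g x) * L2_norm M h"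
  proof (rule eventually_finite_subsets_at_top_weakI)
    fix J assume J: "finite J" "J \<subseteq> I"
    have g: "g \<in> L2 M" using s by (simp add: L2_has_sum_def)
    have F': "(\<lambda>x. \<Sum>i\<in>J. F i x) \<in> L2 M" using J F by (intro L2_sum) auto
    have "(\<Sum>i\<in>J. L2_inner M (F i) h) - L2_inner M g h = L2_inner M (\<lambda>x. (\<Sum>i\<in>J. F i x) - g x) h"
    proof -
      have "L2_inner M (\<lambda>x. \<Sum>i\<in>J. F i x) h = (\<Sum>i\<in>J. L2_inner M (F i) h)"
        using L2_inner_combination_left[of J F M h "\<lambda>_. 1"] J F h by auto
      then show ?thesis by (simp add: L2_inner_diff_left[OF F' g h])
    qed
    then show "norm ((\<Sum>i\<in>J. L2_inner M (F i) h) - L2_inner M g h)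
      \<le> L2_norm M (\<lambda>x. (\<Sum>i\<in>J. F i x) - g x) * L2_norm M h"
      using L2_Cauchy_Schwarz[OF L2_diff[OF F' g] h] by simp
  qed
qed

lemma L2_has_sum_closed_span:
  assumes s: "L2_has_sum M (\<lambda>i x. a i * F i x) I g" and F: "\<And>i. i \<in> I \<Longrightarrow> F i \<in> L2 M"
  shows "g \<in> closed_span M F I"
  unfolding closed_span_def
proof (intro CollectI conjI allI impI)
  show "g \<in> L2 M" using s by (simp add: L2_has_sum_def)
  fix e :: real assume "0 < e"
  then have "\<forall>\<^sub>F J in finite_subsets_at_top I. dist (L2_norm M (\<lambda>x. (lincomb J a F x) - g x)) 0 < e"
    using s unfolding L2_has_sum_def by (intro tendstoD) auto
  then obtain J where "finite J" "J \<subseteq> I" "L2_norm M (\<lambda>x. (lincomb J a F x) - g x) < e"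
    by (auto simp: eventually_finite_subsets_at_top)
  then show "\<exists>J c. finite J \<and> J \<subseteq> I \<and> L2_norm M (\<lambda>x. g x - (lincomb J c F x)) < e"
    by (subst L2_norm_minus_commute) auto
qed

lemma L2_has_sum_bounds:
  assumes s: "L2_has_sum M (\<lambda>i x. a i * F i x) I g" and F: "\<And>i. i \<in> I \<Longrightarrow> F i \<in> L2 M"
    and a: "(\<lambda>i. (cmod (a i))\<^sup>2) summable_on I"
  shows "synth_upper M F I B \<Longrightarrow> (L2_norm M g)\<^sup>2 \<le> B * (\<Sum>\<^sub>\<infinity>i\<in>I. (cmod (a i))\<^sup>2)"
    and "synth_lower M F I A \<Longrightarrow> A * (\<Sum>\<^sub>\<infinity>i\<in>I. (cmod (a i))\<^sup>2) \<le> (L2_norm M g)\<^sup>2"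
proof -
  have n: "((\<lambda>J. (L2_norm M (lincomb J a F))\<^sup>2) \<longlongrightarrow> (L2_norm M g)\<^sup>2) (finite_subsets_at_top I)"
    by (intro tendsto_power L2_has_sum_norm[OF s] L2_scale F)
  have e: "((\<lambda>J. K * energy J a) \<longlongrightarrow> K * (\<Sum>\<^sub>\<infinity>i\<in>I. (cmod (a i))\<^sup>2)) (finite_subsets_at_top I)" for K
    using has_sum_infsum[OF a] unfolding has_sum_def by (intro tendsto_intros)
  show "(L2_norm M g)\<^sup>2 \<le> B * (\<Sum>\<^sub>\<infinity>i\<in>I. (cmod (a i))\<^sup>2)" if "synth_upper M F I B"
    by (rule tendsto_le[OF finite_subsets_at_top_neq_bot e n])
       (rule eventually_finite_subsets_at_top_weakI, rule synth_upperD[OF that])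
  show "A * (\<Sum>\<^sub>\<infinity>i\<in>I. (cmod (a i))\<^sup>2) \<le> (L2_norm M g)\<^sup>2" if "synth_lower M F I A"
    by (rule tendsto_le[OF finite_subsets_at_top_neq_bot n e])
       (rule eventually_finite_subsets_at_top_weakI, rule synth_lowerD[OF that])
qed

lemma finitely_supported_has_sum:
  fixes F :: "'i \<Rightarrow> 'a \<Rightarrow> complex" and c :: "'i \<Rightarrow> complex"
  assumes J: "finite J" "J \<subseteq> I" and F: "\<And>i. i \<in> I \<Longrightarrow> F i \<in> L2 M"
  defines "b \<equiv> (\<lambda>i. if i \<in> J then c i else 0)"
  shows "((\<lambda>i. (cmod (b i))\<^sup>2) has_sum (energy J c)) I"
    and "L2_has_sum M (\<lambda>i x. b i * F i x) I (lincomb J c F)"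
proof -
  show "((\<lambda>i. (cmod (b i))\<^sup>2) has_sum (energy J c)) I"
  proof (rule has_sum_cong_neutral[THEN iffD2])
    show "((\<lambda>i. (cmod (c i))\<^sup>2) has_sum (energy J c)) J" using J by (intro has_sum_finite)
  qed (use J in \<open>auto simp: b_def\<close>)
  show "L2_has_sum M (\<lambda>i x. b i * F i x) I (lincomb J c F)"
    unfolding L2_has_sum_def
  proof (intro conjI tendsto_eventually)
    show "lincomb J c F \<in> L2 M" using J F by (intro L2_combination) auto
    show "\<forall>\<^sub>F K in finite_subsets_at_top I. L2_norm M (\<lambda>x. (lincomb K b F x) - (lincomb J c F x)) = 0"
      unfolding eventually_finite_subsets_at_top
    proof (intro exI[of _ J] conjI allI impI J)
      fix K assume K: "finite K \<and> J \<subseteq> K \<and> K \<subseteq> I"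
      have "lincomb K b F x = lincomb J c F x" for x
        using K by (intro sum.mono_neutral_cong_right) (auto simp: b_def)
      then show "L2_norm M (\<lambda>x. (lincomb K b F x) - (lincomb J c F x)) = 0" by (simp add: L2_norm_def)
    qed
  qed
qed

text \<open>Forwards, the definition is tested on coefficients that vanish off a finite set; backwards, both
bounds pass to the limit along the net of finite partial sums.\<close>

lemma riesz_basic_sequence_iff:
  "riesz_basic_sequence M F I \<longleftrightarrow> (\<forall>i\<in>I. F i \<in> L2 M) \<and> (\<exists>A>0. synth_lower M F I A) \<and> (\<exists>B>0. synth_upper M F I B)"
  (is "?R \<longleftrightarrow> ?L \<and> ?A \<and> ?B")
proof
  assume "?L \<and> ?A \<and> ?B"
  then obtain A B where F: "\<And>i. i \<in> I \<Longrightarrow> F i \<in> L2 M" and A: "0 < A" "synth_lower M F I A" and B: "0 < B" "synth_upper M F I B"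
    by auto
  have "\<exists>g. L2_has_sum M (\<lambda>i x. a i * F i x) I g \<and>
           A * (\<Sum>\<^sub>\<infinity>i\<in>I. (cmod (a i))\<^sup>2) \<le> (L2_norm M g)\<^sup>2 \<and>
           (L2_norm M g)\<^sup>2 \<le> B * (\<Sum>\<^sub>\<infinity>i\<in>I. (cmod (a i))\<^sup>2)"
    if "(\<lambda>i. (cmod (a i))\<^sup>2) summable_on I" for a
    using L2_has_sum_exists[OF B(2,1) F that] L2_has_sum_bounds(1)[OF _ F that B(2)] L2_has_sum_bounds(2)[OF _ F that A(2)]
    by blast
  then show ?R unfolding riesz_basic_sequence_def using F A B by blast
next
  assume R: ?R
  then obtain A B where F: ?L and A: "A > 0" and B: "B > 0" and
    AB: "\<And>a. (\<lambda>i. (cmod (a i))\<^sup>2) summable_on I \<Longrightarrow>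
        \<exists>g. L2_has_sum M (\<lambda>i x. a i * F i x) I g \<and>
           A * (\<Sum>\<^sub>\<infinity>i\<in>I. (cmod (a i))\<^sup>2) \<le> (L2_norm M g)\<^sup>2 \<and>
           (L2_norm M g)\<^sup>2 \<le> B * (\<Sum>\<^sub>\<infinity>i\<in>I. (cmod (a i))\<^sup>2)"
    unfolding riesz_basic_sequence_def by auto
  have *: "A * energy J c \<le> (L2_norm M (lincomb J c F))\<^sup>2 \<and>
      (L2_norm M (lincomb J c F))\<^sup>2 \<le> B * energy J c" if J: "finite J" "J \<subseteq> I" for J c
  proof -
    define a where "a = (\<lambda>i. if i \<in> J then c i else 0)"
    have F': "F i \<in> L2 M" if "i \<in> I" for i using F that by auto
    have hs: "((\<lambda>i. (cmod (a i))\<^sup>2) has_sum (energy J c)) I"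
        "L2_has_sum M (\<lambda>i x. a i * F i x) I (lincomb J c F)"
      unfolding a_def by (rule finitely_supported_has_sum[where F = F and c = c, OF J F'], assumption)+
    have aF: "(\<lambda>x. a i * F i x) \<in> L2 M" if "i \<in> I" for i by (rule L2_scale[OF F'[OF that]])
    have inf: "(\<Sum>\<^sub>\<infinity>i\<in>I. (cmod (a i))\<^sup>2) = energy J c" by (rule infsumI[OF hs(1)])
    obtain g where g: "L2_has_sum M (\<lambda>i x. a i * F i x) I g"
        "A * energy J c \<le> (L2_norm M g)\<^sup>2" "(L2_norm M g)\<^sup>2 \<le> B * energy J c"
      using AB[OF has_sum_imp_summable[OF hs(1)]] unfolding inf by blast
    have "L2_norm M g = L2_norm M (lincomb J c F)"
      by (rule tendsto_unique[OF finite_subsets_at_top_neq_bot L2_has_sum_norm[OF g(1) aF] L2_has_sum_norm[OF hs(2) aF]])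
    with g show ?thesis by simp
  qed
  then show "?L \<and> ?A \<and> ?B" using F A B unfolding synth_lower_def synth_upper_def by blast
qed

text \<open>A lower synthesis bound is also a lower frame bound on the closed span. If \<open>p = \<Sum>
c\<^sub>j F\<^sub>j\<close> is close to \<open>f\<close>, then
\<open>\<parallel>f\<parallel>\<^sup>2 = \<langle>f, f\<rangle>\<close> is close to
\<open>\<langle>f, p\<rangle>\<close>, which is at most \<open>\<parallel>c\<parallel>\<close>
times the square root of \<open>\<Sum> \<bar>\<langle>f, F\<^sub>i\<rangle>\<bar>\<^sup>2\<close>,
and \<open>\<parallel>c\<parallel>\<^sup>2 \<le> \<parallel>p\<parallel>\<^sup>2 / A\<close>.\<close>

lemma synth_lower_analysis:
  assumes A: "0 < A" "synth_lower M F I A" and F: "\<And>i. i \<in> I \<Longrightarrow> F i \<in> L2 M"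
    and f: "f \<in> closed_span M F I"
    and sm: "(\<lambda>i. (cmod (L2_inner M f (F i)))\<^sup>2) summable_on I"
  shows "A * (L2_norm M f)\<^sup>2 \<le> analysis_energy M F I f"
proof -
  define n where "n = L2_norm M f"
  define T where "T = analysis_energy M F I f"
  define q where "q = sqrt (T / A)"
  have n0: "0 \<le> n" and T0: "0 \<le> T"
    by (auto simp: n_def T_def intro!: infsum_nonneg)
  then have q0: "0 \<le> q" using A by (simp add: q_def)
  have fL: "f \<in> L2 M" using f by (rule closed_span_L2)
  have step: "n * n \<le> e * n + (n + e) * q" if e: "0 < e" for e
  proof -
    obtain J c where J: "finite J" "J \<subseteq> I" "L2_norm M (\<lambda>x. f x - (lincomb J c F x)) < e"
      using closed_span_approx[OF f e] .
    define p where "p x = lincomb J c F x" for x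
    have pL: "p \<in> L2 M" unfolding p_def using J F by (intro L2_combination) auto
    have pn: "L2_norm M p \<le> n + e"
      using L2_norm_diff_ge[OF fL pL] J(3) by (simp add: p_def n_def)
    have "(cmod (L2_inner M f p))\<^sup>2 \<le> (\<Sum>j\<in>J. cmod (c j) * cmod (L2_inner M f (F j)))\<^sup>2"
    proof (intro power_mono)
      have "L2_inner M f p = (\<Sum>j\<in>J. cnj (c j) * L2_inner M f (F j))"
        unfolding p_def by (rule L2_inner_combination_right) (use J F fL in auto)
      then show "cmod (L2_inner M f p) \<le> (\<Sum>j\<in>J. cmod (c j) * cmod (L2_inner M f (F j)))"
        by (metis (no_types, lifting) complex_mod_cnj norm_mult norm_sum sum.cong)
    qed simp
    also have "\<dots> \<le> energy J c * (\<Sum>j\<in>J. (cmod (L2_inner M f (F j)))\<^sup>2)"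
      by (rule Cauchy_Schwarz_ineq_sum)
    also have "\<dots> \<le> ((L2_norm M p)\<^sup>2 / A) * T"
    proof (intro mult_mono)
      show "(energy J c) \<le> (L2_norm M p)\<^sup>2 / A"
        using synth_lowerD[OF A(2) J(1,2), of c] A unfolding p_def by (simp add: field_simps)
      show "(\<Sum>j\<in>J. (cmod (L2_inner M f (F j)))\<^sup>2) \<le> T"
        unfolding T_def by (rule finite_sum_le_infsum[OF sm]) (use J in auto)
    qed (use A in \<open>auto intro: sum_nonneg\<close>)
    also have "\<dots> = (L2_norm M p * q)\<^sup>2"
      using A T0 by (simp add: q_def power_mult_distrib)
    finally have "cmod (L2_inner M f p) \<le> L2_norm M p * q"
      by (rule power2_le_imp_le) (use q0 in simp)
    also have "\<dots> \<le> (n + e) * q" using pn q0 by (intro mult_right_mono)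
    finally have 1: "cmod (L2_inner M f p) \<le> (n + e) * q" .
    have "L2_norm M f * L2_norm M (\<lambda>x. f x - p x) \<le> n * e"
      unfolding n_def p_def using J(3) by (intro mult_left_mono) auto
    then have 2: "cmod (L2_inner M f (\<lambda>x. f x - p x)) \<le> n * e"
      using L2_Cauchy_Schwarz[OF fL L2_diff[OF fL pL]] by linarith
    have "L2_inner M f f = L2_inner M f p + L2_inner M f (\<lambda>x. f x - p x)"
      unfolding L2_inner_commute[of M f p] L2_inner_commute[of M f "\<lambda>x. f x - p x"]
      by (simp add: L2_inner_diff_left fL pL) (simp add: L2_inner_self)
    then have "cmod (L2_inner M f f) \<le> (n + e) * q + n * e"
      using 1 2 by (metis add_mono norm_triangle_le)
    moreover have "cmod (L2_inner M f f) = n * n"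
      unfolding L2_inner_self norm_of_real by (simp add: n_def power2_eq_square)
    ultimately show ?thesis by (simp add: mult_ac add_ac)
  qed
  have "n * n \<le> n * q"
  proof (rule field_le_epsilon)
    fix e :: real assume e: "0 < e"
    define d where "d = e / (n + q + 1)"
    have d: "0 < d" "d * (n + q) \<le> e" using e n0 q0 by (auto simp: d_def field_simps)
    show "n * n \<le> n * q + e" using step[OF d(1)] d(2) by (simp add: algebra_simps)
  qed
  then have "n \<le> q" using n0 q0 by (cases "n = 0") auto
  then have "n\<^sup>2 \<le> T / A" using n0 q0 T0 A power_mono[of n q 2] by (simp add: q_def)
  then show ?thesis using A by (simp add: n_def T_def field_simps)
qed

lemma riesz_imp_frame_sequence:
  assumes "riesz_basic_sequence M F I" shows "frame_sequence M F I"
proof -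
  obtain A B where F: "\<And>i. i \<in> I \<Longrightarrow> F i \<in> L2 M" and A: "0 < A" "synth_lower M F I A"
    and B: "0 < B" "synth_upper M F I B"
    using assms by (auto simp: riesz_basic_sequence_iff)
  have "A * (L2_norm M f)\<^sup>2 \<le> analysis_energy M F I f" if f: "f \<in> closed_span M F I" for f
    using synth_lower_analysis[OF A F f] synth_upper_analysis(1)[OF B(2,1) F closed_span_L2[OF f]] by blast
  then show ?thesis using F A B unfolding frame_sequence_iff by blast
qed

lemma L2_has_sum_cong:
  assumes "\<And>i x. i \<in> I \<Longrightarrow> F i x = G i x"
  shows "L2_has_sum M F I g \<longleftrightarrow> L2_has_sum M G I g"
  unfolding L2_has_sum_def
proof (intro conj_cong refl tendsto_cong)
  show "\<forall>\<^sub>F J in finite_subsets_at_top I. L2_norm M (\<lambda>x. (\<Sum>i\<in>J. F i x) - g x) = L2_norm M (\<lambda>x. (\<Sum>i\<in>J. G i x) - g x)"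
  proof (rule eventually_finite_subsets_at_top_weakI)
    fix J assume "finite J" "J \<subseteq> I"
    then have "(\<Sum>i\<in>J. F i x) = (\<Sum>i\<in>J. G i x)" for x using assms by (intro sum.cong) auto
    then show "L2_norm M (\<lambda>x. (\<Sum>i\<in>J. F i x) - g x) = L2_norm M (\<lambda>x. (\<Sum>i\<in>J. G i x) - g x)" by simp
  qed
qed

text \<open>Let \<open>S g = \<Sum> \<langle>g, F\<^sub>i\<rangle> F\<^sub>i\<close> be the frame operator and
\<open>w = \<Sum> c\<^sub>j F\<^sub>j\<close> a finite combination. The frame algorithm
\<open>g\<^sub>k\<^sub>+\<^sub>1 = g\<^sub>k + \<tau> (w - S g\<^sub>k)\<close> converges to a
solution \<open>h\<close> of \<open>S h = w\<close>, because \<open>1 - \<tau> S\<close> is a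
contraction of the closed span. The coefficients \<open>c\<^sub>i - \<langle>h,
F\<^sub>i\<rangle>\<close> then synthesise zero, so injectivity gives \<open>c\<^sub>i =
\<langle>h, F\<^sub>i\<rangle>\<close>. Hence \<open>\<Sum> \<bar>c\<^sub>i\<bar>\<^sup>2 =
\<langle>w, h\<rangle> \<le> \<parallel>w\<parallel> \<parallel>h\<parallel>\<close>, while the
lower frame bound at \<open>h\<close> says \<open>A \<parallel>h\<parallel>\<^sup>2 \<le> \<Sum>
\<bar>c\<^sub>i\<bar>\<^sup>2\<close>; together these are the lower Riesz bound, with the same
constant \<open>A\<close>.\<close>

lemma frame_sequence_injective_imp_riesz:
  fixes F :: "'i \<Rightarrow> 'a \<Rightarrow> complex"
  assumes fr: "frame_sequence M F I"
    and inj: "\<And>a g. (\<lambda>i. (cmod (a i))\<^sup>2) summable_on I \<Longrightarrow> L2_has_sum M (\<lambda>i x. a i * F i x) I g \<Longrightarrow>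
        L2_norm M g = 0 \<Longrightarrow> \<forall>i\<in>I. a i = 0"
  shows "riesz_basic_sequence M F I"
proof -
  define V where "V = closed_span M F I"
  have F: "\<And>i. i \<in> I \<Longrightarrow> F i \<in> L2 M"
    using fr by (auto simp: frame_sequence_iff)
  obtain B where B: "0 < B" "synth_upper M F I B" using fr by (auto simp: frame_sequence_iff)
  obtain A where A: "0 < A" and
    low: "\<And>f. f \<in> V \<Longrightarrow> A * (L2_norm M f)\<^sup>2 \<le> analysis_energy M F I f"
    using fr by (auto simp: frame_sequence_iff V_def)
  have VL: "f \<in> L2 M" if "f \<in> V" for f using that closed_span_L2 by (auto simp: V_def)
  note sm = synth_upper_analysis(1)[OF B(2,1) F]
  have "\<forall>f. \<exists>g. f \<in> L2 M \<longrightarrow> L2_has_sum M (\<lambda>i x. L2_inner M f (F i) * F i x) I g"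
    using L2_has_sum_exists[OF B(2,1) F sm] by blast
  then obtain S where S: "\<And>f. f \<in> L2 M \<Longrightarrow> L2_has_sum M (\<lambda>i x. L2_inner M f (F i) * F i x) I (S f)"
    by metis
  have SV: "S f \<in> V" if "f \<in> V" for f
    unfolding V_def by (rule L2_has_sum_closed_span[OF S[OF VL[OF that]] F])
  \<comment> \<open>With \<open>\<tau> \<le> 1/B\<close> the operator \<open>1 - \<tau> S\<close>
  contracts by \<open>\<rho>\<close>; the summand \<open>A\<close> in the denominator ensures
  \<open>1 - A \<tau> \<ge> 0\<close>.\<close>
  define \<tau> \<rho> where "\<tau> = 1 / (A + B)" and "\<rho> = sqrt (1 - A * \<tau>)"
  have \<tau>: "0 < \<tau>" "\<tau> * B \<le> 1" using A B by (auto simp: \<tau>_def field_simps)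
  have rho: "0 \<le> \<rho>" "\<rho> < 1" "\<rho>\<^sup>2 = 1 - A * \<tau>"
    using A B by (auto simp: \<tau>_def \<rho>_def field_simps)
  have contract: "L2_norm M (\<lambda>x. d x - of_real \<tau> * S d x) \<le> \<rho> * L2_norm M d" if d: "d \<in> V" for d
  proof (rule power2_le_imp_le)
    define u where "u = analysis_energy M F I d"
    have dL: "d \<in> L2 M" "S d \<in> L2 M" using d SV VL by auto
    have "((\<lambda>i. L2_inner M (\<lambda>x. L2_inner M d (F i) * F i x) d) has_sum L2_inner M (S d) d) I"
      by (rule L2_has_sum_inner[OF S]) (auto intro: L2_scale F dL)
    moreover have "L2_inner M (\<lambda>x. L2_inner M d (F i) * F i x) d = of_real ((cmod (L2_inner M d (F i)))\<^sup>2)" for i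
      unfolding L2_inner_scale_left L2_inner_commute[of M "F i" d] complex_norm_square ..
    ultimately have "((\<lambda>i. complex_of_real ((cmod (L2_inner M d (F i)))\<^sup>2)) has_sum L2_inner M (S d) d) I"
      by simp
    moreover have "((\<lambda>i. complex_of_real ((cmod (L2_inner M d (F i)))\<^sup>2)) has_sum of_real u) I"
      unfolding u_def by (intro has_sum_of_real has_sum_infsum sm dL)
    ultimately have in1: "L2_inner M (S d) d = of_real u" by (rule has_sum_unique)
    then have in2: "Re (L2_inner M d (S d)) = u" by (subst L2_inner_commute) simp
    have u0: "0 \<le> u" unfolding u_def by (intro infsum_nonneg) auto
    have nS: "(L2_norm M (S d))\<^sup>2 \<le> B * u"
      unfolding u_def by (rule L2_has_sum_bounds(1)[OF S F sm B(2)]) (use dL in auto)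
    have "(L2_norm M (\<lambda>x. d x - of_real \<tau> * S d x))\<^sup>2 = (L2_norm M d)\<^sup>2 - 2 * (\<tau> * u) + \<tau>\<^sup>2 * (L2_norm M (S d))\<^sup>2"
      by (subst L2_norm_diff_sq) (use dL \<tau> in \<open>auto simp: L2_scale L2_inner_scale_right L2_norm_scale in2 power_mult_distrib\<close>)
    also have "\<tau>\<^sup>2 * (L2_norm M (S d))\<^sup>2 \<le> \<tau>\<^sup>2 * (B * u)" using nS by (intro mult_left_mono) auto
    also have "\<tau>\<^sup>2 * (B * u) = (\<tau> * B) * (\<tau> * u)" by (simp add: power2_eq_square)
    also have "\<dots> \<le> \<tau> * u" using \<tau> u0 by (intro mult_left_le_one_le) (auto simp: B less_imp_le)
    also have "(L2_norm M d)\<^sup>2 - 2 * (\<tau> * u) + \<tau> * u = (L2_norm M d)\<^sup>2 - \<tau> * u" by simp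
    also have "\<dots> \<le> (L2_norm M d)\<^sup>2 - \<tau> * (A * (L2_norm M d)\<^sup>2)"
      using low[OF d] \<tau> by (intro diff_left_mono mult_left_mono) (auto simp: u_def)
    also have "\<dots> = (\<rho> * L2_norm M d)\<^sup>2" by (simp add: power_mult_distrib rho algebra_simps)
    finally show "(L2_norm M (\<lambda>x. d x - of_real \<tau> * S d x))\<^sup>2 \<le> (\<rho> * L2_norm M d)\<^sup>2" by simp
  qed (use rho in simp)
  have "synth_lower M F I A"
    unfolding synth_lower_def
  proof (intro allI impI)
    fix J c assume J: "finite J" "J \<subseteq> I"
    define C w where "C = energy J c" and "w = lincomb J c F"
    define b where "b = (\<lambda>i. if i \<in> J then c i else 0)"
    have wV: "w \<in> V" unfolding w_def V_def by (rule closed_span_combination) (use F J in auto)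
    have b_hs: "((\<lambda>i. (cmod (b i))\<^sup>2) has_sum C) I" and w_hs: "L2_has_sum M (\<lambda>i x. b i * F i x) I w"
      unfolding b_def C_def w_def by (rule finitely_supported_has_sum[where F = F and c = c, OF J F], assumption)+
    \<comment> \<open>The iterates \<open>g\<^sub>k\<close> together with the residuals
    \<open>d\<^sub>k = w - S g\<^sub>k\<close>.\<close>
    define gd where "gd = rec_nat ((\<lambda>x. 0), w) (\<lambda>_ (g, d). ((\<lambda>x. g x + of_real \<tau> * d x), (\<lambda>x. d x - of_real \<tau> * S d x)))"
    define g d where "g k = fst (gd k)" and "d k = snd (gd k)" for k :: nat
    have g0: "g 0 = (\<lambda>x. 0)" and d0: "d 0 = w"
      and gS: "\<And>k. g (Suc k) = (\<lambda>x. g k x + of_real \<tau> * d k x)"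
      and dS: "\<And>k. d (Suc k) = (\<lambda>x. d k x - of_real \<tau> * S (d k) x)"
      by (simp_all add: g_def d_def gd_def case_prod_beta)
    have inv: "g k \<in> V \<and> d k \<in> V \<and> L2_norm M (d k) \<le> \<rho>^k * L2_norm M w \<and>
        L2_has_sum M (\<lambda>i x. (b i - L2_inner M (g k) (F i)) * F i x) I (d k)" for k
    proof (induction k)
      case 0
      have "(\<lambda>x. 0) \<in> V" using closed_span_combination[of I F M "{}"] F by (auto simp: V_def)
      then show ?case using wV w_hs by (simp add: g0 d0 L2_inner_def)
    next
      case (Suc k)
      then have V: "g k \<in> V" "d k \<in> V" "S (d k) \<in> V" using SV by auto
      have L: "g k \<in> L2 M" "d k \<in> L2 M" "S (d k) \<in> L2 M" using V VL by auto
      have 1: "g (Suc k) \<in> V" unfolding gS V_def by (rule closed_span_linear) (use V F in \<open>auto simp: V_def\<close>)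
      have 2: "d (Suc k) \<in> V"
        using closed_span_linear[of I F M "d k" "S (d k)" "- of_real \<tau>"] V F unfolding dS V_def by auto
      have 3: "L2_norm M (d (Suc k)) \<le> \<rho>^Suc k * L2_norm M w"
      proof -
        have "L2_norm M (d (Suc k)) \<le> \<rho> * L2_norm M (d k)" unfolding dS by (rule contract[OF V(2)])
        also have "\<dots> \<le> \<rho> * (\<rho>^k * L2_norm M w)" using Suc rho by (intro mult_left_mono) auto
        finally show ?thesis by simp
      qed
      have "L2_has_sum M (\<lambda>i x. (b i - L2_inner M (g k) (F i)) * F i x + (- of_real \<tau>) * (L2_inner M (d k) (F i) * F i x)) I
          (\<lambda>x. d k x + (- of_real \<tau>) * S (d k) x)"
        by (rule L2_has_sum_linear) (use Suc S L F in \<open>auto intro: L2_scale\<close>)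
      moreover have "(\<lambda>x. d k x + (- of_real \<tau>) * S (d k) x) = d (Suc k)" by (auto simp: dS)
      moreover have "(b i - L2_inner M (g k) (F i)) * F i x + (- of_real \<tau>) * (L2_inner M (d k) (F i) * F i x)
          = (b i - L2_inner M (g (Suc k)) (F i)) * F i x" if "i \<in> I" for i x
        unfolding gS using L F[OF that] by (simp add: L2_inner_add_left L2_inner_scale_left L2_scale algebra_simps)
      ultimately have "L2_has_sum M (\<lambda>i x. (b i - L2_inner M (g (Suc k)) (F i)) * F i x) I (d (Suc k))"
        using L2_has_sum_cong[of I "\<lambda>i x. (b i - L2_inner M (g k) (F i)) * F i x + (- of_real \<tau>) * (L2_inner M (d k) (F i) * F i x)"]
        by simp
      then show ?case using 1 2 3 by blast
    qed
    have gL: "g k \<in> L2 M" and dL: "d k \<in> L2 M" for k using inv VL by blast+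
    have gdiff: "L2_norm M (\<lambda>x. g (k + m) x - g k x) \<le> \<rho>^k * (\<tau> * L2_norm M w / (1 - \<rho>))" for k m
    proof -
      have "g (k + m) x - g k x = (\<Sum>j<m. of_real \<tau> * d (k + j) x)" for x
        by (induction m) (auto simp: gS algebra_simps)
      then have "L2_norm M (\<lambda>x. g (k + m) x - g k x) \<le> (\<Sum>j<m. L2_norm M (\<lambda>x. of_real \<tau> * d (k + j) x))"
        using dL by (auto intro!: L2_norm_sum_le L2_scale)
      also have "\<dots> \<le> (\<Sum>j<m. (\<tau> * L2_norm M w * \<rho>^k) * \<rho>^j)"
      proof (rule sum_mono)
        fix j
        have "L2_norm M (\<lambda>x. of_real \<tau> * d (k + j) x) \<le> \<tau> * (\<rho>^(k + j) * L2_norm M w)"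
          unfolding L2_norm_scale using \<tau> inv[of "k + j"] by simp
        then show "L2_norm M (\<lambda>x. of_real \<tau> * d (k + j) x) \<le> (\<tau> * L2_norm M w * \<rho>^k) * \<rho>^j"
          by (simp add: power_add mult_ac)
      qed
      also have "\<dots> = (\<tau> * L2_norm M w * \<rho>^k) * ((1 - \<rho>^m) / (1 - \<rho>))"
        using rho by (simp add: sum_gp_strict flip: sum_distrib_left)
      also have "\<dots> \<le> (\<tau> * L2_norm M w * \<rho>^k) * (1 / (1 - \<rho>))"
        using rho \<tau> by (intro mult_left_mono divide_right_mono) auto
      finally show ?thesis by (simp add: mult_ac)
    qed
    have rho0: "(\<lambda>k. \<rho>^k * K) \<longlonglongrightarrow> 0" for K
      using tendsto_mult_left_zero[OF LIMSEQ_power_zero[of \<rho>]] rho by auto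
    obtain h where h: "h \<in> L2 M" "(\<lambda>k. L2_norm M (\<lambda>x. g k x - h x)) \<longlonglongrightarrow> 0"
    proof (rule L2_complete[of g])
      fix e :: real assume e: "0 < e"
      obtain N where N: "\<forall>k\<ge>N. norm (\<rho>^k * (\<tau> * L2_norm M w / (1 - \<rho>)) - 0) < e"
        using LIMSEQ_D[OF rho0 e] by blast
      have small: "L2_norm M (\<lambda>x. g (k + j) x - g k x) < e" if "k \<ge> N" for k j
      proof -
        have "norm (\<rho>^k * (\<tau> * L2_norm M w / (1 - \<rho>)) - 0) < e" using N that by blast
        then have "\<rho>^k * (\<tau> * L2_norm M w / (1 - \<rho>)) < e"
          by (simp only: real_norm_def diff_0_right abs_less_iff)
        with gdiff[of k j] show ?thesis by linarith
      qed
      have "L2_norm M (\<lambda>x. g m x - g n x) < e" if mn: "m \<ge> N" "n \<ge> N" for m n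
      proof (cases "n \<le> m")
        case True
        then show ?thesis using small[OF mn(2), of "m - n"] by simp
      next
        case False
        then show ?thesis using small[OF mn(1), of "n - m"] by (subst L2_norm_minus_commute) simp
      qed
      then show "\<exists>N. \<forall>m\<ge>N. \<forall>n\<ge>N. L2_norm M (\<lambda>x. g m x - g n x) < e" by blast
    qed (use gL in auto)
    have hV: "h \<in> V" unfolding V_def
    proof (rule closed_span_closed[OF F h(1)])
      fix e :: real assume "0 < e"
      then obtain k where "L2_norm M (\<lambda>x. g k x - h x) < e"
        using LIMSEQ_D[OF h(2), of e] by auto
      then show "\<exists>g\<in>closed_span M F I. L2_norm M (\<lambda>x. h x - g x) < e"
        using inv[of k] by (subst (asm) L2_norm_minus_commute) (auto simp: V_def)
    qed
    have sb: "(\<lambda>i. (cmod (b i - L2_inner M h (F i)))\<^sup>2) summable_on I"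
    proof (rule summable_on_comparison_test)
      show "(\<lambda>i. 2 * (cmod (b i))\<^sup>2 + 2 * (cmod (L2_inner M h (F i)))\<^sup>2) summable_on I"
        using has_sum_imp_summable[OF b_hs] sm[OF _ h(1)]
        by (intro summable_on_add summable_on_cmult_right) auto
      fix i
      show "(cmod (b i - L2_inner M h (F i)))\<^sup>2 \<le> 2 * (cmod (b i))\<^sup>2 + 2 * (cmod (L2_inner M h (F i)))\<^sup>2"
        using power_mono[OF norm_triangle_ineq4[of "b i" "L2_inner M h (F i)"], of 2]
          sum_squares_bound[of "cmod (b i)" "cmod (L2_inner M h (F i))"]
        by (simp add: power2_sum)
    qed auto
    have v_hs: "L2_has_sum M (\<lambda>i x. (b i - L2_inner M h (F i)) * F i x) I (\<lambda>x. w x - S h x)"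
      using L2_has_sum_linear[OF w_hs S[OF h(1)], of "-1"] F by (auto simp: left_diff_distrib L2_scale)
    moreover have "L2_norm M (\<lambda>x. w x - S h x) = 0"
    proof -
      define v where "v = (\<lambda>x. w x - S h x)"
      have vL: "v \<in> L2 M" unfolding v_def using wV hV SV VL by (intro L2_diff) auto
      have bnd: "L2_norm M v \<le> \<rho>^k * L2_norm M w + B * L2_norm M (\<lambda>x. g k x - h x)" for k
      proof -
        have hgL: "(\<lambda>x. h x - g k x) \<in> L2 M" by (intro L2_diff h gL)
        have "L2_has_sum M (\<lambda>i x. (b i - L2_inner M (g k) (F i)) * F i x + (-1) * ((b i - L2_inner M h (F i)) * F i x)) I
            (\<lambda>x. d k x + (-1) * v x)"
          unfolding v_def by (rule L2_has_sum_linear[OF _ v_hs]) (use inv F in \<open>auto intro: L2_scale\<close>)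
        moreover have "(b i - L2_inner M (g k) (F i)) * F i x + (-1) * ((b i - L2_inner M h (F i)) * F i x) =
            L2_inner M (\<lambda>x. h x - g k x) (F i) * F i x" if "i \<in> I" for i x
          unfolding L2_inner_diff_left[OF h(1) gL F[OF that]] by (simp add: algebra_simps)
        ultimately have "L2_has_sum M (\<lambda>i x. L2_inner M (\<lambda>x. h x - g k x) (F i) * F i x) I (\<lambda>x. d k x - v x)"
          using L2_has_sum_cong[of I "\<lambda>i x. (b i - L2_inner M (g k) (F i)) * F i x + (-1) * ((b i - L2_inner M h (F i)) * F i x)"]
          by simp
        then have "(L2_norm M (\<lambda>x. d k x - v x))\<^sup>2 \<le> B * (\<Sum>\<^sub>\<infinity>i\<in>I. (cmod (L2_inner M (\<lambda>x. h x - g k x) (F i)))\<^sup>2)"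
          by (rule L2_has_sum_bounds(1)[OF _ F sm B(2)]) (use hgL in auto)
        also have "\<dots> \<le> B * (B * (L2_norm M (\<lambda>x. h x - g k x))\<^sup>2)"
          using B by (intro mult_left_mono synth_upper_analysis(2)[OF B(2,1) F hgL]) auto
        also have "\<dots> = (B * L2_norm M (\<lambda>x. g k x - h x))\<^sup>2"
          by (simp add: power2_eq_square L2_norm_minus_commute[of M h])
        finally have "L2_norm M (\<lambda>x. d k x - v x) \<le> B * L2_norm M (\<lambda>x. g k x - h x)"
          by (rule power2_le_imp_le) (use B in auto)
        then show ?thesis using L2_norm_diff_ge[OF dL[of k] vL] inv[of k] by linarith
      qed
      have "(\<lambda>k. \<rho>^k * L2_norm M w + B * L2_norm M (\<lambda>x. g k x - h x)) \<longlonglongrightarrow> 0 + B * 0"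
        by (intro tendsto_intros rho0 h)
      then have "L2_norm M v \<le> 0 + B * 0"
        by (rule LIMSEQ_le_const) (use bnd in auto)
      then have "L2_norm M v = 0" using L2_norm_nonneg[of M v] by linarith
      then show ?thesis by (simp only: v_def)
    qed
    ultimately have eq: "\<forall>i\<in>I. b i - L2_inner M h (F i) = 0"
      using inj[OF sb] by blast
    have "((\<lambda>i. (cmod (L2_inner M h (F i)))\<^sup>2) has_sum C) I"
      using b_hs eq by (subst has_sum_cong[where g = "\<lambda>i. (cmod (b i))\<^sup>2"]) auto
    then have h_le: "A * (L2_norm M h)\<^sup>2 \<le> C" using low[OF hV] by (simp add: infsumI)
    have "L2_inner M w h = (\<Sum>j\<in>J. c j * cnj (L2_inner M h (F j)))"
      unfolding w_def L2_inner_commute[of M "F _" h, symmetric]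
      by (rule L2_inner_combination_left) (use J F h in auto)
    also have "\<dots> = (\<Sum>j\<in>J. of_real ((cmod (c j))\<^sup>2))"
      unfolding complex_norm_square using eq J by (intro sum.cong) (fastforce simp: b_def)+
    also have "\<dots> = of_real C" by (simp add: C_def)
    finally have "L2_inner M w h = of_real C" .
    moreover have C0: "0 \<le> C" by (auto simp: C_def sum_nonneg)
    ultimately have "C \<le> L2_norm M w * L2_norm M h"
      using L2_Cauchy_Schwarz[OF VL[OF wV] h(1)] by simp
    then have "C\<^sup>2 \<le> (L2_norm M w * L2_norm M h)\<^sup>2" using C0 by (intro power_mono)
    then have "A * C\<^sup>2 \<le> (L2_norm M w)\<^sup>2 * (A * (L2_norm M h)\<^sup>2)"
      using A by (simp add: power_mult_distrib mult_ac)
    also have "\<dots> \<le> (L2_norm M w)\<^sup>2 * C" using h_le by (intro mult_left_mono) auto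
    finally have "(A * C) * C \<le> (L2_norm M w)\<^sup>2 * C" by (simp add: power2_eq_square mult_ac)
    then have "A * C \<le> (L2_norm M w)\<^sup>2" using C0 by (cases "C = 0") auto
    then show "A * energy J c \<le> (L2_norm M (lincomb J c F))\<^sup>2"
      by (simp add: C_def w_def)
  qed
  then show ?thesis using A B F by (auto simp: riesz_basic_sequence_iff)
qed

section \<open>Passing to subfamilies, reindexing and finite covers\<close>

lemma synth_mono:
  assumes "I \<subseteq> I'"
  shows "synth_upper M F I' B \<Longrightarrow> synth_upper M F I B" "synth_lower M F I' B \<Longrightarrow> synth_lower M F I B"
  using assms by (auto simp: synth_upper_def synth_lower_def)

lemma riesz_basic_sequence_subset:
  "riesz_basic_sequence M F I' \<Longrightarrow> I \<subseteq> I' \<Longrightarrow> riesz_basic_sequence M F I"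
  unfolding riesz_basic_sequence_iff
  using synth_mono[of I I' M F] by (metis subsetD)

lemma synth_reindex:
  fixes F :: "'i \<Rightarrow> 'a \<Rightarrow> complex" and h :: "'j \<Rightarrow> 'i"
  assumes h: "inj_on h A"
  shows "synth_upper M F (h ` A) B \<longleftrightarrow> synth_upper M (\<lambda>j. F (h j)) A B"
    and "synth_lower M F (h ` A) B \<longleftrightarrow> synth_lower M (\<lambda>j. F (h j)) A B"
proof -
  have all: "(\<forall>J c. finite J \<longrightarrow> J \<subseteq> h ` A \<longrightarrow> P (lincomb J c F) (energy J c)) \<longleftrightarrow>
      (\<forall>J c. finite J \<longrightarrow> J \<subseteq> A \<longrightarrow> P (\<lambda>x. \<Sum>j\<in>J. c j * F (h j) x) (energy J c))" (is "?L \<longleftrightarrow> ?R")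
    for P :: "('a \<Rightarrow> complex) \<Rightarrow> real \<Rightarrow> bool"
  proof
    assume L: ?L
    show ?R
    proof (intro allI impI)
      fix J and c :: "'j \<Rightarrow> complex" assume J: "finite J" "J \<subseteq> A"
      have inj: "inj_on h J" using h J by (blast intro: inj_on_subset)
      define d where "d i = c (inv_into J h i)" for i
      have dj: "d (h j) = c j" if "j \<in> J" for j using inj that by (simp add: d_def)
      have "P (\<lambda>x. \<Sum>j\<in>h ` J. d j * F j x) (\<Sum>j\<in>h ` J. (cmod (d j))\<^sup>2)"
        using L J by (simp add: image_mono)
      moreover have "(\<Sum>j\<in>h ` J. d j * F j x) = (\<Sum>j\<in>J. c j * F (h j) x)" for x
        unfolding sum.reindex[OF inj] by (intro sum.cong) (auto simp: dj)
      moreover have "(\<Sum>j\<in>h ` J. (cmod (d j))\<^sup>2) = energy J c"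
        unfolding sum.reindex[OF inj] by (intro sum.cong) (auto simp: dj)
      ultimately show "P (\<lambda>x. \<Sum>j\<in>J. c j * F (h j) x) (energy J c)" by simp
    qed
  next
    assume R: ?R
    show ?L
    proof (intro allI impI)
      fix K and c :: "'i \<Rightarrow> complex" assume K: "finite K" "K \<subseteq> h ` A"
      then obtain J where J: "J \<subseteq> A" "finite J" "K = h ` J" by (meson finite_subset_image)
      have inj: "inj_on h J" using h J by (blast intro: inj_on_subset)
      show "P (lincomb K c F) (energy K c)"
        using R[rule_format, OF J(2,1), of "\<lambda>j. c (h j)"] by (simp add: J(3) sum.reindex[OF inj])
    qed
  qed
  show "synth_upper M F (h ` A) B \<longleftrightarrow> synth_upper M (\<lambda>j. F (h j)) A B"
    unfolding synth_upper_def by (rule all)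
  show "synth_lower M F (h ` A) B \<longleftrightarrow> synth_lower M (\<lambda>j. F (h j)) A B"
    unfolding synth_lower_def by (rule all)
qed

lemma synth_cong_norm:
  assumes "\<And>J c. finite J \<Longrightarrow> J \<subseteq> I \<Longrightarrow>
    L2_norm M (lincomb J c F) = L2_norm N (lincomb J c G)"
  shows "synth_upper M F I B \<longleftrightarrow> synth_upper N G I B" "synth_lower M F I B \<longleftrightarrow> synth_lower N G I B"
  using assms by (auto simp: synth_upper_def synth_lower_def)

lemma finite_union_of_coloring:
  assumes fin: "finite (col ` I)" and Q: "\<And>k. k \<in> col ` I \<Longrightarrow> Q {i \<in> I. col i = k}"
  shows "finite_union_of Q I"
  unfolding finite_union_of_def
proof (intro exI conjI)
  define P where "P = (\<lambda>k. {i \<in> I. col i = k}) ` (col ` I)"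
  show "finite P" using fin by (simp add: P_def)
  show "partition_on I P" unfolding P_def by (rule partition_onI) (auto simp: disjnt_def)
  show "\<forall>A\<in>P. Q A" using Q by (auto simp: P_def)
qed

text \<open>For a property inherited by subsets a finite cover may replace a finite partition.\<close>

lemma finite_union_of_cover:
  assumes sub: "\<And>A B. Q B \<Longrightarrow> A \<subseteq> B \<Longrightarrow> Q A"
    and C: "finite C" "I \<subseteq> \<Union>C" "\<And>A. A \<in> C \<Longrightarrow> Q A"
  shows "finite_union_of Q I"
proof -
  have "\<forall>i\<in>I. \<exists>A. A \<in> C \<and> i \<in> A" using C by auto
  then obtain col where col: "\<And>i. i \<in> I \<Longrightarrow> col i \<in> C \<and> i \<in> col i" by metis
  show ?thesis
  proof (rule finite_union_of_coloring)
    show "finite (col ` I)" by (rule finite_subset[OF _ C(1)]) (use col in auto)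
    fix k assume "k \<in> col ` I"
    then show "Q {i \<in> I. col i = k}" using col by (intro sub[OF C(3)[of k]]) auto
  qed
qed

lemma finite_union_ofE:
  assumes "finite_union_of Q I"
  obtains C where "finite C" "\<Union>C = I" "\<And>A. A \<in> C \<Longrightarrow> Q A"
  using assms by (auto simp: finite_union_of_def partition_on_def)

section \<open>Integer exponentials on the unit interval\<close>

abbreviation int_expi :: "int \<Rightarrow> real \<Rightarrow> complex" where
  "int_expi \<equiv> (\<lambda>n. expi (of_int n))"

abbreviation tpoly :: "int set \<Rightarrow> (int \<Rightarrow> complex) \<Rightarrow> real \<Rightarrow> complex" where
  "tpoly J c \<equiv> (\<lambda>t. \<Sum>n\<in>J. c n * expi (of_int n) t)"

abbreviation E_modulations :: "real set \<Rightarrow> int \<Rightarrow> real \<Rightarrow> complex" where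
  "E_modulations E \<equiv> int_modulations (indicator E)"

lemma unit_in_lebesgue [simp]: "{0..1} \<inter> space lebesgue \<in> sets (lebesgue :: real measure)"
  by simp

lemma L2_unit_iff:
  "f \<in> L2 unit_leb \<longleftrightarrow> (\<lambda>t. f t * indicator {0..1} t) \<in> L2 lebesgue"
proof -
  have 1: "(\<lambda>t. f t * indicator {0..1} t) = (\<lambda>t. indicator {0..1} t *\<^sub>R f t)"
    by (auto simp: indicator_def)
  have 2: "(\<lambda>t. (cmod (indicator {0..1} t *\<^sub>R f t))\<^sup>2) = (\<lambda>t. indicator {0..1} t *\<^sub>R (cmod (f t))\<^sup>2)"
    by (auto simp: indicator_def)
  show ?thesis
    unfolding L2_def mem_Collect_eq 1 2 borel_measurable_restrict_space_iff[OF unit_in_lebesgue]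
      integrable_restrict_space[OF unit_in_lebesgue] ..
qed

lemma L2_norm_unit: "L2_norm unit_leb f = L2_norm lebesgue (\<lambda>t. f t * indicator {0..1} t)"
proof -
  have "(\<lambda>t. (cmod (f t * indicator {0..1} t))\<^sup>2) = (\<lambda>t. indicator {0..1} t *\<^sub>R (cmod (f t))\<^sup>2)"
    by (auto simp: indicator_def)
  then show ?thesis
    unfolding L2_norm_def integral_restrict_space[OF unit_in_lebesgue] by simp
qed

lemma finite_measure_unit: "finite_measure unit_leb"
  by (rule finite_measureI) (simp add: emeasure_restrict_space)

lemma measure_unit [simp]: "measure unit_leb {0..1} = 1"
  by (simp add: measure_restrict_space)

lemma L2_norm_unit_const: "L2_norm unit_leb (\<lambda>t. c) = cmod c"
  by (simp add: L2_norm_def)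

lemma L2_unit_bounded:
  assumes "f \<in> borel_measurable unit_leb" "\<And>t. t \<in> {0..1} \<Longrightarrow> cmod (f t) \<le> C"
  shows "f \<in> L2 unit_leb" and "L2_norm unit_leb f \<le> C"
proof -
  have 1: "(\<lambda>t. 1) \<in> L2 unit_leb"
    using finite_measure.integrable_const[OF finite_measure_unit, of "1::real"] by (simp add: L2_def)
  have C: "0 \<le> C" using order_trans[OF norm_ge_zero assms(2)[of 0]] by simp
  show "f \<in> L2 unit_leb"
    by (rule L2_dominated(1)[OF 1 assms(1), of C]) (use assms(2) in auto)
  have "L2_norm unit_leb f \<le> C * L2_norm unit_leb (\<lambda>t. 1)"
    by (rule L2_dominated(2)[OF 1 assms(1), of C]) (use assms(2) C in auto)
  then show "L2_norm unit_leb f \<le> C" by (simp add: L2_norm_unit_const)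
qed

lemma expi_add: "expi (a + b) t = expi a t * expi b t"
  by (simp add: expi_def distrib_left distrib_right flip: exp_add)

lemma expi_shift: "expi a (s + t) = expi a s * expi a t"
  by (simp add: expi_def distrib_left flip: exp_add)

lemma expi_0 [simp]: "expi 0 t = 1" by (simp add: expi_def)

lemma norm_expi [simp]: "cmod (expi a t) = 1"
  by (simp add: expi_def)

lemma cnj_expi: "cnj (expi a t) = expi (- a) t"
  by (simp add: expi_def exp_cnj)

lemma continuous_expi: "continuous_on A (expi a)"
  unfolding expi_def by (intro continuous_intros)

lemma measurable_expi [measurable]: "expi a \<in> borel_measurable lebesgue"
  using borel_measurable_continuous_onI[OF continuous_expi[of UNIV a]]
  by (metis measurable_completion measurable_lborel2)

lemma measurable_expi_unit [measurable]: "expi a \<in> borel_measurable unit_leb"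
  by (rule measurable_restrict_space1) simp

lemma continuous_measurable_unit:
  fixes h :: "real \<Rightarrow> complex"
  assumes "continuous_on UNIV h" shows "h \<in> borel_measurable unit_leb"
  using borel_measurable_continuous_onI[OF assms]
  by (intro measurable_restrict_space1) (metis measurable_completion measurable_lborel2)

lemma unit_subset_lmeasurable: "E \<in> sets lebesgue \<Longrightarrow> E \<subseteq> {0..1::real} \<Longrightarrow> E \<in> lmeasurable"
  by (meson bounded_closed_interval bounded_set_imp_lmeasurable bounded_subset)

lemma integral_indicator_unit:
  assumes N: "N \<in> lmeasurable"
  shows "integrable unit_leb (indicat_real N)" "(LINT t|unit_leb. indicat_real N t) = measure lebesgue (N \<inter> {0..1})"
proof -
  have eq: "(\<lambda>t. indicator {0..1} t *\<^sub>R indicat_real N t) = indicator (N \<inter> {0..1})"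
    by (auto simp: indicator_def fun_eq_iff)
  have "N \<inter> {0..1} \<in> lmeasurable" by (rule fmeasurable_Int_fmeasurable[OF N]) simp
  then show "integrable unit_leb (indicat_real N)" "(LINT t|unit_leb. indicat_real N t) = measure lebesgue (N \<inter> {0..1})"
    unfolding integrable_restrict_space[OF unit_in_lebesgue] integral_restrict_space[OF unit_in_lebesgue] eq
    by (auto simp: fmeasurable_def intro: integrable_real_indicator)
qed

lemma expi_L2_unit: "expi a \<in> L2 unit_leb"
  by (rule L2_unit_bounded) auto

lemma integral_expi: "(LINT t|unit_leb. expi (of_int n) t) = (if n = 0 then 1 else 0)"
proof (cases "n = 0")
  case False
  define k where "k = 2 * complex_of_real pi * \<i> * of_int n"
  have k: "k \<noteq> 0" using False by (simp add: k_def)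
  have "((\<lambda>t. exp (k * of_real t)) has_integral (exp (k * of_real 1) / k - exp (k * of_real 0) / k)) {0..1}"
  proof (rule fundamental_theorem_of_calculus)
    fix t :: real
    have "((\<lambda>t. exp (k * of_real t) / k) has_vector_derivative (exp (k * of_real t))) (at t)"
      using k by (auto intro!: derivative_eq_intros has_vector_derivative_real_field)
    then show "((\<lambda>t. exp (k * of_real t) / k) has_vector_derivative (exp (k * of_real t))) (at t within {0..1})"
      by (rule has_vector_derivative_at_within)
  qed simp
  moreover have "exp k = 1"
  proof -
    have "k = (2 * of_int n * of_real pi) * \<i>" by (simp add: k_def)
    then show ?thesis using exp_integer_2pi[of "of_int n"] by simp
  qed
  ultimately have "((\<lambda>t. exp (k * of_real t)) has_integral 0) {0..1}" by simp
  then have "integral {0..1} (expi (of_int n)) = 0"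
    unfolding expi_def k_def by (simp add: integral_unique)
  moreover have "integrable unit_leb (expi (of_int n))"
    by (rule continuous_imp_integrable_real[OF continuous_expi])
  ultimately show ?thesis
    using False by (simp add: lebesgue_integral_eq_integral)
qed simp

lemma expi_orthonormal:
  "L2_inner unit_leb (expi (of_int m)) (expi (of_int n)) = (if m = n then 1 else 0)"
proof -
  have "expi (of_int m) t * cnj (expi (of_int n) t) = expi (of_int (m - n)) t" for t
    unfolding cnj_expi by (simp flip: expi_add)
  then show ?thesis unfolding L2_inner_def by (simp only: integral_expi) simp
qed

lemma trig_norm:
  assumes J: "finite J"
  shows "(L2_norm unit_leb (tpoly J c))\<^sup>2 = energy J c"
proof -
  define p where "p = tpoly J c"
  have pL: "p \<in> L2 unit_leb" unfolding p_def by (intro L2_combination expi_L2_unit)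
  have in1: "L2_inner unit_leb p (expi (of_int m)) = c m" if "m \<in> J" for m
    unfolding p_def
    by (subst L2_inner_combination_left) (use J that in \<open>auto simp: expi_L2_unit expi_orthonormal if_distrib cong: if_cong\<close>)
  have "complex_of_real ((L2_norm unit_leb p)\<^sup>2) = L2_inner unit_leb p p" by (simp add: L2_inner_self)
  also have "\<dots> = L2_inner unit_leb p (tpoly J c)" by (simp add: p_def)
  also have "\<dots> = (\<Sum>n\<in>J. cnj (c n) * c n)"
    by (subst L2_inner_combination_right) (auto simp: expi_L2_unit pL in1)
  also have "\<dots> = of_real (energy J c)"
    unfolding of_real_sum complex_norm_square by (simp add: mult.commute)
  finally show ?thesis unfolding p_def by (simp only: of_real_eq_iff)
qed

lemma int_modulations_indicator_L2:
  assumes "E \<in> sets lebesgue"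
  shows "E_modulations E n \<in> L2 unit_leb"
proof (rule L2_unit_bounded)
  have "(\<lambda>t. expi (of_int n) t * indicator E t) \<in> borel_measurable lebesgue"
    using assms by measurable
  then show "E_modulations E n \<in> borel_measurable unit_leb"
    unfolding int_modulations_def by (rule measurable_restrict_space1)
  show "cmod (E_modulations E n t) \<le> 1" for t
    by (auto simp: int_modulations_def norm_mult indicator_def)
qed

lemma proj_L2:
  assumes "E \<in> sets lebesgue" "f \<in> L2 unit_leb"
  shows "proj E f \<in> L2 unit_leb" and "L2_norm unit_leb (proj E f) \<le> L2_norm unit_leb f"
proof -
  have "indicator E \<in> borel_measurable lebesgue" using assms by simp
  then have "(\<lambda>t. f t * indicator E t) \<in> borel_measurable unit_leb"
    using L2_measurable[OF assms(2)] measurable_restrict_space1[of "indicator E" lebesgue borel "{0..1}"]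
    by (intro borel_measurable_times)
  then have m: "proj E f \<in> borel_measurable unit_leb" by (simp add: proj_def)
  have b: "cmod (proj E f t) \<le> 1 * cmod (f t)" for t by (auto simp: proj_def indicator_def)
  show "proj E f \<in> L2 unit_leb" by (rule L2_dominated(1)[OF assms(2) m b])
  show "L2_norm unit_leb (proj E f) \<le> L2_norm unit_leb f" using L2_dominated(2)[OF assms(2) m b] by simp
qed

lemma proj_combination:
  "proj E (tpoly J c) = (lincomb J c (E_modulations E))"
  by (auto simp: proj_def int_modulations_def sum_distrib_right mult.assoc)

lemma int_modulations_upper:
  assumes "E \<in> sets lebesgue"
  shows "synth_upper unit_leb (E_modulations E) I 1"
  unfolding synth_upper_def
proof (intro allI impI)
  fix J :: "int set" and c :: "int \<Rightarrow> complex" assume J: "finite J" "J \<subseteq> I"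
  show "(L2_norm unit_leb (lincomb J c (E_modulations E)))\<^sup>2 \<le> 1 * energy J c"
    unfolding proj_combination[symmetric] trig_norm[OF J(1), symmetric] mult_1
    by (intro power_mono proj_L2(2) assms L2_combination expi_L2_unit) auto
qed

text \<open>On trigonometric polynomials the \<open>L\<^sup>2\<close> norm is the
\<open>\<ell>\<^sup>2\<close> norm of the coefficients, and \<open>P\<^sub>E\<close> turns the
synthesis of the \<open>e\<^sub>n\<close> into that of the \<open>e\<^sub>n
\<chi>\<^sub>E\<close>. A lower bound for \<open>P\<^sub>E\<close> on these polynomials extends to
their closure \<open>S(A)\<close> by continuity.\<close>

lemma iso_onto_range_iff_synth_lower:
  assumes E: "E \<in> sets lebesgue"
  shows "iso_onto_range unit_leb (proj E) (S A) \<longleftrightarrow>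
    (\<exists>a>0. synth_lower unit_leb (E_modulations E) A a)"
proof
  assume "iso_onto_range unit_leb (proj E) (S A)"
  then obtain a where a: "a > 0" "\<And>f. f \<in> S A \<Longrightarrow> a * L2_norm unit_leb f \<le> L2_norm unit_leb (proj E f)"
    by (auto simp: iso_onto_range_def)
  have "synth_lower unit_leb (E_modulations E) A (a\<^sup>2)"
    unfolding synth_lower_def
  proof (intro allI impI)
    fix J :: "int set" and c :: "int \<Rightarrow> complex" assume J: "finite J" "J \<subseteq> A"
    have "tpoly J c \<in> S A"
      unfolding S_def by (rule closed_span_combination[OF expi_L2_unit J])
    from power_mono[OF a(2)[OF this], of 2] a(1)
    show "a\<^sup>2 * energy J c \<le> (L2_norm unit_leb (lincomb J c (E_modulations E)))\<^sup>2"
      unfolding proj_combination by (simp add: power_mult_distrib trig_norm[OF J(1)])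
  qed
  then show "\<exists>a>0. synth_lower unit_leb (E_modulations E) A a" using a by (intro exI[of _ "a\<^sup>2"]) simp
next
  assume "\<exists>a>0. synth_lower unit_leb (E_modulations E) A a"
  then obtain a where a: "a > 0" "synth_lower unit_leb (E_modulations E) A a" by auto
  define b where "b = sqrt a"
  have b: "b > 0" "b\<^sup>2 = a" using a by (auto simp: b_def)
  have SL: "f \<in> L2 unit_leb" if "f \<in> S A" for f using that closed_span_L2 by (auto simp: S_def)
  have low: "b * L2_norm unit_leb f \<le> L2_norm unit_leb (proj E f)" if f: "f \<in> S A" for f
  proof (rule field_le_epsilon)
    fix e :: real assume e: "0 < e"
    then have "0 < e / (b + 1)" using b by simp
    then obtain J c where J: "finite J" "J \<subseteq> A" "L2_norm unit_leb (\<lambda>x. f x - (tpoly J c x)) < e / (b + 1)"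
      using closed_span_approx[OF f[unfolded S_def]] by blast
    define p where "p = tpoly J c"
    have pL: "p \<in> L2 unit_leb" unfolding p_def by (intro L2_combination expi_L2_unit)
    note fL = SL[OF f]
    have "(b * L2_norm unit_leb p)\<^sup>2 \<le> (L2_norm unit_leb (proj E p))\<^sup>2"
      using synth_lowerD[OF a(2) J(1,2), of c]
      unfolding p_def proj_combination by (simp add: power_mult_distrib b trig_norm[OF J(1)])
    then have 1: "b * L2_norm unit_leb p \<le> L2_norm unit_leb (proj E p)"
      by (rule power2_le_imp_le) simp
    have 2: "L2_norm unit_leb f - L2_norm unit_leb p \<le> e / (b + 1)"
      using L2_norm_diff_ge[OF fL pL] J(3) by (simp add: p_def)
    have 3: "L2_norm unit_leb (proj E p) - L2_norm unit_leb (proj E f) \<le> e / (b + 1)"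
    proof -
      have eq: "(\<lambda>x. proj E f x - proj E p x) = proj E (\<lambda>x. f x - p x)"
        by (auto simp: proj_def algebra_simps)
      have "L2_norm unit_leb (proj E (\<lambda>x. f x - p x)) < e / (b + 1)"
        using proj_L2(2)[OF E L2_diff[OF fL pL]] J(3) by (simp add: p_def)
      then show ?thesis
        using L2_norm_diff_ge[OF proj_L2(1)[OF E fL] proj_L2(1)[OF E pL]] unfolding eq by linarith
    qed
    have "b * L2_norm unit_leb f \<le> b * L2_norm unit_leb p + b * (e / (b + 1))"
      using mult_left_mono[OF 2, of b] b by (simp add: right_diff_distrib)
    also have "\<dots> \<le> L2_norm unit_leb (proj E f) + (e / (b + 1) + b * (e / (b + 1)))" using 1 3 by simp
    also have "e / (b + 1) + b * (e / (b + 1)) = (b + 1) * (e / (b + 1))"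
      unfolding distrib_right by (simp only: mult_1 add.commute)
    also have "\<dots> = e" using b by simp
    finally show "b * L2_norm unit_leb f \<le> L2_norm unit_leb (proj E f) + e" .
  qed
  show "iso_onto_range unit_leb (proj E) (S A)"
    unfolding iso_onto_range_def
  proof (intro conjI exI ballI)
    show "proj E ` S A \<subseteq> L2 unit_leb" using SL proj_L2(1)[OF E] by auto
    show "L2_norm unit_leb (proj E f) \<le> 1 * L2_norm unit_leb f" if "f \<in> S A" for f
      using proj_L2(2)[OF E SL[OF that]] by simp
  qed (use b low in auto)
qed

lemma iso_onto_range_subset:
  assumes "E \<in> sets lebesgue" "iso_onto_range unit_leb (proj E) (S B)" "A \<subseteq> B"
  shows "iso_onto_range unit_leb (proj E) (S A)"
  using assms(2) synth_mono(2)[OF assms(3)] unfolding iso_onto_range_iff_synth_lower[OF assms(1)] by blast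

section \<open>Trigonometric approximation of indicator functions\<close>

definition trig_poly :: "(real \<Rightarrow> complex) \<Rightarrow> bool" where
  "trig_poly p \<longleftrightarrow> (\<exists>J c. finite J \<and> p = tpoly J c)"

lemma trig_poly_monomial: "trig_poly (\<lambda>t. c * expi (of_int n) t)"
  unfolding trig_poly_def by (intro exI[of _ "{n}"] exI[of _ "\<lambda>_. c"]) simp

lemma trig_poly_const: "trig_poly (\<lambda>t. c)"
  using trig_poly_monomial[of c 0] by simp

lemma trig_poly_add:
  assumes "trig_poly p" "trig_poly q" shows "trig_poly (\<lambda>t. p t + q t)"
proof -
  obtain J c K d where J: "finite J" "p = tpoly J c"
    and K: "finite K" "q = tpoly K d"
    using assms unfolding trig_poly_def by auto
  have "p t + q t = (\<Sum>n\<in>J \<union> K. ((if n \<in> J then c n else 0) + (if n \<in> K then d n else 0)) * expi (of_int n) t)" for t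
  proof -
    have 1: "p t = (\<Sum>n\<in>J \<union> K. (if n \<in> J then c n else 0) * expi (of_int n) t)"
      unfolding J(2) using J(1) K(1) by (intro sum.mono_neutral_cong_left) auto
    have 2: "q t = (\<Sum>n\<in>J \<union> K. (if n \<in> K then d n else 0) * expi (of_int n) t)"
      unfolding K(2) using J(1) K(1) by (intro sum.mono_neutral_cong_left) auto
    show ?thesis unfolding 1 2 by (simp add: sum.distrib distrib_right)
  qed
  then have "(\<lambda>t. p t + q t) = (\<lambda>t. \<Sum>n\<in>J \<union> K. ((if n \<in> J then c n else 0) + (if n \<in> K then d n else 0)) * expi (of_int n) t)"
    by auto
  then show ?thesis
    unfolding trig_poly_def using J(1) K(1) by (intro exI[of _ "J \<union> K"] exI conjI finite_UnI)
qed

lemma trig_poly_sum: "(\<And>i. i \<in> I \<Longrightarrow> trig_poly (p i)) \<Longrightarrow> trig_poly (\<lambda>t. \<Sum>i\<in>I. p i t)"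
  by (induction I rule: infinite_finite_induct) (auto intro: trig_poly_add trig_poly_const)

lemma trig_poly_mult:
  assumes "trig_poly p" "trig_poly q" shows "trig_poly (\<lambda>t. p t * q t)"
proof -
  obtain J c K d where J: "finite J" "p = tpoly J c"
    and K: "finite K" "q = tpoly K d"
    using assms unfolding trig_poly_def by auto
  have "p t * q t = (\<Sum>m\<in>J. \<Sum>n\<in>K. (c m * d n) * expi (of_int (m + n)) t)" for t
    unfolding J K sum_product by (simp add: expi_add mult_ac)
  then show ?thesis by (simp only:) (intro trig_poly_sum trig_poly_monomial)
qed

text \<open>On the unit circle a real-linear functional is a combination of \<open>z = e\<^sub>1\<close> and
\<open>cnj z = e\<^sub>-\<^sub>1\<close>. This makes the Stone-Weierstrass theorem for polynomial
functions on the circle a theorem about trigonometric polynomials.\<close>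

lemma trig_poly_real_polynomial:
  assumes "real_polynomial_function g"
  shows "trig_poly (\<lambda>t. of_real (g (expi 1 t)))"
  using assms
proof induction
  case (linear f)
  interpret bounded_linear f by fact
  have "of_real (f (expi 1 t)) = (of_real (f 1) / 2 + of_real (f \<i>) / (2 * \<i>)) * expi (of_int 1) t
     + (of_real (f 1) / 2 - of_real (f \<i>) / (2 * \<i>)) * expi (of_int (-1)) t" for t
  proof -
    define z where "z = expi 1 t"
    have "z = Re z *\<^sub>R 1 + Im z *\<^sub>R \<i>" by (simp add: complex_eq_iff)
    then have "f z = Re z * f 1 + Im z * f \<i>" by (metis add scaleR real_scaleR_def)
    moreover have "expi (-1) t = cnj z" by (simp add: z_def cnj_expi)
    ultimately show ?thesis
      by (simp flip: z_def) (simp add: complex_eq_iff field_simps)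
  qed
  then show ?case by (simp only:) (intro trig_poly_add trig_poly_monomial)
qed (auto intro: trig_poly_const trig_poly_add trig_poly_mult)

lemma expi_1_inj:
  assumes "expi 1 s = expi 1 t" "0 < s" "s < 1" "0 \<le> t" "t \<le> 1"
  shows "s = t"
proof -
  obtain n :: int where n: "2 * complex_of_real pi * \<i> * 1 * of_real s = 2 * complex_of_real pi * \<i> * 1 * of_real t + of_int (2 * n) * pi * \<i>"
    using assms(1) unfolding expi_def exp_eq by auto
  have "2 * pi * s = 2 * pi * t + 2 * of_int n * pi"
    using arg_cong[OF n, of Im] by simp
  then have "pi * (s - t - of_int n) = 0" by (simp add: algebra_simps)
  then have eq: "s - t = of_int n" by simp
  then have "\<bar>real_of_int n\<bar> < 1" using assms(2-5) by linarith
  then have "n = 0" by simp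
  with eq show ?thesis by simp
qed

text \<open>\<open>E\<close> is squeezed between a closed and an open set, and a Urysohn function
\<open>v\<close> separating them is approximated uniformly. Both steps take place on the circle,
that is for functions of \<open>e\<^sub>1(t)\<close>, so that periodicity is automatic; this
requires removing the points \<open>0\<close> and \<open>1\<close>, which have the same image. The
exceptional set \<open>N\<close> consists of them and of the gap between the two sets.\<close>

lemma trig_poly_indicator:
  assumes E: "E \<in> sets lebesgue" "E \<subseteq> {0..1}" and e: "0 < e"
  obtains N v p where "N \<in> lmeasurable" "measure lebesgue N \<le> e" "continuous_on UNIV v" "trig_poly p"
    "\<And>t. 0 \<le> v t \<and> v t \<le> (1::real)"
    "\<And>t. t \<in> {0..1} \<Longrightarrow> cmod (p t - of_real (v t)) < e"
    "\<And>t. t \<in> {0..1} \<Longrightarrow> t \<notin> N \<Longrightarrow> v t = indicator E t"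
proof -
  define E' where "E' = E \<inter> {0<..<1}"
  have E': "E' \<in> sets lebesgue" unfolding E'_def by (intro sets.Int E) simp
  obtain K where K: "closed K" "K \<subseteq> E'" "E' - K \<in> lmeasurable" "emeasure lebesgue (E' - K) < ennreal (e/2)"
    using sets_lebesgue_inner_closed[OF E', of "e/2"] e by auto
  obtain U where U: "open U" "E' \<subseteq> U" "U - E' \<in> lmeasurable" "emeasure lebesgue (U - E') < ennreal (e/2)"
    using sets_lebesgue_outer_open[OF E', of "e/2"] e by auto
  define U' where "U' = U \<inter> {0<..<1}"
  have U': "open U'" "E' \<subseteq> U'" using U by (auto simp: U'_def E'_def)
  define N where "N = (U - E') \<union> (E' - K) \<union> {0, 1}"
  have N01: "{0, 1::real} \<in> lmeasurable" "measure lebesgue {0, 1::real} = 0"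
    using emeasure_lborel_countable[of "{0, 1::real}"] by (auto intro: lmeasurable_compact simp: measure_def)
  have Nm: "N \<in> lmeasurable" unfolding N_def by (intro fmeasurable.Un K U N01)
  have "measure lebesgue N \<le> measure lebesgue (U - E') + measure lebesgue (E' - K) + measure lebesgue {0,1::real}"
    unfolding N_def using K(3) U(3) N01(1)
    by (meson add_right_mono fmeasurable.Un fmeasurableD measure_Un_le order_trans)
  also have "\<dots> \<le> e/2 + e/2 + 0"
  proof (intro add_mono)
    show "measure lebesgue (U - E') \<le> e/2" "measure lebesgue (E' - K) \<le> e/2"
      using K(4) U(4) e by (simp_all add: emeasure_eq_measure2 K(3) U(3) ennreal_less_iff)
  qed (use N01 in simp)
  finally have Ne: "measure lebesgue N \<le> e" by simp
  have "K \<subseteq> {0..1}" using K(2) by (auto simp: E'_def)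
  then have "compact K" using K(1) bounded_subset[OF bounded_closed_interval] by (auto simp: compact_eq_bounded_closed)
  then have cA: "closed (expi 1 ` K)"
    by (intro compact_imp_closed compact_continuous_image continuous_expi)
  have "compact ({0..1} - U')" using U'(1) by (intro compact_diff) auto
  then have cB: "closed (expi 1 ` ({0..1} - U'))"
    by (intro compact_imp_closed compact_continuous_image continuous_expi)
  have "expi 1 ` K \<inter> expi 1 ` ({0..1} - U') = {}"
  proof -
    have False if "s \<in> K" "t \<in> {0..1} - U'" "expi 1 s = expi 1 t" for s t
      using expi_1_inj[OF that(3)] that K(2) U'(2) by (auto simp: E'_def subset_iff)
    then show ?thesis by blast
  qed
  then obtain V :: "complex \<Rightarrow> real" where V: "continuous_on UNIV V" "\<And>z. V z \<in> closed_segment 1 0"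
    "\<And>z. z \<in> expi 1 ` K \<Longrightarrow> V z = 1" "\<And>z. z \<in> expi 1 ` ({0..1} - U') \<Longrightarrow> V z = 0"
    using Urysohn[OF cA cB, of 1 0] by metis
  have "compact (expi 1 ` {0..1})" by (intro compact_continuous_image continuous_expi) auto
  then obtain g where g: "real_polynomial_function g" "\<And>z. z \<in> expi 1 ` {0..1} \<Longrightarrow> \<bar>V z - g z\<bar> < e"
    using Stone_Weierstrass_real_polynomial_function[OF _ continuous_on_subset[OF V(1)] e] by (metis subset_UNIV)
  show ?thesis
  proof (rule that[OF Nm Ne])
    show "trig_poly (\<lambda>t. of_real (g (expi 1 t)))" by (rule trig_poly_real_polynomial[OF g(1)])
    show "continuous_on UNIV (\<lambda>t. V (expi 1 t))"
      by (rule continuous_on_compose2[OF V(1) continuous_expi]) auto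
    show "0 \<le> V (expi 1 t) \<and> V (expi 1 t) \<le> 1" for t
      using V(2)[of "expi 1 t"] by (auto simp: closed_segment_eq_real_ivl split: if_splits)
    fix t :: real assume t: "t \<in> {0..1}"
    show "cmod (of_real (g (expi 1 t)) - of_real (V (expi 1 t))) < e"
      using g(2)[of "expi 1 t"] t by (simp flip: of_real_diff add: abs_minus_commute)
    assume "t \<notin> N"
    then consider "t \<in> K" | "t \<notin> K" "t \<notin> U'" "t \<notin> E'" "t \<noteq> 0" "t \<noteq> 1"
      using U' by (auto simp: N_def U'_def)
    then show "V (expi 1 t) = indicator E t"
      using V(3)[of "expi 1 t"] V(4)[of "expi 1 t"] t K(2) by cases (auto simp: E'_def indicator_def)
  qed
qed

lemma trig_poly_L2: "trig_poly p \<Longrightarrow> p \<in> L2 unit_leb"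
  unfolding trig_poly_def by (auto intro: L2_combination expi_L2_unit)

lemma trig_poly_S: "trig_poly p \<Longrightarrow> p \<in> S UNIV"
  unfolding trig_poly_def S_def by (auto intro: closed_span_combination expi_L2_unit)

lemma indicator_unit_L2:
  assumes N: "N \<in> lmeasurable"
  shows "indicator N \<in> L2 unit_leb" "L2_norm unit_leb (indicator N) \<le> sqrt (measure lebesgue N)"
proof -
  have m: "N \<in> sets lebesgue" using N by auto
  show "indicator N \<in> L2 unit_leb"
    using int_modulations_indicator_L2[OF m, of 0] by (simp add: int_modulations_def)
  have "(\<lambda>t. (cmod (indicator N t))\<^sup>2) = indicat_real N" by (auto simp: indicator_def)
  then have "L2_norm unit_leb (indicator N) = sqrt (measure lebesgue (N \<inter> {0..1}))"
    unfolding L2_norm_def by (simp only: integral_indicator_unit(2)[OF N])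
  also have "\<dots> \<le> sqrt (measure lebesgue N)"
    using N by (intro real_sqrt_le_mono measure_mono_fmeasurable) (auto simp: m)
  finally show "L2_norm unit_leb (indicator N) \<le> sqrt (measure lebesgue N)" .
qed

lemma int_modulations_indicator_S:
  assumes E: "E \<in> sets lebesgue" "E \<subseteq> {0..1}"
  shows "E_modulations E n \<in> S UNIV"
  unfolding S_def
proof (rule closed_span_closed[OF expi_L2_unit int_modulations_indicator_L2[OF E(1)]])
  fix e :: real assume e: "0 < e"
  define d where "d = min (e/4) ((e/4)\<^sup>2)"
  have "sqrt d \<le> sqrt ((e/4)\<^sup>2)" unfolding d_def by (intro real_sqrt_le_mono) simp
  then have d: "0 < d" "d \<le> e/4" "sqrt d \<le> e/4" using e by (auto simp: d_def)
  obtain N v p where N: "N \<in> lmeasurable" "measure lebesgue N \<le> d" and vc: "continuous_on UNIV v" and p: "trig_poly p" and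
    v: "\<And>t. 0 \<le> v t \<and> v t \<le> 1"
    and pv: "\<And>t. t \<in> {0..1} \<Longrightarrow> cmod (p t - of_real (v t)) < d"
    and vE: "\<And>t. t \<in> {0..1} \<Longrightarrow> t \<notin> N \<Longrightarrow> v t = indicator E t"
    using trig_poly_indicator[OF E d(1)] by blast
  have vm: "(\<lambda>t. complex_of_real (v t)) \<in> borel_measurable unit_leb"
    by (intro continuous_measurable_unit continuous_intros vc)
  have vL: "(\<lambda>t. complex_of_real (v t)) \<in> L2 unit_leb"
    by (rule L2_unit_bounded(1)[OF vm, of 1]) (use v in auto)
  have iL: "indicator E \<in> L2 unit_leb"
    using int_modulations_indicator_L2[OF E(1), of 0] by (simp add: int_modulations_def)
  note pL = trig_poly_L2[OF p]
  have "L2_norm unit_leb (\<lambda>t. indicator E t - of_real (v t)) \<le> 1 * L2_norm unit_leb (indicator N)"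
  proof (rule L2_dominated(2)[OF indicator_unit_L2(1)[OF N(1)]])
    show "(\<lambda>t. indicator E t - complex_of_real (v t)) \<in> borel_measurable unit_leb"
      by (rule L2_measurable[OF L2_diff[OF iL vL]])
    fix t assume "t \<in> space unit_leb"
    moreover have "indicator E t - complex_of_real (v t) = of_real (indicator E t - v t)"
      by (simp add: indicator_def)
    ultimately show "cmod (indicator E t - complex_of_real (v t)) \<le> 1 * cmod (indicator N t)"
      using vE[of t] v[of t] by (auto simp only: norm_of_real) (auto simp: indicator_def split: if_splits)
  qed simp
  also have "\<dots> \<le> sqrt (measure lebesgue N)" using indicator_unit_L2(2)[OF N(1)] by simp
  also have "\<dots> \<le> sqrt d" using N(2) by simp
  finally have 1: "L2_norm unit_leb (\<lambda>t. indicator E t - of_real (v t)) \<le> e/4" using d by linarith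
  have 2: "L2_norm unit_leb (\<lambda>t. of_real (v t) - p t) \<le> d"
    by (rule L2_unit_bounded(2)) (use pv L2_measurable[OF L2_diff[OF vL pL]] in \<open>auto simp: norm_minus_commute less_imp_le\<close>)
  have 3: "L2_norm unit_leb (\<lambda>t. indicator E t - p t) < e"
    using L2_triangle[OF L2_diff[OF iL vL] L2_diff[OF vL pL]] 1 2 d e by simp
  have q: "trig_poly (\<lambda>t. (1 * expi (of_int n) t) * p t)" by (intro trig_poly_mult trig_poly_monomial p)
  have "L2_norm unit_leb (\<lambda>t. E_modulations E n t - (1 * expi (of_int n) t) * p t) = L2_norm unit_leb (\<lambda>t. indicator E t - p t)"
    unfolding L2_norm_def int_modulations_def by (simp add: norm_mult flip: right_diff_distrib)
  with 3 trig_poly_S[OF q] show "\<exists>g\<in>closed_span unit_leb (\<lambda>n. expi (real_of_int n)) UNIV.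
      L2_norm unit_leb (\<lambda>x. E_modulations E n x - g x) < e"
    unfolding S_def by (intro bexI) auto
qed

section \<open>Functions without negative frequencies\<close>

text \<open>All frequencies of \<open>g\<close> are positive, and so are those of its powers: every term of
the exponential series except the constant one is annihilated by \<open>f\<close>.\<close>

lemma integral_exp_trig_poly:
  fixes m :: "'k \<Rightarrow> int" and d :: "'k \<Rightarrow> complex"
  assumes f: "f \<in> L2 unit_leb" and pos: "\<And>k. k \<in> K \<Longrightarrow> 0 < m k"
    and orth: "\<And>n. 0 < n \<Longrightarrow> (LINT t|unit_leb. f t * expi (of_int n) t) = 0"
  defines "g \<equiv> (\<lambda>t. \<Sum>k\<in>K. d k * expi (of_int (m k)) t)"
  shows "(LINT t|unit_leb. f t * exp (g t)) = (LINT t|unit_leb. f t)"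
proof -
  define C where "C = (\<Sum>k\<in>K. cmod (d k))"
  have gC: "cmod (g t) \<le> C" for t unfolding g_def C_def by (rule order_trans[OF norm_sum]) (simp add: norm_mult)
  have gc: "continuous_on UNIV g" unfolding g_def by (intro continuous_intros continuous_expi)
  note meas = continuous_measurable_unit
  have int: "integrable unit_leb (\<lambda>t. f t * h t)" if "continuous_on UNIV h" "\<And>t. cmod (h t) \<le> D" for h D
  proof -
    have "continuous_on UNIV (\<lambda>t. cnj (h t))" using that(1) by (intro continuous_intros)
    then have "(\<lambda>t. cnj (h t)) \<in> L2 unit_leb" using that by (intro L2_unit_bounded(1)[OF meas, of _ D]) auto
    from L2_prod_integrable[OF f this] show ?thesis by simp
  qed
  have bpow: "cmod (g t ^ k) \<le> C ^ k" for t k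
    unfolding norm_power by (intro power_mono gC norm_ge_zero)
  have pow: "(LINT t|unit_leb. f t * (expi (of_int n) t * g t ^ k)) = 0" if "0 < n" for n k
    using that
  proof (induction k arbitrary: n)
    case (Suc k)
    have "f t * (expi (of_int n) t * g t ^ Suc k) = (\<Sum>j\<in>K. d j * (f t * (expi (of_int (n + m j)) t * g t ^ k)))" for t
      by (simp add: expi_add, subst (1) g_def) (simp add: sum_distrib_left sum_distrib_right mult_ac)
    moreover have "integrable unit_leb (\<lambda>t. f t * (expi (of_int (n + m j)) t * g t ^ k))" for j
      by (rule int[where D = "C ^ k"]) (use bpow in \<open>auto simp: norm_mult intro!: continuous_intros continuous_expi gc\<close>)
    ultimately show ?case
      using Suc pos by (simp add: Bochner_Integration.integral_sum add_pos_pos del: of_int_add power_Suc)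
  qed (simp add: orth)
  have powS: "(LINT t|unit_leb. f t * g t ^ Suc k) = 0" for k
  proof -
    have "f t * g t ^ Suc k = (\<Sum>j\<in>K. d j * (f t * (expi (of_int (m j)) t * g t ^ k)))" for t
      by (simp, subst (1) g_def) (simp add: sum_distrib_left sum_distrib_right mult_ac)
    moreover have "integrable unit_leb (\<lambda>t. f t * (expi (of_int (m j)) t * g t ^ k))" for j
      by (rule int[where D = "C ^ k"]) (use bpow in \<open>auto simp: norm_mult intro!: continuous_intros continuous_expi gc\<close>)
    ultimately show ?thesis
      using pow pos by (simp add: Bochner_Integration.integral_sum)
  qed
  define s where "s N t = (\<Sum>k\<le>N. g t ^ k / fact k)" for N :: nat and t
  have s_int: "(LINT t|unit_leb. f t * s N t) = (LINT t|unit_leb. f t)" for N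
  proof (induction N)
    case (Suc N)
    have "f t * s (Suc N) t = f t * s N t + (f t * g t ^ Suc N) / fact (Suc N)" for t
      by (simp add: s_def distrib_left del: power_Suc)
    moreover have "integrable unit_leb (\<lambda>t. f t * s N t)"
      by (rule int[where D = "\<Sum>k\<le>N. C ^ k / fact k"])
         (auto simp: s_def norm_divide intro!: continuous_intros gc order_trans[OF norm_sum] sum_mono divide_right_mono bpow)
    moreover have "integrable unit_leb (\<lambda>t. f t * g t ^ Suc N)"
      by (rule int[where D = "C ^ Suc N"]) (auto simp del: power_Suc intro!: continuous_intros gc bpow)
    ultimately show ?case using Suc powS[of N] by (simp del: power_Suc)
  qed (simp add: s_def)
  have "(\<lambda>N. LINT t|unit_leb. f t * s N t) \<longlonglongrightarrow> (LINT t|unit_leb. f t * exp (g t))"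
  proof (rule integral_dominated_convergence[where w = "\<lambda>t. cmod (f t) * exp C"])
    have "integrable unit_leb f" using int[of "\<lambda>_. 1" 1] by simp
    then show "integrable unit_leb (\<lambda>t. cmod (f t) * exp C)" by simp
    show "AE t in unit_leb. (\<lambda>N. f t * s N t) \<longlonglongrightarrow> f t * exp (g t)"
    proof (intro AE_I2 tendsto_intros)
      fix t
      have "(\<lambda>n. \<Sum>k<Suc n. g t ^ k /\<^sub>R fact k) \<longlonglongrightarrow> exp (g t)"
        using exp_converges[of "g t"] unfolding sums_def by (rule LIMSEQ_Suc)
      then show "(\<lambda>N. s N t) \<longlonglongrightarrow> exp (g t)"
        unfolding s_def lessThan_Suc_atMost by (simp add: scaleR_conv_of_real field_simps)
    qed
    fix N
    show "AE t in unit_leb. norm (f t * s N t) \<le> cmod (f t) * exp C"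
    proof (intro AE_I2)
      fix t
      have "cmod (s N t) \<le> (\<Sum>k\<le>N. C ^ k /\<^sub>R fact k)"
        unfolding s_def by (rule order_trans[OF norm_sum], rule sum_mono)
          (use bpow[of t] in \<open>auto simp: norm_divide divide_simps\<close>)
      also have "\<dots> \<le> exp C"
        unfolding exp_def by (rule sum_le_suminf[OF summable_exp_generic]) (auto simp: C_def sum_nonneg)
      finally show "norm (f t * s N t) \<le> cmod (f t) * exp C" by (simp add: norm_mult mult_left_mono)
    qed
    have "s N \<in> borel_measurable unit_leb"
      unfolding s_def by (intro meas continuous_intros gc) simp
    then show "(\<lambda>t. f t * s N t) \<in> borel_measurable unit_leb"
      by (rule borel_measurable_times[OF L2_measurable[OF f]])
    show "(\<lambda>t. f t * exp (g t)) \<in> borel_measurable unit_leb"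
      by (intro borel_measurable_times L2_measurable[OF f] meas continuous_intros gc)
  qed
  then show ?thesis unfolding s_int by (simp add: LIMSEQ_const_iff)
qed

text \<open>An instance of Szego's argument. As \<open>f\<close> has no negative frequencies,
\<open>\<integral> f = \<integral> f exp g\<close> for every analytic polynomial \<open>g\<close>
of mean zero, so \<open>\<bar>\<integral> f\<bar> \<le> \<integral> \<bar>f\<bar> exp (Re
g)\<close>. Off a set \<open>N\<close> of tiny measure the real part of \<open>g\<close> can be
prescribed to be close to \<open>M (\<chi>\<^sub>E - \<bar>E\<bar>)\<close>: it is large only on
\<open>E\<close>, where \<open>f\<close> vanishes, and about \<open>- M \<bar>E\<bar>\<close>
elsewhere. The measure of \<open>N\<close> is chosen so small, depending on \<open>M\<close>, that
the whole estimate decays exponentially in \<open>M\<close>.\<close>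

lemma hardy_mean_zero:
  assumes f: "f \<in> L2 unit_leb" and E: "E \<in> sets lebesgue" "E \<subseteq> {0..1}" "0 < measure lebesgue E"
    and van: "AE t in unit_leb. t \<in> E \<longrightarrow> f t = 0"
    and orth: "\<And>n. 0 < n \<Longrightarrow> (LINT t|unit_leb. f t * expi (of_int n) t) = 0"
  shows "(LINT t|unit_leb. f t) = 0"
proof -
  define a where "a = measure lebesgue E"
  define L where "L = L2_norm unit_leb f"
  have absL: "(\<lambda>t. complex_of_real (cmod (f t))) \<in> L2 unit_leb" "L2_norm unit_leb (\<lambda>t. complex_of_real (cmod (f t))) = L"
    using f by (auto simp: L2_def L2_norm_def L_def)
  have oneL: "(\<lambda>t. 1) \<in> L2 unit_leb" by (rule L2_unit_bounded(1)) auto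
  have indf: "integrable unit_leb (\<lambda>t. cmod (f t) * indicator N t)"
      "(LINT t|unit_leb. cmod (f t) * indicator N t) \<le> L * sqrt (measure lebesgue N)" if "N \<in> lmeasurable" for N
  proof -
    have 0: "complex_of_real (cmod (f t)) * cnj (indicator N t) = complex_of_real (cmod (f t) * indicator N t)" for t
      by (simp add: indicator_def)
    have "integrable unit_leb (\<lambda>t. complex_of_real (cmod (f t) * indicator N t))"
      using L2_prod_integrable[OF absL(1) indicator_unit_L2(1)[OF that]] unfolding 0 .
    then show "integrable unit_leb (\<lambda>t. cmod (f t) * indicator N t)" by (simp only: complex_of_real_integrable_eq)
    have "cmod (L2_inner unit_leb (\<lambda>t. complex_of_real (cmod (f t))) (indicator N)) \<le> L * L2_norm unit_leb (indicator N)"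
      using L2_Cauchy_Schwarz[OF absL(1) indicator_unit_L2(1)[OF that]] absL(2) by simp
    also have "L2_inner unit_leb (\<lambda>t. complex_of_real (cmod (f t))) (indicator N) = of_real (LINT t|unit_leb. cmod (f t) * indicator N t)"
      unfolding L2_inner_def 0 by (rule integral_complex_of_real)
    also have "L * L2_norm unit_leb (indicator N) \<le> L * sqrt (measure lebesgue N)"
      by (intro mult_left_mono indicator_unit_L2(2) that) (simp add: L_def)
    finally show "(LINT t|unit_leb. cmod (f t) * indicator N t) \<le> L * sqrt (measure lebesgue N)" by simp
  qed
  have unit: "{0..1::real} \<in> lmeasurable" by simp
  have intf: "integrable unit_leb (\<lambda>t. cmod (f t))" "(LINT t|unit_leb. cmod (f t)) \<le> L"
  proof -
    have i: "integrable unit_leb (\<lambda>t. cmod (f t) * indicator {0..1} t) = integrable unit_leb (\<lambda>t. cmod (f t))"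
      by (rule Bochner_Integration.integrable_cong) auto
    have l: "(LINT t|unit_leb. cmod (f t) * indicator {0..1} t) = (LINT t|unit_leb. cmod (f t))"
      by (rule Bochner_Integration.integral_cong) auto
    show "integrable unit_leb (\<lambda>t. cmod (f t))" using indf(1)[OF unit] i by simp
    show "(LINT t|unit_leb. cmod (f t)) \<le> L" using indf(2)[OF unit] l by simp
  qed
  have main: "cmod (LINT t|unit_leb. f t) \<le> exp (- (a/2) * M) * (2 * exp 1 * L)" if M: "1 \<le> M" for M :: real
  proof -
    \<comment> \<open>\<open>1/M\<close> makes the uniform error harmless after multiplication by
    \<open>M\<close>, \<open>a/4\<close> keeps the mean of \<open>Re p\<close> above
    \<open>a/2\<close>, and \<open>exp (-2 M)\<close> compensates the factor \<open>exp M\<close>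
    on \<open>N\<close>.\<close>
    define e where "e = min (1/M) (min (a/4) (exp (-M) * exp (-M)))"
    have e: "0 < e" "e \<le> 1/M" "e \<le> a/4" "e \<le> exp (-M) * exp (-M)"
      using M E by (auto simp: e_def a_def)
    obtain N v p where N: "N \<in> lmeasurable" "measure lebesgue N \<le> e" and vc: "continuous_on UNIV v" and p: "trig_poly p" and
      v: "\<And>t. 0 \<le> v t \<and> v t \<le> 1"
      and pv: "\<And>t. t \<in> {0..1} \<Longrightarrow> cmod (p t - of_real (v t)) < e"
      and vE: "\<And>t. t \<in> {0..1} \<Longrightarrow> t \<notin> N \<Longrightarrow> v t = indicator E t"
      using trig_poly_indicator[OF E(1,2) e(1)] by blast
    have vR: "\<bar>Re (p t) - v t\<bar> < e" if "t \<in> {0..1}" for t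
      using pv[OF that] abs_Re_le_cmod[of "p t - of_real (v t)"] by simp
    obtain J c where J: "finite J" and pJ: "p = tpoly J c"
      using p unfolding trig_poly_def by auto
    define c0 where "c0 = (if 0 \<in> J then c 0 else 0)"
    \<comment> \<open>Conjugating the terms of negative frequency does not change the real part of
    \<open>p\<close>; up to its constant term, \<open>M p\<close> becomes an analytic polynomial
    \<open>g\<close>.\<close>
    define d where "d n = of_real M * (if 0 < n then c n else cnj (c n))" for n
    define g where "g = (\<lambda>t. \<Sum>n\<in>J - {0}. d n * expi (of_int \<bar>n\<bar>) t)"
    have Reg: "M * Re (p t) = M * Re c0 + Re (g t)" for t
    proof -
      have "Re (d n * expi (of_int \<bar>n\<bar>) t) = M * Re (c n * expi (of_int n) t)" if "n \<noteq> 0" for n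
      proof (cases "0 < n")
        case False
        have "d n * expi (of_int \<bar>n\<bar>) t = of_real M * cnj (c n * expi (of_int n) t)"
          using False by (simp add: d_def cnj_expi mult.assoc)
        moreover have "Re (of_real M * cnj z) = M * Re z" for z by simp
        ultimately show ?thesis by presburger
      qed (simp add: d_def mult.assoc)
      then have "Re (g t) = M * (\<Sum>n\<in>J - {0}. Re (c n * expi (of_int n) t))"
        unfolding g_def by (simp add: sum_distrib_left del: times_complex.sel of_int_abs)
      moreover have "Re (p t) = Re c0 + (\<Sum>n\<in>J - {0}. Re (c n * expi (of_int n) t))"
        unfolding pJ c0_def using J by (cases "0 \<in> J") (simp_all add: sum.remove[of J 0] del: times_complex.sel)
      ultimately show ?thesis by (simp add: distrib_left)
    qed
    have intp: "integrable unit_leb p" "(LINT t|unit_leb. p t) = c0"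
    proof -
      have i: "integrable unit_leb (expi (of_int n))" for n :: int
        by (rule continuous_imp_integrable_real[OF continuous_expi])
      then show "integrable unit_leb p" unfolding pJ by auto
      have "(LINT t|unit_leb. p t) = (\<Sum>n\<in>J. c n * (if n = 0 then 1 else 0))"
        unfolding pJ using i by (simp add: Bochner_Integration.integral_sum integral_expi)
      also have "\<dots> = c0" using J by (simp add: c0_def if_distrib cong: if_cong)
      finally show "(LINT t|unit_leb. p t) = c0" .
    qed
    have c0: "a / 2 \<le> Re c0"
    proof -
      note Em = unit_subset_lmeasurable[OF E(1,2)]
      have indint: "integrable unit_leb (indicat_real E)" "integrable unit_leb (indicat_real N)" "integrable unit_leb (\<lambda>t. e)"
        using integral_indicator_unit(1) Em N(1) finite_measure.integrable_const[OF finite_measure_unit] by auto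
      have "Re c0 = (LINT t|unit_leb. Re (p t))" using intp by (simp add: integral_Re)
      also have "\<dots> \<ge> (LINT t|unit_leb. indicat_real E t - indicat_real N t - e)"
      proof (rule integral_mono)
        show "integrable unit_leb (\<lambda>t. Re (p t))" using intp by simp
        fix t assume t: "t \<in> space unit_leb"
        then have "indicat_real E t - indicat_real N t \<le> v t" using vE[of t] v[of t] by (auto simp: indicator_def)
        then show "indicat_real E t - indicat_real N t - e \<le> Re (p t)" using vR[of t] t by (auto simp: abs_less_iff)
      qed (use indint in auto)
      also have "(LINT t|unit_leb. indicat_real E t - indicat_real N t - e) = a - measure lebesgue (N \<inter> {0..1}) - e"
      proof -
        have "E \<inter> {0..1} = E" using E(2) by auto
        then show ?thesis
          using indint integral_indicator_unit(2)[OF Em] integral_indicator_unit(2)[OF N(1)]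
          by (simp only: Bochner_Integration.integral_diff Bochner_Integration.integrable_diff a_def) simp
      qed
      finally have "a - measure lebesgue (N \<inter> {0..1}) - e \<le> Re c0" .
      moreover have "measure lebesgue (N \<inter> {0..1}) \<le> measure lebesgue N"
        using N(1) by (intro measure_mono_fmeasurable) auto
      ultimately show ?thesis using N(2) e(3) by linarith
    qed
    have ge: "(LINT t|unit_leb. f t * exp (g t)) = (LINT t|unit_leb. f t)"
      unfolding g_def by (rule integral_exp_trig_poly[OF f]) (use orth in auto)
    have bound: "AE t in unit_leb. cmod (f t * exp (g t)) \<le>
        exp (- (a/2) * M) * (exp 1 * cmod (f t) + exp (M + 1) * (cmod (f t) * indicator N t))"
      using van AE_space
    proof eventually_elim
      case (elim t)
      then have t: "t \<in> {0..1}" by simp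
      show ?case
      proof (cases "t \<in> E")
        case False
        have "Re (g t) = M * Re (p t) - M * Re c0" using Reg[of t] by simp
        also have "\<dots> \<le> M * (v t + e) - M * (a/2)"
          using vR[OF t] c0 M by (intro diff_mono mult_left_mono) auto
        also have "\<dots> \<le> M * v t + 1 - M * (a/2)"
          using M mult_left_mono[OF e(2), of M] by (simp add: distrib_left)
        also have "M * v t \<le> M * indicator N t"
          using vE[OF t] v[of t] False M by (intro mult_left_mono) (auto simp: indicator_def)
        finally have "Re (g t) \<le> - (a/2) * M + (M * indicator N t + 1)" by (simp add: mult.commute)
        then have "exp (Re (g t)) \<le> exp (- (a/2) * M) * exp (M * indicator N t + 1)"
          unfolding exp_add[symmetric] by simp
        also have "\<dots> \<le> exp (- (a/2) * M) * (exp 1 + exp (M + 1) * indicator N t)"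
          by (intro mult_left_mono) (auto simp: indicator_def)
        finally have "cmod (f t) * exp (Re (g t)) \<le> cmod (f t) * (exp (- (a/2) * M) * (exp 1 + exp (M + 1) * indicator N t))"
          by (rule mult_left_mono) simp
        then show ?thesis by (simp add: norm_mult algebra_simps)
      qed (use elim in auto)
    qed
    have "cmod (LINT t|unit_leb. f t) = cmod (LINT t|unit_leb. f t * exp (g t))" by (simp add: ge)
    also have "\<dots> \<le> (LINT t|unit_leb. cmod (f t * exp (g t)))" by (rule integral_norm_bound)
    also have "\<dots> \<le> (LINT t|unit_leb. exp (- (a/2) * M) * (exp 1 * cmod (f t) + exp (M + 1) * (cmod (f t) * indicator N t)))"
      by (rule integral_mono_AE'[OF _ bound]) (use intf indf(1)[OF N(1)] in \<open>auto intro!: AE_I2\<close>)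
    also have "\<dots> = exp (- (a/2) * M) * (exp 1 * (LINT t|unit_leb. cmod (f t)) + exp (M + 1) * (LINT t|unit_leb. cmod (f t) * indicator N t))"
      using intf indf(1)[OF N(1)] by simp
    also have "\<dots> \<le> exp (- (a/2) * M) * (exp 1 * L + exp (M + 1) * (L * exp (- M)))"
    proof (intro mult_left_mono add_mono intf)
      have "sqrt (measure lebesgue N) \<le> sqrt ((exp (- M))\<^sup>2)"
        using N(2) e(4) by (intro real_sqrt_le_mono) (simp add: power2_eq_square)
      then have "L * sqrt (measure lebesgue N) \<le> L * exp (- M)"
        by (intro mult_left_mono) (auto simp: L_def)
      then show "(LINT t|unit_leb. cmod (f t) * indicator N t) \<le> L * exp (- M)"
        using indf(2)[OF N(1)] by linarith
    qed auto
    also have "exp (M + 1) * (L * exp (- M)) = exp 1 * L"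
      by (simp add: exp_add exp_minus field_simps)
    finally show ?thesis by (simp add: mult_ac)
  qed
  have "((\<lambda>M. exp (- (a/2) * M) * (2 * exp 1 * L)) \<longlongrightarrow> 0 * (2 * exp 1 * L)) at_top"
  proof (intro tendsto_mult tendsto_const)
    have "filterlim (\<lambda>M. (a/2) * M) at_top at_top"
      using E(3) by (intro filterlim_tendsto_pos_mult_at_top[OF tendsto_const _ filterlim_ident]) (simp add: a_def)
    then have "filterlim (\<lambda>M. - ((a/2) * M)) at_bot at_top" by (rule filterlim_uminus_at_bot_at_top[THEN filterlim_compose])
    then show "((\<lambda>M. exp (- (a/2) * M)) \<longlongrightarrow> 0) at_top"
      using filterlim_compose[OF exp_at_bot] by simp
  qed
  then have "cmod (LINT t|unit_leb. f t) \<le> 0 * (2 * exp 1 * L)"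
    by (rule tendsto_le[OF trivial_limit_at_top_linorder _ tendsto_const])
       (use main in \<open>auto simp: eventually_at_top_linorder\<close>)
  then show ?thesis by simp
qed

text \<open>If all coefficients of \<open>f\<close> below \<open>n\<close> vanish, then \<open>f
e\<^sub>-\<^sub>n\<close> again has no negative frequencies and vanishes on \<open>E\<close>, so
its mean, which is the \<open>n\<close>-th coefficient of \<open>f\<close>, is zero.\<close>

lemma hardy_vanishing:
  assumes f: "f \<in> L2 unit_leb" and E: "E \<in> sets lebesgue" "E \<subseteq> {0..1}" "0 < measure lebesgue E"
    and van: "AE t in unit_leb. t \<in> E \<longrightarrow> f t = 0"
    and orth: "\<And>n. n < 0 \<Longrightarrow> L2_inner unit_leb f (expi (of_int n)) = 0"
  shows "L2_inner unit_leb f (expi (of_int n)) = 0"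
proof -
  have coef: "L2_inner unit_leb f (expi (of_int (int n))) = 0" for n
  proof (induction n rule: less_induct)
    case (less n)
    have below: "L2_inner unit_leb f (expi (of_int m)) = 0" if "m < int n" for m
    proof (cases "m < 0")
      case False
      then have "m = int (nat m)" "nat m < n" using that by auto
      with less show ?thesis by metis
    qed (use orth in auto)
    define h where "h t = f t * expi (of_int (- int n)) t" for t
    have hL: "h \<in> L2 unit_leb" unfolding h_def
      by (rule L2_dominated(1)[OF f, where C = 1])
         (auto simp: norm_mult intro!: borel_measurable_times L2_measurable[OF f])
    have int: "(LINT t|unit_leb. h t * expi (of_int m) t) = L2_inner unit_leb f (expi (of_int (int n - m)))" for m
      unfolding L2_inner_def h_def cnj_expi mult.assoc expi_add[symmetric] by simp
    have "(LINT t|unit_leb. h t) = 0"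
    proof (rule hardy_mean_zero[OF hL E])
      show "AE t in unit_leb. t \<in> E \<longrightarrow> h t = 0" using van by eventually_elim (auto simp: h_def)
      show "(LINT t|unit_leb. h t * expi (of_int m) t) = 0" if "0 < m" for m
        unfolding int by (rule below) (use that in simp)
    qed
    then show ?case using int[of 0] by simp
  qed
  show ?thesis
  proof (cases "n < 0")
    case False
    then show ?thesis using coef[of "nat n"] by simp
  qed (use orth in auto)
qed

text \<open>If \<open>\<Sum> a\<^sub>n e\<^sub>n \<chi>\<^sub>E = 0\<close>, then the function \<open>f =
\<Sum> a\<^sub>n e\<^sub>n\<close> vanishes on \<open>E\<close> and has only nonnegative
frequencies, so it has no nonzero coefficient. Thus the synthesis map is injective.\<close>

lemma frame_sequence_nonneg_imp_riesz:
  assumes E: "E \<in> sets lebesgue" "E \<subseteq> {0..1}" "0 < measure lebesgue E" and A: "A \<subseteq> {0..}"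
    and fr: "frame_sequence unit_leb (E_modulations E) A"
  shows "riesz_basic_sequence unit_leb (E_modulations E) A"
proof (rule frame_sequence_injective_imp_riesz[OF fr])
  fix a g assume a: "(\<lambda>i. (cmod (a i))\<^sup>2) summable_on A"
    and g: "L2_has_sum unit_leb (\<lambda>i x. a i * E_modulations E i x) A g"
    and g0: "L2_norm unit_leb g = 0"
  note F = int_modulations_indicator_L2[OF E(1)]
  have "synth_upper unit_leb int_expi A 1"
    unfolding synth_upper_def by (auto simp: trig_norm)
  from L2_has_sum_exists[OF this _ expi_L2_unit a]
  obtain f where f: "L2_has_sum unit_leb (\<lambda>n x. a n * expi (of_int n) x) A f" by auto
  then have fL: "f \<in> L2 unit_leb" by (simp add: L2_has_sum_def)
  have "L2_has_sum unit_leb (\<lambda>i x. a i * E_modulations E i x) A (proj E f)"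
    unfolding L2_has_sum_def
  proof (intro conjI proj_L2(1)[OF E(1) fL] tendsto_sandwich[OF _ _ tendsto_const f[unfolded L2_has_sum_def, THEN conjunct2]])
    show "\<forall>\<^sub>F J in finite_subsets_at_top A. L2_norm unit_leb (\<lambda>x. (lincomb J a (E_modulations E) x) - proj E f x)
        \<le> L2_norm unit_leb (\<lambda>x. (tpoly J a x) - f x)"
    proof (rule eventually_finite_subsets_at_top_weakI)
      fix J assume "finite J" "J \<subseteq> A"
      have "(\<lambda>x. (lincomb J a (E_modulations E) x) - proj E f x) = proj E (\<lambda>x. (tpoly J a x) - f x)"
        by (auto simp: proj_def int_modulations_def left_diff_distrib sum_distrib_right mult.assoc)
      then show "L2_norm unit_leb (\<lambda>x. (lincomb J a (E_modulations E) x) - proj E f x)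
        \<le> L2_norm unit_leb (\<lambda>x. (tpoly J a x) - f x)"
        using proj_L2(2)[OF E(1) L2_diff[OF L2_combination[OF expi_L2_unit] fL]] by simp
    qed
  qed simp
  from tendsto_unique[OF finite_subsets_at_top_neq_bot L2_has_sum_norm[OF this] L2_has_sum_norm[OF g]]
  have "L2_norm unit_leb (proj E f) = 0" using F g0 by (simp add: L2_scale)
  then have "AE t in unit_leb. proj E f t = 0" using proj_L2(1)[OF E(1) fL] by (simp add: L2_norm_eq_0_iff)
  then have van: "AE t in unit_leb. t \<in> E \<longrightarrow> f t = 0"
    by eventually_elim (auto simp: proj_def indicator_def split: if_splits)
  have coef: "L2_inner unit_leb f (expi (of_int n)) = (if n \<in> A then a n else 0)" for n
  proof -
    have "((\<lambda>i. L2_inner unit_leb (\<lambda>x. a i * expi (of_int i) x) (expi (of_int n))) has_sum L2_inner unit_leb f (expi (of_int n))) A"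
      by (rule L2_has_sum_inner[OF f]) (auto intro: L2_scale expi_L2_unit)
    then have 1: "((\<lambda>i. if i = n then a n else 0) has_sum L2_inner unit_leb f (expi (of_int n))) A"
      unfolding L2_inner_scale_left expi_orthonormal by (simp add: if_distrib cong: if_cong has_sum_cong)
    have "((\<lambda>i. if i = n then a n else 0) has_sum (\<Sum>i\<in>A \<inter> {n}. a n)) A"
      by (rule has_sum_cong_neutral[THEN iffD1, OF _ _ _ has_sum_finite]) auto
    from has_sum_unique[OF 1 this] show ?thesis by (auto simp: Int_insert_right)
  qed
  have "L2_inner unit_leb f (expi (of_int n)) = 0" for n
    by (rule hardy_vanishing[OF fL E van]) (use A coef in auto)
  then show "\<forall>i\<in>A. a i = 0" using coef by (metis (full_types))
qed

section \<open>Real frequencies\<close>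

lemma L2_norm_translate:
  fixes m :: real
  shows "L2_norm lebesgue (\<lambda>t. f (m + t)) = L2_norm lebesgue f"
  unfolding L2_norm_def using lebesgue_integral_real_affine[of 1 "\<lambda>t. (cmod (f t))\<^sup>2" m] by simp

lemma L2_translate:
  fixes m :: real
  assumes "f \<in> L2 lebesgue" shows "(\<lambda>t. f (m + t)) \<in> L2 lebesgue"
proof -
  have "(\<lambda>t. m + t) \<in> lebesgue \<rightarrow>\<^sub>M lebesgue"
    using lebesgue_affine_measurable[of "\<lambda>_. 1" m] by simp
  from measurable_compose[OF this L2_measurable[OF assms]]
  show ?thesis
    using assms lebesgue_integrable_real_affine_iff[of 1 "\<lambda>t. (cmod (f t))\<^sup>2" m] by (simp add: L2_def)
qed

lemma L2_mult_indicator: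
  assumes "f \<in> L2 M" "A \<in> sets M"
  shows "(\<lambda>t. f t * indicator A t) \<in> L2 M"
proof (rule L2_dominated(1)[OF assms(1), of _ 1])
  show "(\<lambda>t. f t * indicator A t) \<in> borel_measurable M"
    using assms by (intro borel_measurable_times[OF L2_measurable]) auto
qed (auto simp: indicator_def)

text \<open>The line is a countable union of intervals \<open>[m, m+1]\<close>, and on one of them where
\<open>\<phi>\<close> is not almost everywhere zero, the support of \<open>\<phi>\<close> is the
countable union of the sets \<open>\<bar>\<phi>\<bar> \<ge> 1/(k+1)\<close>.\<close>

lemma L2_nonzero_bounded_below:
  fixes \<phi> :: "real \<Rightarrow> complex"
  assumes \<phi>: "\<phi> \<in> L2 lebesgue" "L2_nonzero lebesgue \<phi>"
  obtains m :: int and c :: real and E where "0 < c" "E \<in> sets lebesgue" "E \<subseteq> {0..1}" "0 < measure lebesgue E"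
    "\<And>t. t \<in> E \<Longrightarrow> c \<le> cmod (\<phi> (of_int m + t))"
proof -
  have "\<exists>m :: int. \<not> (AE t in lebesgue. \<phi> (of_int m + t) * indicator {0..1} t = 0)"
  proof (rule ccontr)
    assume "\<not> ?thesis"
    then have z: "AE t in lebesgue. \<phi> (of_int m + t) * indicator {0..1} t = 0" for m :: int by auto
    have "AE t in lebesgue. \<phi> t * indicator {of_int m..of_int m + 1} t = 0" for m :: int
    proof -
      define h where "h t = \<phi> t * indicator {of_int m..of_int m + 1} t" for t
      have hL: "h \<in> L2 lebesgue" unfolding h_def by (rule L2_mult_indicator[OF \<phi>(1)]) simp
      have eq: "h (of_int m + t) = \<phi> (of_int m + t) * indicator {0..1} t" for t
        by (auto simp: h_def indicator_def)
      have "L2_norm lebesgue (\<lambda>t. h (of_int m + t)) = 0"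
        using z[of m] L2_translate[OF hL, of "of_int m"] by (simp add: L2_norm_eq_0_iff eq)
      then have "L2_norm lebesgue h = 0" by (simp add: L2_norm_translate)
      then show ?thesis using hL by (simp add: L2_norm_eq_0_iff h_def)
    qed
    then have "AE t in lebesgue. \<forall>m :: int. \<phi> t * indicator {of_int m..of_int m + 1} t = 0"
      unfolding AE_all_countable by blast
    then have "AE t in lebesgue. \<phi> t = 0"
    proof eventually_elim
      case (elim t)
      have "t \<in> {of_int \<lfloor>t\<rfloor>..of_int \<lfloor>t\<rfloor> + 1}" using floor_correct[of t] by (auto intro: less_imp_le)
      with elim[rule_format, of "\<lfloor>t\<rfloor>"] show ?case by simp
    qed
    with \<phi>(2) show False by (simp add: L2_nonzero_def)
  qed
  then obtain m :: int where m: "\<not> (AE t in lebesgue. \<phi> (of_int m + t) * indicator {0..1} t = 0)" by blast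
  define G where "G k = {t \<in> space lebesgue. inverse (real (Suc k)) \<le> cmod (\<phi> (of_int m + t))} \<inter> {0..1}" for k
  have Gs: "G k \<in> sets lebesgue" for k
    unfolding G_def using L2_measurable[OF L2_translate[OF \<phi>(1), of "of_int m"]]
    by (intro sets.Int borel_measurable_le borel_measurable_norm) auto
  have "\<exists>k. measure lebesgue (G k) \<noteq> 0"
  proof (rule ccontr)
    assume "\<not> ?thesis"
    then have G0: "measure lebesgue (G k) = 0" for k by auto
    have Gm: "G k \<in> lmeasurable" for k
      by (rule unit_subset_lmeasurable[OF Gs]) (auto simp: G_def)
    have "G k \<in> null_sets lebesgue" for k
      using Gs[of k] G0[of k] Gm[of k] by (auto simp: null_sets_def emeasure_eq_measure2)
    then have "AE t in lebesgue. t \<notin> G k" for k by (rule AE_not_in)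
    then have "AE t in lebesgue. \<forall>k. t \<notin> G k" by (simp add: AE_all_countable)
    then have "AE t in lebesgue. \<phi> (of_int m + t) * indicator {0..1} t = 0"
    proof eventually_elim
      case (elim t)
      show ?case
      proof (rule ccontr)
        assume a: "\<not> ?case"
        then have "0 < cmod (\<phi> (of_int m + t))" "t \<in> {0..1}" by (auto simp: indicator_def split: if_splits)
        then obtain k where "inverse (real (Suc k)) < cmod (\<phi> (of_int m + t))" using reals_Archimedean by blast
        with elim \<open>t \<in> {0..1}\<close> show False by (auto simp: G_def dest!: spec[of _ k])
      qed
    qed
    with m show False by simp
  qed
  then obtain k where k: "0 < measure lebesgue (G k)" by (auto simp: less_le)
  show ?thesis
    by (rule that[OF _ Gs _ k, of "inverse (real (Suc k))" m]) (auto simp: G_def)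
qed

text \<open>Translation by \<open>m\<close> moves the set where \<open>\<bar>\<phi>\<bar> \<ge> c\<close> into
\<open>[0,1]\<close> and multiplies the coefficients by unimodular numbers.\<close>

lemma norm_modulations_ge:
  assumes \<phi>: "\<phi> \<in> L2 lebesgue" and E: "E \<in> sets lebesgue" "E \<subseteq> {0..1}" and c: "0 < c"
    and low: "\<And>t. t \<in> E \<Longrightarrow> c \<le> cmod (\<phi> (of_int m + t))" and J: "finite J"
  shows "c * L2_norm unit_leb (proj E (\<lambda>t. \<Sum>j\<in>J. (x j * expi (l j) (of_int m)) * expi (l j) t))
     \<le> L2_norm lebesgue (lincomb J x (real_modulations l \<phi>))"
proof -
  define g where "g = (\<lambda>t. \<Sum>j\<in>J. (x j * expi (l j) (of_int m)) * expi (l j) t)"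
  define D where "D = (\<Sum>j\<in>J. cmod (x j))"
  have gD: "cmod (g t) \<le> D" for t
    unfolding g_def D_def by (rule order_trans[OF norm_sum]) (simp add: norm_mult)
  have gm: "g \<in> borel_measurable lebesgue" unfolding g_def by measurable
  have \<phi>m: "(\<lambda>t. \<phi> (of_int m + t)) \<in> L2 lebesgue" by (rule L2_translate[OF \<phi>])
  have hL: "(\<lambda>t. g t * \<phi> (of_int m + t)) \<in> L2 lebesgue"
  proof (rule L2_dominated(1)[OF \<phi>m])
    show "(\<lambda>t. g t * \<phi> (of_int m + t)) \<in> borel_measurable lebesgue"
      by (intro borel_measurable_times gm L2_measurable[OF \<phi>m])
    show "cmod (g t * \<phi> (of_int m + t)) \<le> D * cmod (\<phi> (of_int m + t))" for t
      unfolding norm_mult by (intro mult_right_mono gD) simp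
  qed
  have "L2_norm unit_leb (proj E g) = L2_norm lebesgue (\<lambda>t. proj E g t * indicator {0..1} t)"
    by (rule L2_norm_unit)
  also have "(\<lambda>t. proj E g t * indicator {0..1} t) = (\<lambda>t. g t * indicator E t)"
    using E(2) by (auto simp: proj_def indicator_def fun_eq_iff)
  also have "L2_norm lebesgue (\<lambda>t. g t * indicator E t) \<le> (1/c) * L2_norm lebesgue (\<lambda>t. g t * \<phi> (of_int m + t))"
  proof (rule L2_dominated(2)[OF hL])
    show "(\<lambda>t. g t * indicator E t) \<in> borel_measurable lebesgue"
      using E(1) by (intro borel_measurable_times gm) auto
    show "cmod (g t * indicator E t) \<le> 1 / c * cmod (g t * \<phi> (of_int m + t))" for t
    proof (cases "t \<in> E")
      case True
      have "cmod (g t) * c \<le> cmod (g t) * cmod (\<phi> (of_int m + t))" by (intro mult_left_mono low True) simp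
      then show ?thesis using True c by (simp add: norm_mult field_simps)
    qed (use c in auto)
  qed (use c in auto)
  also have "(\<lambda>t. g t * \<phi> (of_int m + t)) = (\<lambda>t. (\<Sum>j\<in>J. x j * real_modulations l \<phi> j (of_int m + t)))"
    by (rule ext) (simp add: g_def real_modulations_def expi_shift sum_distrib_right, simp add: mult_ac)
  also have "L2_norm lebesgue \<dots> = L2_norm lebesgue (lincomb J x (real_modulations l \<phi>))"
    by (rule L2_norm_translate)
  finally show ?thesis unfolding g_def[symmetric] using c by (simp add: field_simps)
qed

lemma synth_expi: "synth_upper unit_leb int_expi I 1" "synth_lower unit_leb int_expi I 1"
  by (auto simp: synth_upper_def synth_lower_def trig_norm)

text \<open>Expanding \<open>exp (2 \<pi> \<i> \<epsilon>\<^sub>i t) - 1\<close> as a power series in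
\<open>t\<close> separates the variables: the \<open>j\<close>-th term is \<open>(2 \<pi> \<i>
t)\<^sup>j / j!\<close> times a trigonometric polynomial with coefficients \<open>c\<^sub>i
\<epsilon>\<^sub>i\<^sup>j\<close>, whose norm is at most \<open>\<delta>\<^sup>j
\<parallel>c\<parallel>\<close> by orthonormality. Summing over \<open>j \<ge> 1\<close> gives the
factor \<open>exp (2 \<pi> \<delta>) - 1\<close>.\<close>

lemma perturbed_exponentials:
  fixes k :: "'i \<Rightarrow> int"
  assumes J: "finite J" and k: "inj_on k J" and \<epsilon>: "\<And>i. i \<in> J \<Longrightarrow> \<bar>\<epsilon> i\<bar> \<le> \<delta>" and \<delta>: "0 \<le> \<delta>"
  shows "L2_norm unit_leb (\<lambda>t. \<Sum>i\<in>J. c i * (expi (of_int (k i)) t * (expi (\<epsilon> i) t - 1)))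
     \<le> (exp (2 * pi * \<delta>) - 1) * sqrt (energy J c)"
proof -
  define C where "C = sqrt (energy J c)"
  define z where "z i t = 2 * complex_of_real pi * \<i> * of_real (\<epsilon> i) * of_real t" for i t
  define full where "full = (\<lambda>t. \<Sum>i\<in>J. c i * (expi (of_int (k i)) t * (expi (\<epsilon> i) t - 1)))"
  define part where "part N t = (\<Sum>j\<in>{1..N}. ((2 * complex_of_real pi * \<i> * of_real t) ^ j / fact j) *
      (\<Sum>i\<in>J. (c i * of_real (\<epsilon> i ^ j)) * expi (of_int (k i)) t))" for N :: nat and t
  define r where "r N = exp (2 * pi * \<delta>) * (2 * pi * \<delta>) ^ Suc N / fact N" for N :: nat
  have C0: "0 \<le> C" by (simp add: C_def sum_nonneg)
  note meas = continuous_measurable_unit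
  have up: "synth_upper unit_leb (\<lambda>i. expi (of_int (k i))) J 1"
    using synth_reindex(1)[OF k, of unit_leb "\<lambda>n. expi (of_int n)" 1] synth_expi(1) by simp
  have partL: "part N \<in> L2 unit_leb \<and> L2_norm unit_leb (part N) \<le> (exp (2 * pi * \<delta>) - 1) * C" for N
  proof -
    define G where "G j t = (\<Sum>i\<in>J. (c i * of_real (\<epsilon> i ^ j)) * expi (of_int (k i)) t)" for j :: nat and t
    define H where "H j t = ((2 * complex_of_real pi * \<i> * of_real t) ^ j / fact j) * G j t" for j :: nat and t
    have GL: "G j \<in> L2 unit_leb" for j unfolding G_def by (intro L2_combination expi_L2_unit)
    have Gn: "L2_norm unit_leb (G j) \<le> \<delta> ^ j * C" for j
    proof (rule power2_le_imp_le)
      have "(L2_norm unit_leb (G j))\<^sup>2 \<le> 1 * (\<Sum>i\<in>J. (cmod (c i * of_real (\<epsilon> i ^ j)))\<^sup>2)"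
        unfolding G_def by (rule synth_upperD[OF up J]) simp
      also have "\<dots> \<le> 1 * (\<Sum>i\<in>J. (cmod (c i))\<^sup>2 * (\<delta> ^ j)\<^sup>2)"
        unfolding norm_mult power_mult_distrib norm_of_real power_abs
        by (intro mult_left_mono sum_mono power_mono) (auto intro: \<epsilon>)
      also have "\<dots> = (\<delta> ^ j * C)\<^sup>2"
        by (simp add: C_def power_mult_distrib sum_nonneg sum_distrib_right[symmetric])
      finally show "(L2_norm unit_leb (G j))\<^sup>2 \<le> (\<delta> ^ j * C)\<^sup>2" .
    qed (use \<delta> C0 in auto)
    have Hb: "H j \<in> L2 unit_leb \<and> L2_norm unit_leb (H j) \<le> ((2 * pi * \<delta>) ^ j / fact j) * C" for j
    proof -
      have m: "H j \<in> borel_measurable unit_leb"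
        unfolding H_def G_def by (intro meas continuous_intros continuous_expi) auto
      have b: "cmod (H j t) \<le> ((2 * pi) ^ j / fact j) * cmod (G j t)" if "t \<in> space unit_leb" for t
      proof -
        have "(2 * pi * \<bar>t\<bar>) ^ j \<le> (2 * pi) ^ j" using that by (intro power_mono) auto
        then have "cmod ((2 * complex_of_real pi * \<i> * of_real t) ^ j / fact j) \<le> (2 * pi) ^ j / fact j"
          by (simp add: norm_divide norm_power norm_mult divide_right_mono)
        then show ?thesis unfolding H_def norm_mult by (rule mult_right_mono) simp
      qed
      have "L2_norm unit_leb (H j) \<le> ((2 * pi) ^ j / fact j) * L2_norm unit_leb (G j)"
        by (rule L2_dominated(2)[OF GL m b]) auto
      also have "\<dots> \<le> ((2 * pi) ^ j / fact j) * (\<delta> ^ j * C)" by (intro mult_left_mono Gn) auto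
      finally show ?thesis using L2_dominated(1)[OF GL m b] by (simp add: power_mult_distrib)
    qed
    have part: "part N = (\<lambda>t. \<Sum>j\<in>{1..N}. H j t)" by (rule ext) (simp add: part_def H_def G_def)
    have "L2_norm unit_leb (part N) \<le> (\<Sum>j\<in>{1..N}. L2_norm unit_leb (H j))"
      unfolding part by (rule L2_norm_sum_le) (use Hb in auto)
    also have "\<dots> \<le> (\<Sum>j\<in>{1..N}. ((2 * pi * \<delta>) ^ j / fact j) * C)" by (intro sum_mono) (use Hb in auto)
    also have "\<dots> = (\<Sum>j\<in>{1..N}. (2 * pi * \<delta>) ^ j / fact j) * C" by (simp add: sum_distrib_right)
    also have "\<dots> \<le> (exp (2 * pi * \<delta>) - 1) * C"
    proof (intro mult_right_mono C0)
      have "(\<Sum>j\<in>{0..N}. (2 * pi * \<delta>) ^ j /\<^sub>R fact j) \<le> exp (2 * pi * \<delta>)"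
        unfolding exp_def by (rule sum_le_suminf[OF summable_exp_generic]) (use \<delta> in auto)
      then show "(\<Sum>j\<in>{1..N}. (2 * pi * \<delta>) ^ j / fact j) \<le> exp (2 * pi * \<delta>) - 1"
        by (subst (asm) sum.atLeast_Suc_atMost) (auto simp: divide_inverse mult.commute)
    qed
    finally have "L2_norm unit_leb (part N) \<le> (exp (2 * pi * \<delta>) - 1) * C" .
    moreover have "part N \<in> L2 unit_leb" unfolding part by (rule L2_sum) (use Hb in auto)
    ultimately show ?thesis by simp
  qed
  have fullm: "full \<in> borel_measurable unit_leb"
    unfolding full_def by (intro meas continuous_intros continuous_expi)
  have close: "cmod (full t - part N t) \<le> (\<Sum>i\<in>J. cmod (c i)) * r N" if t: "t \<in> {0..1}" for t N
  proof -
    have part: "part N t = (\<Sum>i\<in>J. c i * (expi (of_int (k i)) t * ((\<Sum>j\<le>N. z i t ^ j / fact j) - 1)))"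
    proof -
      have "part N t = (\<Sum>i\<in>J. \<Sum>j\<in>{1..N}. c i * (expi (of_int (k i)) t * (z i t ^ j / fact j)))"
        unfolding part_def sum_distrib_left
        by (subst sum.swap) (simp add: z_def power_mult_distrib mult_ac)
      also have "(\<Sum>j\<in>{1..N}. z i t ^ j / fact j) = (\<Sum>j\<le>N. z i t ^ j / fact j) - 1" for i
        by (simp add: atMost_atLeast0 sum.atLeast_Suc_atMost)
      then have "(\<Sum>j\<in>{1..N}. c i * (expi (of_int (k i)) t * (z i t ^ j / fact j))) =
          c i * (expi (of_int (k i)) t * ((\<Sum>j\<le>N. z i t ^ j / fact j) - 1))" for i
        by (simp only: sum_distrib_left[symmetric])
      then have "(\<Sum>i\<in>J. \<Sum>j\<in>{1..N}. c i * (expi (of_int (k i)) t * (z i t ^ j / fact j))) =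
          (\<Sum>i\<in>J. c i * (expi (of_int (k i)) t * ((\<Sum>j\<le>N. z i t ^ j / fact j) - 1)))"
        by simp
      finally show ?thesis .
    qed
    have "full t - part N t = (\<Sum>i\<in>J. c i * (expi (of_int (k i)) t * (exp (z i t) - (\<Sum>j\<le>N. z i t ^ j / fact j))))"
      unfolding full_def part sum_subtractf[symmetric]
      by (intro sum.cong) (auto simp: expi_def z_def algebra_simps)
    also have "cmod \<dots> \<le> (\<Sum>i\<in>J. cmod (c i) * r N)"
    proof (rule sum_norm_le)
      fix i assume i: "i \<in> J"
      have zb: "cmod (z i t) \<le> 2 * pi * \<delta>"
      proof -
        have "\<bar>\<epsilon> i\<bar> * \<bar>t\<bar> \<le> \<delta> * 1" using \<epsilon>[OF i] t \<delta> by (intro mult_mono) auto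
        then show ?thesis by (simp add: z_def norm_mult)
      qed
      have "cmod (exp (z i t) - (\<Sum>j\<le>N. z i t ^ j / fact j)) \<le> exp (cmod (z i t)) * (cmod (z i t) ^ Suc N) / fact N"
        by (rule Taylor_exp_field)
      also have "\<dots> \<le> r N"
        unfolding r_def using zb \<delta> by (intro divide_right_mono mult_mono power_mono) auto
      finally show "cmod (c i * (expi (of_int (k i)) t * (exp (z i t) - (\<Sum>j\<le>N. z i t ^ j / fact j)))) \<le> cmod (c i) * r N"
        by (simp add: norm_mult mult_left_mono)
    qed
    finally show ?thesis by (simp add: sum_distrib_right)
  qed
  have bnd: "L2_norm unit_leb full \<le> (exp (2 * pi * \<delta>) - 1) * C + (\<Sum>i\<in>J. cmod (c i)) * r N" for N
  proof -
    have dm: "(\<lambda>t. full t - part N t) \<in> borel_measurable unit_leb"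
      using fullm partL[of N] L2_measurable by (intro borel_measurable_diff) auto
    note d = L2_unit_bounded[OF dm close]
    have "L2_norm unit_leb (\<lambda>t. part N t + (full t - part N t)) \<le> L2_norm unit_leb (part N) + L2_norm unit_leb (\<lambda>t. full t - part N t)"
      using partL[of N] d(1) by (intro L2_triangle) auto
    then show ?thesis using partL[of N] d(2) by simp
  qed
  have "(\<lambda>N. (exp (2 * pi * \<delta>) - 1) * C + (\<Sum>i\<in>J. cmod (c i)) * r N) \<longlonglongrightarrow> (exp (2 * pi * \<delta>) - 1) * C + (\<Sum>i\<in>J. cmod (c i)) * 0"
  proof (intro tendsto_intros)
    have "(\<lambda>N. inverse (fact N) *\<^sub>R (2 * pi * \<delta>) ^ N) \<longlonglongrightarrow> 0"
      by (rule summable_LIMSEQ_zero[OF summable_exp_generic])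
    then have "(\<lambda>N. (exp (2 * pi * \<delta>) * (2 * pi * \<delta>)) * (inverse (fact N) *\<^sub>R (2 * pi * \<delta>) ^ N)) \<longlonglongrightarrow> (exp (2 * pi * \<delta>) * (2 * pi * \<delta>)) * 0"
      by (intro tendsto_intros)
    then show "r \<longlonglongrightarrow> 0" unfolding r_def by (simp add: divide_inverse mult_ac)
  qed
  from LIMSEQ_le_const[OF this] bnd
  show ?thesis unfolding C_def full_def by fastforce
qed

lemma real_modulations_L2:
  assumes "\<phi> \<in> L2 lebesgue" shows "real_modulations l \<phi> n \<in> L2 lebesgue"
  unfolding real_modulations_def
proof (rule L2_dominated(1)[OF assms, of _ 1])
  show "(\<lambda>t. expi (l n) t * \<phi> t) \<in> borel_measurable lebesgue"
    by (rule borel_measurable_times[OF measurable_expi L2_measurable[OF assms]])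
qed (simp add: norm_mult)

text \<open>Frequencies within \<open>1/8\<close> of each other do not cancel on \<open>[0,1]\<close>: after
suitable unimodular factors the sum of \<open>N\<close> such modulations has modulus at least
\<open>N c / 2\<close> on the translate of \<open>E\<close>. Its squared norm grows like
\<open>N\<^sup>2\<close>, whereas the Bessel bound allows only \<open>B N\<close>.\<close>

lemma card_frequencies_bounded:
  assumes \<phi>: "\<phi> \<in> L2 lebesgue" and E: "E \<in> sets lebesgue" "E \<subseteq> {0..1}" "0 < measure lebesgue E" and c: "0 < c"
    and low: "\<And>t. t \<in> E \<Longrightarrow> c \<le> cmod (\<phi> (of_int m + t))"
    and B: "0 < B" "synth_upper lebesgue (real_modulations l \<phi>) \<Lambda> B"
    and J: "finite J" "J \<subseteq> \<Lambda>" and close: "\<And>j. j \<in> J \<Longrightarrow> x \<le> l j \<and> l j \<le> x + 1/8"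
  shows "real (card J) \<le> 4 * B / (c\<^sup>2 * measure lebesgue E)"
proof (cases "J = {}")
  case False
  define N where "N = real (card J)"
  have N: "0 < N" using False J by (simp add: N_def card_gt_0_iff)
  define s where "s t = (\<Sum>j\<in>J. expi (l j) t)" for t
  \<comment> \<open>These coefficients undo the phases that the translation by \<open>m\<close>
  introduces.\<close>
  define y where "y j = expi (- l j) (of_int m)" for j
  have y: "y j * expi (l j) (of_int m) = 1" for j
    unfolding y_def expi_add[symmetric] by simp
  have s_ge: "N / 2 \<le> cmod (s t)" if t: "t \<in> {0..1}" for t
  proof -
    have re: "1/2 \<le> Re (expi (l j - x) t)" if "j \<in> J" for j
    proof -
      have "0 \<le> (l j - x) * t" using close[OF that] t by auto
      moreover have "(l j - x) * t \<le> (1/8) * 1" using close[OF that] t by (intro mult_mono) auto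
      ultimately have "0 \<le> 2 * pi * ((l j - x) * t)" "2 * pi * ((l j - x) * t) \<le> pi / 3"
        by (auto intro!: order_trans[OF mult_left_mono[of _ "1/8" "2 * pi"]])
      then have "cos (pi / 3) \<le> cos (2 * pi * ((l j - x) * t))"
        by (intro cos_monotone_0_pi_le) auto
      also have "cos (2 * pi * ((l j - x) * t)) = Re (expi (l j - x) t)"
        by (simp add: expi_def Re_exp mult.assoc)
      finally show ?thesis by (simp add: cos_60)
    qed
    have "N / 2 = (\<Sum>j\<in>J. 1/2)" by (simp add: N_def)
    also have "\<dots> \<le> (\<Sum>j\<in>J. Re (expi (l j - x) t))" by (intro sum_mono re)
    also have "\<dots> = Re (\<Sum>j\<in>J. expi (l j - x) t)" by simp
    also have "(\<Sum>j\<in>J. expi (l j - x) t) = expi (- x) t * s t"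
      by (simp add: s_def sum_distrib_left flip: expi_add)
    also have "Re \<dots> \<le> cmod (expi (- x) t * s t)" by (rule complex_Re_le_cmod)
    finally show ?thesis by (simp add: norm_mult)
  qed
  have sL: "s \<in> L2 unit_leb" unfolding s_def by (intro L2_sum expi_L2_unit)
  have Em: "E \<in> lmeasurable" by (rule unit_subset_lmeasurable[OF E(1,2)])
  have nE: "(L2_norm unit_leb (indicator E))\<^sup>2 = measure lebesgue E"
  proof -
    have "(\<lambda>t. (cmod (indicator E t))\<^sup>2) = indicat_real E" by (auto simp: indicator_def)
    moreover have "E \<inter> {0..1} = E" using E(2) by auto
    ultimately show ?thesis unfolding L2_norm_sq by (simp only: integral_indicator_unit(2)[OF Em])
  qed
  have "L2_norm unit_leb (indicator E) \<le> (2 / N) * L2_norm unit_leb (proj E s)"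
  proof (rule L2_dominated(2)[OF proj_L2(1)[OF E(1) sL]])
    show "(\<lambda>t. indicator E t :: complex) \<in> borel_measurable unit_leb"
      using L2_measurable[OF indicator_unit_L2(1)[OF Em]] .
    fix t assume "t \<in> space unit_leb"
    then show "cmod (indicator E t) \<le> 2 / N * cmod (proj E s t)"
      using s_ge[of t] N by (auto simp: proj_def indicator_def field_simps)
  qed (use N in auto)
  then have 1: "(N / 2) * L2_norm unit_leb (indicator E) \<le> L2_norm unit_leb (proj E s)"
    using N by (simp add: field_simps)
  have "c * L2_norm unit_leb (proj E s) \<le> L2_norm lebesgue (lincomb J y (real_modulations l \<phi>))"
    using norm_modulations_ge[OF \<phi> E(1,2) c low J(1), of y l] by (simp add: y s_def[abs_def])
  then have "c * ((N / 2) * L2_norm unit_leb (indicator E)) \<le> L2_norm lebesgue (lincomb J y (real_modulations l \<phi>))"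
    using mult_left_mono[OF 1, of c] c by linarith
  then have "(c * ((N / 2) * L2_norm unit_leb (indicator E)))\<^sup>2 \<le> (L2_norm lebesgue (lincomb J y (real_modulations l \<phi>)))\<^sup>2"
    by (rule power_mono) (use c N in auto)
  also have "\<dots> \<le> B * energy J y" by (rule synth_upperD[OF B(2) J])
  also have "\<dots> = B * N" by (simp add: y_def N_def)
  finally have "c\<^sup>2 * (N\<^sup>2 / 4) * measure lebesgue E \<le> B * N"
    by (simp add: power_mult_distrib nE power_divide mult.assoc)
  then have "N * (c\<^sup>2 * measure lebesgue E * N) \<le> N * (4 * B)" by (simp add: power2_eq_square algebra_simps)
  then have "c\<^sup>2 * measure lebesgue E * N \<le> 4 * B" using N by simp
  then show ?thesis using c E(3) by (simp add: N_def field_simps)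
next
  case True
  then show ?thesis using B(1) E(3) by simp
qed

text \<open>The factor \<open>e\<^sub>\<theta>\<close> common to all frequencies has modulus one, so up to an
error of at most \<open>\<delta>\<close> the \<open>l\<^sub>i\<close> may be replaced by the
distinct integers \<open>k\<^sub>i\<close>. The perturbation then costs at most half of the lower
bound \<open>\<alpha>\<close>.\<close>

lemma perturbed_synth_lower:
  assumes \<phi>: "\<phi> \<in> L2 lebesgue" and E: "E \<in> sets lebesgue" "E \<subseteq> {0..1}" and c: "0 < c"
    and low: "\<And>t. t \<in> E \<Longrightarrow> c \<le> cmod (\<phi> (of_int m + t))"
    and \<alpha>: "0 < \<alpha>" "synth_lower unit_leb (E_modulations E) A (\<alpha>\<^sup>2)"
    and k: "inj_on k I" "k ` I \<subseteq> A" and \<delta>: "0 \<le> \<delta>" "exp (2 * pi * \<delta>) - 1 \<le> \<alpha> / 2"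
    and l: "\<And>i. i \<in> I \<Longrightarrow> \<bar>l i - of_int (k i) - \<theta>\<bar> \<le> \<delta>"
  shows "synth_lower lebesgue (real_modulations l \<phi>) I ((c * (\<alpha> / 2))\<^sup>2)"
  unfolding synth_lower_def
proof (intro allI impI)
  fix J and x :: "nat \<Rightarrow> complex" assume J: "finite J" "J \<subseteq> I"
  define y where "y j = x j * expi (l j) (of_int m)" for j
  define \<epsilon> where "\<epsilon> j = l j - of_int (k j) - \<theta>" for j
  define X where "X = sqrt (energy J x)"
  have X0: "0 \<le> X" "X\<^sup>2 = energy J x" by (simp_all add: X_def sum_nonneg)
  have yX: "(energy J y) = X\<^sup>2" by (simp add: X0 y_def norm_mult)
  define f0 f1 where "f0 = (\<lambda>t. \<Sum>j\<in>J. y j * expi (of_int (k j)) t)"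
    and "f1 = (\<lambda>t. \<Sum>j\<in>J. y j * (expi (of_int (k j)) t * (expi (\<epsilon> j) t - 1)))"
  have f0L: "f0 \<in> L2 unit_leb" unfolding f0_def by (intro L2_combination expi_L2_unit)
  have f01: "f0 t + f1 t = (\<Sum>j\<in>J. y j * (expi (of_int (k j)) t * expi (\<epsilon> j) t))" for t
    unfolding f0_def f1_def by (simp add: algebra_simps flip: sum.distrib)
  have f01L: "(\<lambda>t. f0 t + f1 t) \<in> L2 unit_leb"
    unfolding f01 expi_add[symmetric] by (intro L2_combination expi_L2_unit)
  have f1L: "f1 \<in> L2 unit_leb" using L2_diff[OF f01L f0L] by simp
  have kJ: "inj_on k J" using k(1) J(2) by (rule inj_on_subset)
  have n0: "\<alpha> * X \<le> L2_norm unit_leb (proj E f0)"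
  proof (rule power2_le_imp_le)
    have "synth_lower unit_leb (E_modulations E) (k ` J) (\<alpha>\<^sup>2)"
      by (rule synth_mono(2)[OF _ \<alpha>(2)]) (use k J in auto)
    then have "synth_lower unit_leb (\<lambda>j. E_modulations E (k j)) J (\<alpha>\<^sup>2)"
      by (simp add: synth_reindex(2)[OF kJ])
    from synth_lowerD[OF this J(1) order_refl, of y]
    have "\<alpha>\<^sup>2 * X\<^sup>2 \<le> (L2_norm unit_leb (\<lambda>t. \<Sum>j\<in>J. y j * E_modulations E (k j) t))\<^sup>2"
      by (simp add: yX)
    moreover have "(\<lambda>t. \<Sum>j\<in>J. y j * E_modulations E (k j) t) = proj E f0"
      by (simp add: fun_eq_iff proj_def f0_def int_modulations_def sum_distrib_right mult.assoc)
    ultimately show "(\<alpha> * X)\<^sup>2 \<le> (L2_norm unit_leb (proj E f0))\<^sup>2" by (simp add: power_mult_distrib)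
  qed simp
  have "L2_norm unit_leb (proj E f1) \<le> L2_norm unit_leb f1" by (rule proj_L2(2)[OF E(1) f1L])
  also have "\<dots> \<le> (exp (2 * pi * \<delta>) - 1) * sqrt (energy J y)"
    unfolding f1_def by (rule perturbed_exponentials[OF J(1) kJ _ \<delta>(1)]) (use l J in \<open>auto simp: \<epsilon>_def\<close>)
  also have "\<dots> \<le> (\<alpha> / 2) * X" unfolding yX using X0(1) \<delta>(2) by (simp only: real_sqrt_abs abs_of_nonneg) (rule mult_right_mono)
  finally have n1: "L2_norm unit_leb (proj E f1) \<le> (\<alpha> / 2) * X" .
  have n2: "(\<alpha> / 2) * X \<le> L2_norm unit_leb (proj E (\<lambda>t. f0 t + f1 t))"
  proof -
    have eq: "(\<lambda>t. proj E (\<lambda>t. f0 t + f1 t) t - proj E f1 t) = proj E f0" by (simp add: proj_def algebra_simps fun_eq_iff)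
    have "L2_norm unit_leb (proj E f0) \<le> L2_norm unit_leb (proj E (\<lambda>t. f0 t + f1 t)) + L2_norm unit_leb (proj E f1)"
      using L2_triangle_diff[OF proj_L2(1)[OF E(1) f01L] proj_L2(1)[OF E(1) f1L]] unfolding eq .
    then show ?thesis using n0 n1 by linarith
  qed
  have "L2_norm unit_leb (proj E (\<lambda>t. f0 t + f1 t)) =
      L2_norm unit_leb (proj E (\<lambda>t. \<Sum>j\<in>J. (x j * expi (l j) (of_int m)) * expi (l j) t))"
  proof -
    have "(\<Sum>j\<in>J. (x j * expi (l j) (of_int m)) * expi (l j) t) = expi \<theta> t * (f0 t + f1 t)" for t
    proof -
      have "expi (l j) t = expi \<theta> t * (expi (of_int (k j)) t * expi (\<epsilon> j) t)" for j
        unfolding expi_add[symmetric] by (simp add: \<epsilon>_def)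
      then show ?thesis unfolding f01 by (simp add: sum_distrib_left y_def mult_ac)
    qed
    then show ?thesis unfolding L2_norm_def proj_def by (simp add: norm_mult)
  qed
  with n2 have "c * ((\<alpha> / 2) * X) \<le> c * L2_norm unit_leb (proj E (\<lambda>t. \<Sum>j\<in>J. (x j * expi (l j) (of_int m)) * expi (l j) t))"
    using c by (intro mult_left_mono) auto
  also have "\<dots> \<le> L2_norm lebesgue (lincomb J x (real_modulations l \<phi>))"
    by (rule norm_modulations_ge[OF \<phi> E c low J(1)])
  finally have "(c * ((\<alpha> / 2) * X))\<^sup>2 \<le> (L2_norm lebesgue (lincomb J x (real_modulations l \<phi>)))\<^sup>2"
    by (rule power_mono) (use c \<alpha> X0 in auto)
  then show "(c * (\<alpha> / 2))\<^sup>2 * energy J x \<le> (L2_norm lebesgue (lincomb J x (real_modulations l \<phi>)))\<^sup>2"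
    by (simp only: X0(2)[symmetric] power_mult_distrib mult.assoc)
qed

text \<open>The line is cut into cells of length \<open>1/K\<close>. Each index is coloured by a set
\<open>A\<close> containing the integer part of its frequency, by its rank among the indices whose
frequency lies in the same cell, and by the position of that cell within its unit interval. Within
a colour class distinct indices have distinct integer parts, and all fractional parts agree up to
\<open>1/K\<close>.\<close>

lemma real_bessel_union_riesz:
  assumes H: "\<And>E. E \<in> sets lebesgue \<Longrightarrow> E \<subseteq> {0..1} \<Longrightarrow> 0 < measure lebesgue E \<Longrightarrow>
       finite_union_of (\<lambda>A. iso_onto_range unit_leb (proj E) (S A)) (UNIV :: int set)"
    and \<phi>: "\<phi> \<in> L2 lebesgue" "L2_nonzero lebesgue \<phi>"
    and b: "bessel_sequence lebesgue (real_modulations l \<phi>) \<Lambda>"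
  shows "finite_union_of (riesz_basic_sequence lebesgue (real_modulations l \<phi>)) \<Lambda>"
proof -
  obtain B where B: "0 < B" "synth_upper lebesgue (real_modulations l \<phi>) \<Lambda> B"
    using b by (auto simp: bessel_sequence_iff)
  obtain m :: int and c :: real and E where c: "0 < c" and E: "E \<in> sets lebesgue" "E \<subseteq> {0..1}" "0 < measure lebesgue E"
    and low: "\<And>t. t \<in> E \<Longrightarrow> c \<le> cmod (\<phi> (of_int m + t))"
    by (rule L2_nonzero_bounded_below[OF \<phi>]) (rule that)
  obtain C where C: "finite C" "\<Union>C = (UNIV :: int set)" "\<And>A. A \<in> C \<Longrightarrow> iso_onto_range unit_leb (proj E) (S A)"
    using finite_union_ofE[OF H[OF E]] by blast
  have "\<exists>\<alpha>>0. \<forall>A\<in>C. synth_lower unit_leb (E_modulations E) A (\<alpha>\<^sup>2)"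
  proof -
    have "\<forall>A\<in>C. \<exists>a>0. synth_lower unit_leb (E_modulations E) A a"
      using C(3) iso_onto_range_iff_synth_lower[OF E(1)] by blast
    then obtain a where a: "\<And>A. A \<in> C \<Longrightarrow> 0 < a A" "\<And>A. A \<in> C \<Longrightarrow> synth_lower unit_leb (E_modulations E) A (a A)"
      by metis
    define a0 where "a0 = Min (insert 1 (a ` C))"
    have a0: "0 < a0" "\<And>A. A \<in> C \<Longrightarrow> a0 \<le> a A" using a(1) C(1) by (auto simp: a0_def)
    have "synth_lower unit_leb (E_modulations E) A a0" if "A \<in> C" for A
      unfolding synth_lower_def
    proof (intro allI impI)
      fix J :: "int set" and x :: "int \<Rightarrow> complex" assume J: "finite J" "J \<subseteq> A"
      have "a0 * energy J x \<le> a A * energy J x"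
        using a0(2)[OF that] by (intro mult_right_mono sum_nonneg) auto
      also have "\<dots> \<le> (L2_norm unit_leb (lincomb J x (E_modulations E)))\<^sup>2"
        by (rule synth_lowerD[OF a(2)[OF that] J])
      finally show "a0 * energy J x \<le> (L2_norm unit_leb (lincomb J x (E_modulations E)))\<^sup>2" .
    qed
    then show ?thesis using a0(1) by (intro exI[of _ "sqrt a0"]) auto
  qed
  then obtain \<alpha> where \<alpha>: "0 < \<alpha>" "\<And>A. A \<in> C \<Longrightarrow> synth_lower unit_leb (E_modulations E) A (\<alpha>\<^sup>2)"
    by blast
  \<comment> \<open>\<open>K \<ge> 8\<close> makes every cell short enough for the count of
  frequencies.\<close>
  have "\<exists>K::nat. 8 \<le> K \<and> exp (2 * pi * (1 / real K)) - 1 \<le> \<alpha> / 2"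
  proof -
    have "(\<lambda>K::nat. exp (2 * pi * (1 / real K)) - 1) \<longlonglongrightarrow> exp (2 * pi * 0) - 1"
      by (intro tendsto_intros lim_1_over_n)
    then have "\<forall>\<^sub>F K in sequentially. exp (2 * pi * (1 / real K)) - 1 < \<alpha> / 2"
      by (rule order_tendstoD) (use \<alpha> in simp)
    then have "\<forall>\<^sub>F K in sequentially. 8 \<le> K \<and> exp (2 * pi * (1 / real K)) - 1 < \<alpha> / 2"
      using eventually_ge_at_top by (rule eventually_elim2) auto
    then show ?thesis by (auto simp: eventually_at_top_linorder intro: less_imp_le)
  qed
  then obtain K :: nat where K: "8 \<le> K" "exp (2 * pi * (1 / real K)) - 1 \<le> \<alpha> / 2" by blast
  define q where "q n = \<lfloor>real K * l n\<rfloor>" for n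
  define k where "k n = q n div int K" for n
  define r where "r n = card {i\<in>\<Lambda>. i < n \<and> q i = q n}" for n
  define col where "col n = ((SOME A. A \<in> C \<and> k n \<in> A), r n, q n mod int K)" for n
  have colA: "fst (col n) \<in> C \<and> k n \<in> fst (col n)" for n
  proof -
    have "k n \<in> \<Union>C" unfolding C(2) by simp
    then have "\<exists>A. A \<in> C \<and> k n \<in> A" by auto
    then show ?thesis unfolding col_def fst_conv by (rule someI_ex)
  qed
  have ql: "of_int (q n) / real K \<le> l n \<and> l n \<le> of_int (q n) / real K + 1 / real K" for n
  proof -
    have "of_int (q n) \<le> real K * l n" "real K * l n < of_int (q n) + 1"
      unfolding q_def by linarith+
    then show ?thesis using K(1) by (simp add: field_simps)
  qed
  define R where "R = 4 * B / (c\<^sup>2 * measure lebesgue E)"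
  have cell: "real (card J) \<le> R" if "finite J" "J \<subseteq> {n\<in>\<Lambda>. q n = z}" for J z
    unfolding R_def
  proof (rule card_frequencies_bounded[OF \<phi>(1) E c low B])
    have "1 / real K \<le> 1/8" using K(1) by (simp add: field_simps)
    then show "of_int z / real K \<le> l j \<and> l j \<le> of_int z / real K + 1/8" if "j \<in> J" for j
      using ql[of j] that \<open>J \<subseteq> _\<close> by auto
  qed (use that in auto)
  have cell_fin: "finite {n\<in>\<Lambda>. q n = z}" for z
  proof (rule ccontr)
    assume "infinite {n\<in>\<Lambda>. q n = z}"
    then obtain J where J: "finite J" "card J = nat \<lceil>R\<rceil> + 1" "J \<subseteq> {n\<in>\<Lambda>. q n = z}"
      using infinite_arbitrarily_large by blast
    have "real (nat \<lceil>R\<rceil> + 1) \<le> R" using cell[OF J(1,3)] J(2) by simp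
    then show False by linarith
  qed
  show ?thesis
  proof (rule finite_union_of_coloring)
    have "col n \<in> C \<times> {..nat \<lceil>R\<rceil>} \<times> {0..<int K}" if "n \<in> \<Lambda>" for n
    proof -
      have "real (r n) \<le> R" unfolding r_def by (rule cell[of _ "q n"]) (auto intro: finite_subset[OF _ cell_fin[of "q n"]])
      then have "r n \<le> nat \<lceil>R\<rceil>" by linarith
      then show ?thesis using colA[of n] K(1) by (auto simp: col_def)
    qed
    then have "col ` \<Lambda> \<subseteq> C \<times> {..nat \<lceil>R\<rceil>} \<times> {0..<int K}" by blast
    then show "finite (col ` \<Lambda>)" by (rule finite_subset) (use C(1) in auto)
    fix col0 assume "col0 \<in> col ` \<Lambda>"
    then obtain n0 where n0: "n0 \<in> \<Lambda>" "col0 = col n0" by auto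
    define I where "I = {i \<in> \<Lambda>. col i = col0}"
    define A where "A = fst col0"
    define j where "j = q n0 mod int K"
    have I: "i \<in> \<Lambda>" "fst (col i) = A" "r i = r n0" "q i mod int K = j" if "i \<in> I" for i
      using that n0 by (auto simp: I_def A_def j_def col_def)
    have q_inj: "i = i'" if "i \<in> I" "i' \<in> I" "q i = q i'" for i i'
    proof -
      have *: False if "i \<in> I" "i' \<in> I" "q i = q i'" "i < i'" for i i'
      proof -
        have "{n\<in>\<Lambda>. n < i \<and> q n = q i} \<subset> {n\<in>\<Lambda>. n < i' \<and> q n = q i'}"
          using that I(1)[OF that(1)] by auto
        then have "r i < r i'" unfolding r_def
          by (rule psubset_card_mono[rotated]) (rule finite_subset[OF _ cell_fin[of "q i'"]], auto)
        then show False using I(3)[OF that(1)] I(3)[OF that(2)] by simp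
      qed
      show ?thesis using *[OF that] *[OF that(2,1) that(3)[symmetric]] by (meson linorder_neqE_nat)
    qed
    have qk: "q i = k i * int K + j" if "i \<in> I" for i
      using I(4)[OF that] unfolding k_def by (metis div_mult_mod_eq)
    have low': "synth_lower lebesgue (real_modulations l \<phi>) I ((c * (\<alpha> / 2))\<^sup>2)"
    proof (rule perturbed_synth_lower[OF \<phi>(1) E(1,2) c low \<alpha>(1) _ _ _ _ K(2), where A = A and k = k and \<theta> = "of_int j / real K"])
      show "synth_lower unit_leb (E_modulations E) A (\<alpha>\<^sup>2)"
        using colA[of n0] n0 by (intro \<alpha>(2)) (simp add: A_def)
      show "inj_on k I" by (rule inj_onI) (use q_inj qk in auto)
      show "k ` I \<subseteq> A" using colA I(2) by auto
      fix i assume i: "i \<in> I"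
      have "of_int (q i) / real K = of_int (k i) + of_int j / real K"
        using qk[OF i] K(1) by (simp add: field_simps)
      then show "\<bar>l i - of_int (k i) - of_int j / real K\<bar> \<le> 1 / real K"
        using ql[of i] by (auto simp: abs_le_iff)
    qed auto
    have "riesz_basic_sequence lebesgue (real_modulations l \<phi>) I"
      unfolding riesz_basic_sequence_iff
    proof (intro conjI)
      show "\<exists>A>0. synth_lower lebesgue (real_modulations l \<phi>) I A" using low' c \<alpha>(1) by (intro exI[of _ "(c * (\<alpha> / 2))\<^sup>2"]) auto
      show "\<exists>B>0. synth_upper lebesgue (real_modulations l \<phi>) I B"
        using B synth_mono(1)[of I \<Lambda>] by (auto simp: I_def)
    qed (use \<phi> in \<open>auto intro: real_modulations_L2\<close>)
    then show "riesz_basic_sequence lebesgue (real_modulations l \<phi>) {i \<in> \<Lambda>. col i = col0}"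
      by (simp add: I_def)
  qed
qed

section \<open>The equivalence\<close>

lemma int_modulations_extend:
  fixes \<phi> :: "real \<Rightarrow> complex"
  defines "\<phi>' \<equiv> (\<lambda>t. \<phi> t * indicator {0..1} t)"
  shows "synth_upper unit_leb (int_modulations \<phi>) I B \<longleftrightarrow> synth_upper lebesgue (int_modulations \<phi>') I B"
    and "synth_lower unit_leb (int_modulations \<phi>) I B \<longleftrightarrow> synth_lower lebesgue (int_modulations \<phi>') I B"
proof -
  have "L2_norm unit_leb (lincomb J c (int_modulations \<phi>)) = L2_norm lebesgue (lincomb J c (int_modulations \<phi>'))" for J c
    unfolding L2_norm_unit by (simp add: int_modulations_def \<phi>'_def sum_distrib_right mult.assoc)
  then show "synth_upper unit_leb (int_modulations \<phi>) I B \<longleftrightarrow> synth_upper lebesgue (int_modulations \<phi>') I B"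
    "synth_lower unit_leb (int_modulations \<phi>) I B \<longleftrightarrow> synth_lower lebesgue (int_modulations \<phi>') I B"
    using synth_cong_norm[of I unit_leb "int_modulations \<phi>" lebesgue "int_modulations \<phi>'" B] by auto
qed

lemma int_modulations_L2:
  assumes "\<phi> \<in> L2 unit_leb" shows "int_modulations \<phi> n \<in> L2 unit_leb"
  unfolding int_modulations_def
proof (rule L2_dominated(1)[OF assms, of _ 1])
  show "(\<lambda>t. expi (of_int n) t * \<phi> t) \<in> borel_measurable unit_leb"
    by (rule borel_measurable_times[OF measurable_expi_unit L2_measurable[OF assms]])
qed (simp add: norm_mult)

abbreviation enum_int :: "nat \<Rightarrow> real" where
  "enum_int n \<equiv> of_int (int_decode n)"

lemma real_modulations_enum_int: "real_modulations enum_int \<phi> = (\<lambda>n. int_modulations \<phi> (int_decode n))"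
  by (simp add: real_modulations_def int_modulations_def fun_eq_iff)

lemma synth_enum_int:
  fixes \<phi> :: "real \<Rightarrow> complex"
  defines "\<phi>' \<equiv> (\<lambda>t. \<phi> t * indicator {0..1} t)"
  shows "synth_upper lebesgue (real_modulations enum_int \<phi>') I B \<longleftrightarrow> synth_upper unit_leb (int_modulations \<phi>) (int_decode ` I) B"
    and "synth_lower lebesgue (real_modulations enum_int \<phi>') I B \<longleftrightarrow> synth_lower unit_leb (int_modulations \<phi>) (int_decode ` I) B"
proof -
  have inj: "inj_on int_decode I" by (rule inj_int_decode)
  show "synth_upper lebesgue (real_modulations enum_int \<phi>') I B \<longleftrightarrow> synth_upper unit_leb (int_modulations \<phi>) (int_decode ` I) B"
    unfolding int_modulations_extend \<phi>'_def[symmetric]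
    unfolding synth_reindex[OF inj] real_modulations_enum_int ..
  show "synth_lower lebesgue (real_modulations enum_int \<phi>') I B \<longleftrightarrow> synth_lower unit_leb (int_modulations \<phi>) (int_decode ` I) B"
    unfolding int_modulations_extend \<phi>'_def[symmetric]
    unfolding synth_reindex[OF inj] real_modulations_enum_int ..
qed

lemma indicator_extend: "E \<subseteq> {0..1} \<Longrightarrow> (\<lambda>t. indicator E t * indicator {0..1} t) = (indicator E :: real \<Rightarrow> complex)"
  by (auto simp: indicator_def fun_eq_iff)

lemma indicator_L2:
  assumes "E \<in> sets lebesgue" "E \<subseteq> {0..1}" "0 < measure lebesgue E"
  shows "indicator E \<in> L2 unit_leb" "indicator E \<in> L2 lebesgue"
    "L2_nonzero unit_leb (indicator E)" "L2_nonzero lebesgue (indicator E)"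
proof -
  have Em: "E \<in> lmeasurable" by (rule unit_subset_lmeasurable[OF assms(1,2)])
  show u: "indicator E \<in> L2 unit_leb" by (rule indicator_unit_L2(1)[OF Em])
  show l: "indicator E \<in> L2 lebesgue" using u indicator_extend[OF assms(2)] by (simp add: L2_unit_iff)
  have "(cmod (indicator E t))\<^sup>2 = indicat_real E t" for t by (simp add: indicator_def)
  then have "(L2_norm lebesgue (indicator E))\<^sup>2 = measure lebesgue E" by (simp add: L2_norm_sq)
  then have n: "L2_norm lebesgue (indicator E) \<noteq> 0" using assms(3) by auto
  then show "L2_nonzero lebesgue (indicator E)" using L2_norm_eq_0_iff[OF l] by (simp add: L2_nonzero_def)
  have "L2_norm unit_leb (indicator E) \<noteq> 0" using n indicator_extend[OF assms(2)] by (simp add: L2_norm_unit)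
  then show "L2_nonzero unit_leb (indicator E)" using L2_norm_eq_0_iff[OF u] by (simp add: L2_nonzero_def)
qed

lemma closed_span_combination_of_members:
  assumes F: "\<And>i. i \<in> I \<Longrightarrow> F i \<in> L2 M" and G: "\<And>j. j \<in> J \<Longrightarrow> G j \<in> closed_span M F I" and J: "finite J"
  shows "lincomb J c G \<in> closed_span M F I"
  using J G
proof (induction J rule: finite_induct)
  case empty
  show ?case using closed_span_combination[of I F M "{}"] F by simp
next
  case (insert j J)
  have "(\<lambda>x. (lincomb J c G x) + c j * G j x) \<in> closed_span M F I"
    by (rule closed_span_linear[OF F]) (use insert in auto)
  then show ?case using insert by (simp add: add.commute)
qed

text \<open>An element \<open>f\<close> of the closed span agrees with \<open>f \<chi>\<^sub>E\<close>, and
its restriction to \<open>[0,1]\<close> lies in the closed span of the orthonormal family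
\<open>e\<^sub>n\<close>, whose lower frame bound \<open>1\<close> carries over because
\<open>\<langle>f, e\<^sub>n \<chi>\<^sub>E\<rangle> = \<langle>f \<chi>\<^sub>E,
e\<^sub>n\<rangle>\<close>.\<close>

lemma frame_sequence_indicator:
  assumes E: "E \<in> sets lebesgue" "E \<subseteq> {0..1}" "0 < measure lebesgue E"
  shows "frame_sequence lebesgue (real_modulations enum_int (indicator E)) UNIV"
proof -
  define F where "F = real_modulations enum_int (indicator E)"
  note ext = indicator_extend[OF E(2)]
  have FL: "F n \<in> L2 lebesgue" for n unfolding F_def by (rule real_modulations_L2[OF indicator_L2(2)[OF E]])
  have up: "synth_upper lebesgue F UNIV 1"
    unfolding F_def using synth_enum_int(1)[of "indicator E" UNIV 1] int_modulations_upper[OF E(1)] by (simp add: ext)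
  have "1 * (L2_norm lebesgue f)\<^sup>2 \<le> (\<Sum>\<^sub>\<infinity>n. (cmod (L2_inner lebesgue f (F n)))\<^sup>2)"
    if f: "f \<in> closed_span lebesgue F UNIV" for f
  proof -
    have fL: "f \<in> L2 lebesgue" using f by (rule closed_span_L2)
    have Fp: "F n t = E_modulations E (int_decode n) t" for n t
      by (simp add: F_def real_modulations_enum_int)
    have FE: "F n t * indicator E t = F n t" for n t
      by (simp add: Fp int_modulations_def indicator_def)
    have gL: "(\<lambda>t. f t * indicator E t) \<in> L2 lebesgue" by (rule L2_mult_indicator[OF fL E(1)])
    have gu: "(\<lambda>t. proj E f t * indicator {0..1} t) = (\<lambda>t. f t * indicator E t)"
      using E(2) by (auto simp: proj_def indicator_def fun_eq_iff)
    have pL: "proj E f \<in> L2 unit_leb" unfolding L2_unit_iff gu by (rule gL)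
    have ap: "L2_norm lebesgue (\<lambda>t. f t - f t * indicator E t) \<le> e \<and>
        (\<exists>p\<in>S UNIV. L2_norm unit_leb (\<lambda>t. proj E f t - p t) < e)" if e: "0 < e" for e
    proof -
      obtain J c where J: "finite J" "L2_norm lebesgue (\<lambda>t. f t - (lincomb J c F t)) < e"
        using closed_span_approx[OF f e] by metis
      define p where "p = lincomb J c F"
      have pp: "p t * indicator E t = p t" for t by (simp add: p_def sum_distrib_right mult.assoc FE)
      have dL: "(\<lambda>t. f t - p t) \<in> L2 lebesgue" unfolding p_def by (intro L2_diff fL L2_combination FL)
      have dm: "(\<lambda>t. (f t - p t) * indicator E t) \<in> borel_measurable lebesgue" "(\<lambda>t. (f t - p t) * indicator (-E) t) \<in> borel_measurable lebesgue"
        using E(1) by (auto intro!: borel_measurable_times L2_measurable[OF dL])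
      have "L2_norm lebesgue (\<lambda>t. (f t - p t) * indicator (-E) t) \<le> 1 * L2_norm lebesgue (\<lambda>t. f t - p t)"
        by (rule L2_dominated(2)[OF dL dm(2)]) (auto simp: indicator_def)
      also have "(\<lambda>t. (f t - p t) * indicator (-E) t) = (\<lambda>t. f t - f t * indicator E t)"
        using pp by (auto simp: fun_eq_iff indicator_def split: if_splits)
      finally have 1: "L2_norm lebesgue (\<lambda>t. f t - f t * indicator E t) \<le> e" using J(2) by (simp add: p_def)
      have "L2_norm lebesgue (\<lambda>t. (f t - p t) * indicator E t) \<le> 1 * L2_norm lebesgue (\<lambda>t. f t - p t)"
        by (rule L2_dominated(2)[OF dL dm(1)]) (auto simp: indicator_def)
      also have "(\<lambda>t. (f t - p t) * indicator E t) = (\<lambda>t. (proj E f t - p t) * indicator {0..1} t)"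
        using pp E(2) by (auto simp: fun_eq_iff proj_def indicator_def split: if_splits)
      finally have 2: "L2_norm unit_leb (\<lambda>t. proj E f t - p t) < e" using J(2) by (simp add: p_def L2_norm_unit)
      have "p \<in> S UNIV" unfolding p_def S_def
      proof (rule closed_span_combination_of_members[OF expi_L2_unit _ J(1)])
        show "F j \<in> closed_span unit_leb int_expi UNIV" for j
          unfolding F_def real_modulations_enum_int by (rule int_modulations_indicator_S[OF E(1,2), unfolded S_def])
      qed
      with 1 2 show ?thesis by blast
    qed
    have "L2_norm lebesgue (\<lambda>t. f t - f t * indicator E t) \<le> 0" by (rule field_le_epsilon) (simp add: ap)
    then have "L2_norm lebesgue f = L2_norm lebesgue (\<lambda>t. f t * indicator E t)"
      using L2_norm_diff_ge[OF fL gL] by simp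
    also have "\<dots> = L2_norm unit_leb (proj E f)" by (simp add: L2_norm_unit gu)
    finally have n: "L2_norm lebesgue f = L2_norm unit_leb (proj E f)" .
    have pS: "proj E f \<in> closed_span unit_leb int_expi UNIV"
      by (rule closed_span_closed[OF expi_L2_unit pL]) (use ap in \<open>auto simp: S_def\<close>)
    have inner: "L2_inner lebesgue f (F n) = L2_inner unit_leb (proj E f) (expi (of_int (int_decode n)))" for n
      unfolding L2_inner_def integral_restrict_space[OF unit_in_lebesgue]
      by (rule Bochner_Integration.integral_cong) (use E(2) in \<open>auto simp: Fp int_modulations_def proj_def indicator_def\<close>)
    have "1 * (L2_norm unit_leb (proj E f))\<^sup>2 \<le> (\<Sum>\<^sub>\<infinity>n\<in>UNIV. (cmod (L2_inner unit_leb (proj E f) (expi (of_int n))))\<^sup>2)"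
      by (rule synth_lower_analysis[OF _ synth_expi(2) expi_L2_unit pS])
         (use synth_upper_analysis(1)[OF synth_expi(1) _ expi_L2_unit pL] in auto)
    also have "\<dots> = (\<Sum>\<^sub>\<infinity>n. (cmod (L2_inner lebesgue f (F n)))\<^sup>2)"
      unfolding inner by (rule infsum_reindex_bij_betw[OF bij_int_decode, symmetric])
    finally show ?thesis by (simp add: n)
  qed
  then have "frame_sequence lebesgue F UNIV"
    unfolding frame_sequence_iff using FL up zero_less_one by blast
  then show ?thesis by (simp add: F_def)
qed

lemma iso_cover_imp_finite_union:
  assumes E: "E \<in> sets lebesgue"
    and C: "finite C" "UNIV \<subseteq> \<Union>C"
    and low: "\<And>A. A \<in> C \<Longrightarrow> \<exists>a>0. synth_lower unit_leb (E_modulations E) A a"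
  shows "finite_union_of (\<lambda>A. iso_onto_range unit_leb (proj E) (S A)) (UNIV :: int set)"
  by (rule finite_union_of_cover[OF iso_onto_range_subset[OF E] C])
     (use low in \<open>auto simp: iso_onto_range_iff_synth_lower[OF E]\<close>)

text \<open>Complex conjugation preserves norms and, since \<open>\<chi>\<^sub>E\<close> is real, sends
\<open>e\<^sub>n \<chi>\<^sub>E\<close> to \<open>e\<^sub>-\<^sub>n \<chi>\<^sub>E\<close>.\<close>

lemma synth_lower_reflect:
  assumes "synth_lower unit_leb (E_modulations E) A a"
  shows "synth_lower unit_leb (E_modulations E) (uminus ` A) a"
proof -
  have inj: "inj_on uminus A" by simp
  have "synth_lower unit_leb (\<lambda>n. E_modulations E (- n)) A a"
    unfolding synth_lower_def
  proof (intro allI impI)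
    fix J :: "int set" and c :: "int \<Rightarrow> complex" assume J: "finite J" "J \<subseteq> A"
    have "cmod (\<Sum>j\<in>J. cnj (c j) * E_modulations E j t) = cmod (\<Sum>j\<in>J. c j * E_modulations E (- j) t)" for t
    proof -
      have "(\<Sum>j\<in>J. c j * E_modulations E (- j) t) = cnj (\<Sum>j\<in>J. cnj (c j) * E_modulations E j t)"
        by (simp add: int_modulations_def cnj_expi indicator_def)
      then show ?thesis by (simp only: complex_mod_cnj)
    qed
    then have "L2_norm unit_leb (\<lambda>t. \<Sum>j\<in>J. cnj (c j) * E_modulations E j t) =
        L2_norm unit_leb (\<lambda>t. \<Sum>j\<in>J. c j * E_modulations E (- j) t)"
      unfolding L2_norm_def by simp
    then show "a * energy J c \<le> (L2_norm unit_leb (\<lambda>t. \<Sum>j\<in>J. c j * E_modulations E (- j) t))\<^sup>2"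
      using synth_lowerD[OF assms J, of "\<lambda>j. cnj (c j)"] by simp
  qed
  then show ?thesis by (simp add: synth_reindex(2)[OF inj])
qed

lemma all_equivalent_cycles:
  assumes "P1 \<Longrightarrow> P2" "P2 \<Longrightarrow> P4" "P4 \<Longrightarrow> P1" "P2 \<Longrightarrow> P3" "P3 \<Longrightarrow> P5" "P5 \<Longrightarrow> P1"
  shows "all_equivalent [P1, P2, P3, P4, P5]"
proof -
  have "P1 = P2" "P1 = P3" "P1 = P4" "P1 = P5" using assms by blast+
  then show ?thesis by (simp add: all_equivalent_def)
qed

theorem theorem7p4:
  "all_equivalent
    [\<forall>E. E \<in> sets lebesgue \<longrightarrow> E \<subseteq> {0..1} \<longrightarrow> 0 < measure lebesgue E \<longrightarrow>
       finite_union_of (\<lambda>A. iso_onto_range unit_leb (proj E) (S A)) (UNIV :: int set),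
     \<forall>\<phi>\<in>L2 lebesgue. L2_nonzero lebesgue \<phi> \<longrightarrow> (\<forall>(\<Lambda> :: nat set) (l :: nat \<Rightarrow> real).
       bessel_sequence lebesgue (real_modulations l \<phi>) \<Lambda> \<longrightarrow>
       finite_union_of (riesz_basic_sequence lebesgue (real_modulations l \<phi>)) \<Lambda>),
     \<forall>\<phi>\<in>L2 unit_leb. L2_nonzero unit_leb \<phi> \<longrightarrow> (\<forall>\<Lambda> :: int set.
       bessel_sequence unit_leb (int_modulations \<phi>) \<Lambda> \<longrightarrow>
       finite_union_of (riesz_basic_sequence unit_leb (int_modulations \<phi>)) \<Lambda>),
     \<forall>\<phi>\<in>L2 lebesgue. L2_nonzero lebesgue \<phi> \<longrightarrow> (\<forall>(\<Lambda> :: nat set) (l :: nat \<Rightarrow> real).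
       frame_sequence lebesgue (real_modulations l \<phi>) \<Lambda> \<longrightarrow>
       finite_union_of (riesz_basic_sequence lebesgue (real_modulations l \<phi>)) \<Lambda>),
     \<forall>\<Lambda> :: int set. \<forall>\<phi>\<in>L2 unit_leb. L2_nonzero unit_leb \<phi> \<longrightarrow>
       bessel_sequence unit_leb (int_modulations \<phi>) \<Lambda> \<longrightarrow>
       finite_union_of (frame_sequence unit_leb (int_modulations \<phi>)) \<Lambda>]"
  (is "all_equivalent [?P1, ?P2, ?P3, ?P4, ?P5]")
proof -
  have 12: ?P2 if ?P1
    using real_bessel_union_riesz that by blast
  have 24: ?P4 if ?P2
  proof (intro ballI allI impI)
    fix \<phi> \<Lambda> l assume "\<phi> \<in> L2 lebesgue" "L2_nonzero lebesgue \<phi>" "frame_sequence lebesgue (real_modulations l \<phi>) \<Lambda>"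
    moreover from this have "bessel_sequence lebesgue (real_modulations l \<phi>) \<Lambda>"
      unfolding frame_sequence_iff bessel_sequence_iff by blast
    ultimately show "finite_union_of (riesz_basic_sequence lebesgue (real_modulations l \<phi>)) \<Lambda>"
      using that by blast
  qed
  have 41: ?P1 if ?P4
  proof (intro allI impI)
    fix E :: "real set" assume E: "E \<in> sets lebesgue" "E \<subseteq> {0..1}" "0 < measure lebesgue E"
    have "finite_union_of (riesz_basic_sequence lebesgue (real_modulations enum_int (indicator E))) UNIV"
      using that indicator_L2[OF E] frame_sequence_indicator[OF E] by blast
    then obtain C where C: "finite C" "\<Union>C = UNIV"
      "\<And>A. A \<in> C \<Longrightarrow> riesz_basic_sequence lebesgue (real_modulations enum_int (indicator E)) A"
      by (rule finite_union_ofE) blast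
    show "finite_union_of (\<lambda>A. iso_onto_range unit_leb (proj E) (S A)) (UNIV :: int set)"
    proof (rule iso_cover_imp_finite_union[OF E(1), of "(`) int_decode ` C"])
      have "int_decode ` \<Union>C = UNIV" unfolding C(2) by (rule surj_int_decode)
      then show "UNIV \<subseteq> \<Union> ((`) int_decode ` C)" by (simp add: image_Union)
      fix A assume "A \<in> (`) int_decode ` C"
      then obtain A' where A': "A' \<in> C" "A = int_decode ` A'" by auto
      then obtain a where "0 < a" "synth_lower lebesgue (real_modulations enum_int (indicator E)) A' a"
        using C(3)[OF A'(1)] unfolding riesz_basic_sequence_iff by blast
      then show "\<exists>a>0. synth_lower unit_leb (E_modulations E) A a"
        using synth_enum_int(2)[of "indicator E" A' a] A'(2) by (auto simp: indicator_extend[OF E(2)])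
    qed (use C in auto)
  qed
  have 23: ?P3 if ?P2
  proof (intro ballI allI impI)
    fix \<phi> and \<Lambda> :: "int set"
    assume \<phi>: "\<phi> \<in> L2 unit_leb" "L2_nonzero unit_leb \<phi>" and b: "bessel_sequence unit_leb (int_modulations \<phi>) \<Lambda>"
    define \<phi>' where "\<phi>' = (\<lambda>t. \<phi> t * indicator {0..1} t)"
    have \<phi>'L: "\<phi>' \<in> L2 lebesgue" using \<phi>(1) by (simp add: L2_unit_iff \<phi>'_def)
    have "L2_norm lebesgue \<phi>' = L2_norm unit_leb \<phi>" by (simp add: L2_norm_unit \<phi>'_def)
    then have nz: "L2_nonzero lebesgue \<phi>'"
      using L2_norm_eq_0_iff[OF \<phi>(1)] L2_norm_eq_0_iff[OF \<phi>'L] \<phi>(2) by (simp add: L2_nonzero_def)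
    define \<Lambda>' where "\<Lambda>' = int_decode -` \<Lambda>"
    have \<Lambda>': "int_decode ` \<Lambda>' = \<Lambda>" unfolding \<Lambda>'_def using surj_int_decode by (rule surj_image_vimage_eq)
    have "bessel_sequence lebesgue (real_modulations enum_int \<phi>') \<Lambda>'"
      using b real_modulations_L2[OF \<phi>'L]
      unfolding bessel_sequence_iff \<phi>'_def synth_enum_int \<Lambda>' by blast
    then have "finite_union_of (riesz_basic_sequence lebesgue (real_modulations enum_int \<phi>')) \<Lambda>'"
      using that \<phi>'L nz by blast
    then obtain C where C: "finite C" "\<Union>C = \<Lambda>'"
      "\<And>A. A \<in> C \<Longrightarrow> riesz_basic_sequence lebesgue (real_modulations enum_int \<phi>') A"
      by (rule finite_union_ofE) blast
    show "finite_union_of (riesz_basic_sequence unit_leb (int_modulations \<phi>)) \<Lambda>"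
    proof (rule finite_union_of_cover[OF riesz_basic_sequence_subset])
      show "finite ((`) int_decode ` C)" using C by simp
      show "\<Lambda> \<subseteq> \<Union> ((`) int_decode ` C)" unfolding image_Union[symmetric] C(2) \<Lambda>' by simp
      fix A assume "A \<in> (`) int_decode ` C"
      then obtain A' where A': "A' \<in> C" "A = int_decode ` A'" by auto
      show "riesz_basic_sequence unit_leb (int_modulations \<phi>) A"
        using C(3)[OF A'(1)] int_modulations_L2[OF \<phi>(1)]
        unfolding riesz_basic_sequence_iff \<phi>'_def synth_enum_int A'(2) by blast
    qed
  qed
  have 35: ?P5 if ?P3
    using that riesz_imp_frame_sequence unfolding finite_union_of_def by meson
  have 51: ?P1 if ?P5
  proof (intro allI impI)
    fix E :: "real set" assume E: "E \<in> sets lebesgue" "E \<subseteq> {0..1}" "0 < measure lebesgue E"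
    have "bessel_sequence unit_leb (E_modulations E) {0..}"
      using int_modulations_indicator_L2[OF E(1)] int_modulations_upper[OF E(1)] zero_less_one
      unfolding bessel_sequence_iff by blast
    then have "finite_union_of (frame_sequence unit_leb (E_modulations E)) {0..}"
      using that indicator_L2[OF E] by blast
    then obtain C where C: "finite C" "\<Union>C = {0..}"
      "\<And>A. A \<in> C \<Longrightarrow> frame_sequence unit_leb (E_modulations E) A"
      by (rule finite_union_ofE) blast
    have low: "\<exists>a>0. synth_lower unit_leb (E_modulations E) A a" if "A \<in> C" for A
    proof -
      have "A \<subseteq> {0..}" using C(2) that by blast
      then show ?thesis
        using frame_sequence_nonneg_imp_riesz[OF E _ C(3)[OF that]] unfolding riesz_basic_sequence_iff by blast
    qed
    show "finite_union_of (\<lambda>A. iso_onto_range unit_leb (proj E) (S A)) (UNIV :: int set)"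
    proof (rule iso_cover_imp_finite_union[OF E(1), of "C \<union> (`) uminus ` C"])
      show "UNIV \<subseteq> \<Union> (C \<union> (`) uminus ` C)"
      proof
        fix n :: int
        show "n \<in> \<Union> (C \<union> (`) uminus ` C)"
        proof (cases "0 \<le> n")
          case True
          then have "n \<in> \<Union>C" using C(2) by simp
          then show ?thesis by auto
        next
          case False
          then have "- n \<in> \<Union>C" using C(2) by simp
          then obtain A where "A \<in> C" "- n \<in> A" by auto
          then show ?thesis by (auto intro!: bexI[of _ A] image_eqI[of _ _ "- n"])
        qed
      qed
      fix A assume "A \<in> C \<union> (`) uminus ` C"
      then show "\<exists>a>0. synth_lower unit_leb (E_modulations E) A a"
        using low synth_lower_reflect by blast
    qed (use C in auto)
  qed
  show ?thesis by (rule all_equivalent_cycles[OF 12 24 41 23 35 51])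
qed

end
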